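(* Let $k\ge 2$, $j\in\{1,\dots,k-1\}$, and let $d^{DV}_j(u)$ be the $k$-th order De Vylder type approximation of the $j$-th moment of the deficit at ruin $d_j(u):=\mathbb E[|U_T|^j\mid T<\infty]$: it is the same quantity computed for a compound Poisson reserve model $(U^{DV}_t)$ such that $\mathbb{E}[(U_t(u))^i]=\mathbb{E}[(U^{DV}_t(u))^i]$ for all $i=1,\dots,k$, $t\ge 0$ and $u\ge 0$. Suppose that both reserve models $(U_t)$ and $(U^{DV}_t)$ satisfy the following assumptions, written here for $(U_t)$ and analogously for $(U^{DV}_t)$: (A1) there exists $R>0$ with $\int_0^\infty e^{Rx}\frac{f_I(x)}{1+\theta}\,dx=1$; (A2) $m_k^{\exp}:=\int_0^\infty x^k e^{Rx}\frac{f_I(x)}{1+\theta}\,dx<\infty$; (A3) $h_I:=\sup_{x\ge 0} f_I(x)/\overline F_I(x)<\infty$. Then, for $u\ge0$ and $\theta>0$ in a bounded interval, $$d_j(u)-d^{DV}_j(u)=\mathcal O(1),$$ and, for the relative error, $$\frac{d_j(u)-d^{DV}_j(u)}{d_j(u)}=\mathcal O(1).$$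
   Context: Reserve model: $U_t=U_t(u)=u+ct-\sum_{i=1}^{N_t}Z_i$, where $u\ge0$ is the initial reserve, $c>0$ is the premium per unit time, $(N_t)_{t\ge0}$ is a Poisson process of intensity $\lambda>0$, and $(Z_i)_{i\ge1}$ are positive i.i.d. random variables, independent of $(N_t)$, with cumulative distribution function $F$ of unbounded support. Write $m_j:=\mathbb E(Z_1^j)$ and $\overline\Phi:=1-\Phi$ for any distribution function $\Phi$. Set $f_I(x):=\overline F(x)/m_1$, $F_I(x):=\int_0^x f_I(y)\,dy$, and $\theta:=\frac{c}{\lambda m_1}-1$ (safety loading coefficient). The time of ruin is $T=T(u):=\inf\{t\ge0:U_t<0\}$; the deficit at ruin is $|U_T|$. The model $(U^{DV}_t)$ is of the same form, with the same initial reserve $u$, and with all parameters and derived quantities defined in the same way and carrying the superscript $DV$ ($c^{DV},\lambda^{DV},F^{DV},m_j^{DV},\theta^{DV},f_I^{DV},F_I^{DV},R^{DV},T^{DV},\dots$). No particular form of the claim distribution $F^{DV}$ is assumed. Dependence on $\theta$: $\lambda$ and $F$ are fixed and $\theta$ varies through $c=(1+\theta)\lambda m_1$; the quantities $d_j,R,m_k^{\exp}$ depend implicitly on $\theta$. The moments $m_j^{DV}$ do not depend on $\theta$, and $\theta^{DV}$ depends linearly on $\theta$. Notation $\mathcal O$: $a(u,\theta)=\mathcal O(b(u,\theta))$ means that there is a constant $C\ge0$, independent of $(u,\theta)$, with $|a(u,\theta)|\le C|b(u,\theta)|$ for all $u\ge0$ and all $\theta>0$ in a bounded interval. The constant $C$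 may depend on the $m_j$'s, $m_k^{\exp}$ and $h_I$ and on the corresponding quantities of the approximating model (these are treated as constants, i.e. bounded over the range of $\theta$). *)

theory Defs
  imports "HOL-Probability.Probability"
begin

text \<open>
  The library has no Poisson process. As a counting process it starts at 0 and has
  nondecreasing right-continuous paths; its increments are independent and Poisson distributed.
  Only times \<open>t \<ge> 0\<close> matter. Subtraction of naturals does not truncate here, because the paths
  are nondecreasing.
\<close>

definition poisson_process :: "'a measure \<Rightarrow> real \<Rightarrow> (real \<Rightarrow> 'a \<Rightarrow> nat) \<Rightarrow> bool" where
  "poisson_process M l N \<longleftrightarrow>
     (\<forall>t\<ge>0. N t \<in> measurable M (count_space UNIV)) \<and>
     (\<forall>\<omega>\<in>space M. N 0 \<omega> = 0 \<and> mono_on {0..} (\<lambda>t. N t \<omega>) \<and>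
        (\<forall>t\<ge>0. ((\<lambda>s. N s \<omega>) \<longlongrightarrow> N t \<omega>) (at_right t))) \<and>
     (\<forall>s t. 0 \<le> s \<longrightarrow> s < t \<longrightarrow>
        distr M (count_space UNIV) (\<lambda>\<omega>. N t \<omega> - N s \<omega>) = measure_pmf (poisson_pmf (l * (t - s)))) \<and>
     (\<forall>\<tau> :: nat \<Rightarrow> real. 0 \<le> \<tau> 0 \<longrightarrow> mono \<tau> \<longrightarrow>
        prob_space.indep_vars M (\<lambda>_. count_space UNIV)
          (\<lambda>i \<omega>. N (\<tau> (Suc i)) \<omega> - N (\<tau> i) \<omega>) UNIV)"

text \<open>Claims are indexed from 1; \<open>claim X 0\<close> is never used.\<close>

record 'a model =
  sample :: "'a measure"
  premium :: real
  intensity :: real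
  arrivals :: "real \<Rightarrow> 'a \<Rightarrow> nat"
  claim :: "nat \<Rightarrow> 'a \<Rightarrow> real"

definition claim_cdf :: "'a model \<Rightarrow> real \<Rightarrow> real" where
  "claim_cdf X = cdf (distr (sample X) borel (claim X 1))"

text \<open>
  The last conjunct is the independence of the \<open>\<sigma>\<close>-algebras generated by the whole arrival
  process and by the whole claim sequence.
\<close>

definition reserve_model :: "'a model \<Rightarrow> bool" where
  "reserve_model X \<longleftrightarrow>
     prob_space (sample X) \<and> premium X > 0 \<and> intensity X > 0 \<and>
     poisson_process (sample X) (intensity X) (arrivals X) \<and>
     prob_space.indep_vars (sample X) (\<lambda>_. borel) (claim X) {1..} \<and>
     (\<forall>i\<ge>1. distr (sample X) borel (claim X i) = distr (sample X) borel (claim X 1)) \<and>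
     (\<forall>i\<ge>1. AE \<omega> in sample X. claim X i \<omega> > 0) \<and>
     (\<forall>x. claim_cdf X x < 1) \<and>
     prob_space.indep_set (sample X)
       (sets (vimage_algebra (space (sample X)) (\<lambda>\<omega>. \<lambda>t\<in>{0..}. arrivals X t \<omega>)
          (\<Pi>\<^sub>M t\<in>{0..}. count_space UNIV)))
       (sets (vimage_algebra (space (sample X)) (\<lambda>\<omega>. \<lambda>i\<in>{1..}. claim X i \<omega>)
          (\<Pi>\<^sub>M i\<in>{1..}. borel)))"

definition reserve :: "'a model \<Rightarrow> real \<Rightarrow> real \<Rightarrow> 'a \<Rightarrow> real" where
  "reserve X u t \<omega> = u + premium X * t - (\<Sum>i=1..arrivals X t \<omega>. claim X i \<omega>)"

definition reserve_moment :: "'a model \<Rightarrow> real \<Rightarrow> real \<Rightarrow> nat \<Rightarrow> real" where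
  "reserve_moment X u t i = (LINT \<omega>|sample X. reserve X u t \<omega> ^ i)"

text \<open>In \<open>ereal\<close> the infimum of the empty set is \<open>\<infinity>\<close>.\<close>

definition ruin_time :: "'a model \<Rightarrow> real \<Rightarrow> 'a \<Rightarrow> ereal" where
  "ruin_time X u \<omega> = Inf (ereal ` {t. 0 \<le> t \<and> reserve X u t \<omega> < 0})"

definition ruin_event :: "'a model \<Rightarrow> real \<Rightarrow> 'a set" where
  "ruin_event X u = {\<omega> \<in> space (sample X). ruin_time X u \<omega> < \<infinity>}"

definition deficit :: "'a model \<Rightarrow> real \<Rightarrow> 'a \<Rightarrow> real" where
  "deficit X u \<omega> = \<bar>reserve X u (real_of_ereal (ruin_time X u \<omega>)) \<omega>\<bar>"

definition deficit_moment :: "'a model \<Rightarrow> nat \<Rightarrow> real \<Rightarrow> real" where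
  "deficit_moment X j u =
     (LINT \<omega>:ruin_event X u|sample X. deficit X u \<omega> ^ j) / measure (sample X) (ruin_event X u)"

definition claim_moment :: "'a model \<Rightarrow> nat \<Rightarrow> real" where
  "claim_moment X j = (LINT \<omega>|sample X. claim X 1 \<omega> ^ j)"

definition loading :: "'a model \<Rightarrow> real" where
  "loading X = premium X / (intensity X * claim_moment X 1) - 1"

definition f_I :: "'a model \<Rightarrow> real \<Rightarrow> real" where
  "f_I X x = (1 - claim_cdf X x) / claim_moment X 1"

definition F_I :: "'a model \<Rightarrow> real \<Rightarrow> real" where
  "F_I X x = (LBINT y:{0..x}. f_I X y)"

text \<open>
  Since a Bochner integral is 0 if it does not exist, the value 1 in the next definition entails
  integrability, and also that the first claim moment is finite and nonzero.
  The positive solution is unique, because the integral is strictly increasing in \<open>r\<close>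
  where it is finite.
\<close>

definition adjustment_eq :: "'a model \<Rightarrow> real \<Rightarrow> bool" where
  "adjustment_eq X r \<longleftrightarrow> r > 0 \<and> (LBINT x:{0..}. exp (r * x) * (f_I X x / (1 + loading X))) = 1"

definition adjustment_coeff :: "'a model \<Rightarrow> real" where
  "adjustment_coeff X = (THE r. adjustment_eq X r)"

definition m_exp :: "'a model \<Rightarrow> nat \<Rightarrow> real" where
  "m_exp X k = (LBINT x:{0..}. x ^ k * exp (adjustment_coeff X * x) * (f_I X x / (1 + loading X)))"

definition h_I :: "'a model \<Rightarrow> real" where
  "h_I X = (SUP x\<in>{0..}. f_I X x / (1 - F_I X x))"

definition A1 :: "'a model \<Rightarrow> bool" where
  "A1 X \<longleftrightarrow> (\<exists>r. adjustment_eq X r)"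

definition A2 :: "'a model \<Rightarrow> nat \<Rightarrow> bool" where
  "A2 X k \<longleftrightarrow> set_integrable lborel {0..}
     (\<lambda>x. x ^ k * exp (adjustment_coeff X * x) * (f_I X x / (1 + loading X)))"

definition A3 :: "'a model \<Rightarrow> bool" where
  "A3 X \<longleftrightarrow> bdd_above ((\<lambda>x. f_I X x / (1 - F_I X x)) ` {0..})"

end

theory Submission
  imports Defs
begin

text \<open>
  Between two claims the reserve grows, so ruin can only happen at a claim, and seen at the claims
  the reserve is a random walk: the waiting times of the Poisson process are independent and
  exponential, and independent of the claims. For a penalty \<open>w\<close> of the deficit let
  \<open>Q w u\<close> be the expectation of \<open>w (deficit)\<close> on the event of ruin. Conditioning on the first
  claim makes \<open>Q w\<close> the least fixed point of a first-step operator (\<open>ruin_value_represents\<close>), and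
  \<open>d_j = Q (y ^ j) / Q 1\<close> (\<open>deficit_moment_eq\<close>).

  Integrated over the initial reserve, the first-step equation becomes a renewal equation
  \<open>Q = K Q + b\<close> whose kernel is the defective density \<open>f_I / (1 + \<theta>)\<close> of the ladder heights
  (\<open>renewal_equation\<close>). Multiplied by \<open>exp (R u)\<close> the kernel becomes a probability density \<open>g\<close> by
  (A1), with finite moments up to order \<open>k\<close> by (A2), and \<open>Q w u\<close> becomes \<open>exp (- R u)\<close> times an
  expectation over the overshoot, above the level \<open>u\<close>, of a renewal process with step density \<open>g\<close>.
  The \<open>j\<close>-th moment of this overshoot is bounded uniformly in \<open>u\<close> by moments of \<open>g\<close> of orders \<open>j\<close>
  and \<open>j + 1 \<le> k\<close>; an explicit Lyapunov function shows this directly from the renewal equation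
  (\<open>ruin_value_upper\<close>). If \<open>M\<close> bounds the mean overshoot, Jensen's inequality gives
  \<open>Q 1 u \<ge> exp (- R (u + M))\<close> (\<open>ruin_value_lower\<close>). In the quotient the factors \<open>exp (- R u)\<close>
  cancel. As \<open>\<theta>\<close> tends to 0 so does \<open>R\<close>, but the bounds do not degenerate: they rest on the
  \<open>k\<close>-th moment of \<open>g\<close> and on its mass beyond half the mean claim, which is at least
  \<open>1 / (2 (1 + \<theta>))\<close>. Hence \<open>d_j\<close> is bounded by a constant that depends on the mean claim and on bounds for
  \<open>\<theta>\<close> and \<open>m_exp\<close> (\<open>deficit_moment_bounds\<close>). This applies to both models, because equality of the
  first two moments of the reserves forces \<open>\<theta>\<^sup>D\<^sup>V\<close> to be a fixed multiple of \<open>\<theta>\<close>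
  (\<open>matched_loading\<close>), so that the absolute error is bounded.

  For the relative error \<open>d_j\<close> is bounded from below: by (A3) the mean of \<open>Z - v\<close> given \<open>Z > v\<close> is at
  least \<open>1 / h_I\<close> for every \<open>v\<close>, so a claim that causes ruin has conditional \<open>j\<close>-th overshoot moment at
  least \<open>(1 / h_I) ^ j\<close>, whatever the reserve before it (\<open>ruin_value_moment_lower\<close>).
\<close>

section \<open>Interarrival times of a Poisson process\<close>

lemma (in prob_space) prob_tendsto_eventually:
  assumes [measurable]: "\<And>m. A m \<in> events" "B \<in> events"
    and ev: "AE \<omega> in M. eventually (\<lambda>m. \<omega> \<in> A m \<longleftrightarrow> \<omega> \<in> B) sequentially"
  shows "(\<lambda>m::nat. prob (A m)) \<longlonglongrightarrow> prob B"
proof -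
  have "(\<lambda>m. \<integral>\<omega>. indicator (A m) \<omega> \<partial>M) \<longlonglongrightarrow> (\<integral>\<omega>. (indicator B \<omega> :: real) \<partial>M)"
  proof (rule integral_dominated_convergence[where w="\<lambda>_. 1"])
    show "AE \<omega> in M. (\<lambda>m. indicator (A m) \<omega>) \<longlonglongrightarrow> (indicator B \<omega> :: real)"
      using ev
    proof eventually_elim
      case (elim \<omega>)
      show ?case
        by (rule tendsto_eventually) (use elim in \<open>eventually_elim, auto simp: indicator_def\<close>)
    qed
  qed (auto simp: indicator_def)
  then show ?thesis by simp
qed

lemma (in prob_space) measurable_eq_event:
  assumes [measurable]: "f \<in> measurable M (count_space UNIV)" "g \<in> measurable M (count_space UNIV)"
  shows "{\<omega> \<in> space M. (f \<omega>::nat) = g \<omega>} \<in> events"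
proof -
  have "{\<omega> \<in> space M. f \<omega> = g \<omega>} = (\<Union>n. (f -` {n} \<inter> space M) \<inter> (g -` {n} \<inter> space M))" by auto
  also have "\<dots> \<in> events" by (intro sets.countable_UN sets.Int measurable_sets[OF assms(1)] measurable_sets[OF assms(2)] image_subsetI) auto
  finally show ?thesis .
qed

text \<open>
  The default value on paths that stay below \<open>n\<close> keeps jump times measurable with respect to the
  \<open>\<sigma>\<close>-algebra of the arrivals.
\<close>
definition jump_time :: "(real \<Rightarrow> 'a \<Rightarrow> nat) \<Rightarrow> nat \<Rightarrow> 'a \<Rightarrow> real" where
  "jump_time N n \<omega> = (if \<exists>t\<ge>0. n \<le> N t \<omega> then Inf {t. 0 \<le> t \<and> n \<le> N t \<omega>} else 0)"

definition interarrival :: "(real \<Rightarrow> 'a \<Rightarrow> nat) \<Rightarrow> nat \<Rightarrow> 'a \<Rightarrow> real" where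
  "interarrival N n \<omega> = jump_time N (Suc n) \<omega> - jump_time N n \<omega>"

locale poisson = prob_space M for M :: "'a measure" +
  fixes l :: real and N :: "real \<Rightarrow> 'a \<Rightarrow> nat"
  assumes rate_pos: "l > 0" and process: "poisson_process M l N"
begin

lemma N_measurable [measurable]: "0 \<le> t \<Longrightarrow> N t \<in> measurable M (count_space UNIV)"
  using process unfolding poisson_process_def by blast

lemma N_0: "\<omega> \<in> space M \<Longrightarrow> N 0 \<omega> = 0"
  using process unfolding poisson_process_def by blast

lemma N_mono: "\<omega> \<in> space M \<Longrightarrow> 0 \<le> s \<Longrightarrow> s \<le> t \<Longrightarrow> N s \<omega> \<le> N t \<omega>"
  using process unfolding poisson_process_def mono_on_def by force

lemma N_right_constant:
  assumes "\<omega> \<in> space M" "0 \<le> t"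
  shows "\<exists>d>0. \<forall>s. t \<le> s \<longrightarrow> s < t + d \<longrightarrow> N s \<omega> = N t \<omega>"
proof -
  have "((\<lambda>s. N s \<omega>) \<longlongrightarrow> N t \<omega>) (at_right t)"
    using process assms unfolding poisson_process_def by blast
  then have "eventually (\<lambda>s. N s \<omega> = N t \<omega>) (at_right t)"
    by (simp add: tendsto_discrete)
  then obtain b where b: "b > t" "\<And>y. y > t \<Longrightarrow> y < b \<Longrightarrow> N y \<omega> = N t \<omega>"
    unfolding eventually_at_right_field by blast
  show ?thesis
    by (rule exI[of _ "b - t"]) (use b in \<open>force simp: le_less\<close>)
qed

lemma prob_increment:
  assumes "0 \<le> s" "s < t"
  shows "prob {\<omega> \<in> space M. N t \<omega> - N s \<omega> \<in> A} = measure (measure_pmf (poisson_pmf (l * (t - s)))) A"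
proof -
  have d: "distr M (count_space UNIV) (\<lambda>\<omega>. N t \<omega> - N s \<omega>) = measure_pmf (poisson_pmf (l * (t - s)))"
    using process assms unfolding poisson_process_def by blast
  have [measurable]: "N t \<in> measurable M (count_space UNIV)" "N s \<in> measurable M (count_space UNIV)"
    using assms by auto
  have "prob {\<omega> \<in> space M. N t \<omega> - N s \<omega> \<in> A}
      = measure (distr M (count_space UNIV) (\<lambda>\<omega>. N t \<omega> - N s \<omega>)) A"
    by (subst measure_distr) (auto intro!: arg_cong[where f=prob])
  then show ?thesis unfolding d .
qed

lemma prob_increment_eq:
  assumes "0 \<le> s" "s < t"
  shows "prob {\<omega> \<in> space M. N t \<omega> - N s \<omega> = k} = (l * (t - s)) ^ k / fact k * exp (- (l * (t - s)))"
  using prob_increment[OF assms, of "{k}"] rate_pos assms by (simp add: measure_pmf_single)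

lemma AE_unbounded: "AE \<omega> in M. \<forall>n. \<exists>t\<ge>0. n \<le> N t \<omega>"
  unfolding AE_all_countable
proof
  fix n :: nat
  let ?A = "{\<omega> \<in> space M. \<forall>m::nat. N (real m) \<omega> < n}"
  have "prob ?A \<le> (\<Sum>k<n. (l * (real m)) ^ k / fact k * exp (- (l * real m)))" if "m > 0" for m :: nat
  proof -
    have "prob ?A \<le> prob (\<Union>k<n. {\<omega> \<in> space M. N (real m) \<omega> - N 0 \<omega> = k})"
      by (rule finite_measure_mono) (auto simp: N_0)
    also have "\<dots> \<le> (\<Sum>k<n. prob {\<omega> \<in> space M. N (real m) \<omega> - N 0 \<omega> = k})"
      by (rule measure_UNION_le) auto
    also have "\<dots> = (\<Sum>k<n. (l * (real m)) ^ k / fact k * exp (- (l * real m)))"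
      using that by (simp add: prob_increment_eq)
    finally show ?thesis .
  qed
  moreover have "(\<lambda>m. \<Sum>k<n. (l * (real m)) ^ k / fact k * exp (- (l * real m))) \<longlonglongrightarrow> 0"
  proof (rule tendsto_null_sum)
    fix k
    have "filterlim (\<lambda>m. l * real m) at_top sequentially"
      using rate_pos by (intro filterlim_tendsto_pos_mult_at_top[OF tendsto_const] filterlim_real_sequentially) auto
    from filterlim_compose[OF tendsto_power_div_exp_0[of k] this]
    have "(\<lambda>m. (l * real m) ^ k / exp (l * real m) / fact k) \<longlonglongrightarrow> 0 / fact k"
      by (intro tendsto_divide) auto
    then show "(\<lambda>m. (l * (real m)) ^ k / fact k * exp (- (l * real m))) \<longlonglongrightarrow> 0"
      by (simp add: exp_minus field_simps)
  qed
  ultimately have "prob ?A \<le> 0"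
    by (intro tendsto_lowerbound[where f="\<lambda>m. \<Sum>k<n. (l * (real m)) ^ k / fact k * exp (- (l * real m))" and F=sequentially])
       (auto simp: eventually_sequentially intro!: exI[of _ 1])
  then have "prob ?A = 0" using measure_nonneg[of M ?A] by linarith
  moreover have "?A \<in> events" by measurable
  ultimately have "AE \<omega> in M. \<omega> \<notin> ?A" by (simp add: prob_eq_0)
  with AE_space show "AE \<omega> in M. \<exists>t\<ge>0. n \<le> N t \<omega>"
  proof eventually_elim
    case (elim \<omega>)
    then obtain m :: nat where "n \<le> N (real m) \<omega>" by (auto simp: not_less)
    then show ?case by (intro exI[of _ "real m"]) simp
  qed
qed

text \<open>
  The Poisson probability of at least two events is \<open>1 - (1 + x) exp (- x)\<close>, and \<open>exp (- x) \<ge> 1 - x\<close>.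
\<close>
lemma prob_two_jumps_le:
  assumes "0 \<le> s" "s < t"
  shows "prob {\<omega> \<in> space M. 2 \<le> N t \<omega> - N s \<omega>} \<le> (l * (t - s))\<^sup>2"
proof -
  define x where "x = l * (t - s)"
  have x: "x > 0" using rate_pos assms by (simp add: x_def)
  have [measurable]: "N t \<in> measurable M (count_space UNIV)" "N s \<in> measurable M (count_space UNIV)"
    using assms by auto
  have "measure (measure_pmf (poisson_pmf x)) {0, 1} = (1 + x) * exp (- x)"
    using x by (subst measure_measure_pmf_finite) (auto simp: algebra_simps)
  moreover have "measure (measure_pmf (poisson_pmf x)) {2..} = 1 - measure (measure_pmf (poisson_pmf x)) (- {2..})"
    by (subst measure_pmf.prob_compl[symmetric]) (auto simp: Compl_eq_Diff_UNIV double_diff)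
  moreover have "- {2..} = {0, 1::nat}" by auto
  ultimately have "measure (measure_pmf (poisson_pmf x)) {2..} = 1 - (1 + x) * exp (- x)" by simp
  also have "\<dots> \<le> 1 - (1 + x) * (1 - x)"
    using exp_ge_add_one_self[of "-x"] x by (intro diff_left_mono mult_left_mono) auto
  also have "\<dots> = x\<^sup>2" by (simp add: algebra_simps power2_eq_square)
  finally show ?thesis
    using prob_increment[OF assms, of "{2..}"] by (simp add: x_def)
qed

text \<open>
  A double jump in \<open>[0, K]\<close> puts two arrivals into one cell of every grid. For the grid of mesh
  \<open>h = 1 / (m + 1)\<close> the probability of this is at most \<open>K / h\<close> times \<open>(l h)\<^sup>2\<close>, which tends to 0.
\<close>
lemma AE_simple_jumps:
  "AE \<omega> in M. \<forall>t>0. \<exists>r\<ge>0. r < t \<and> N t \<omega> \<le> N r \<omega> + 1"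
proof -
  define D where "D K m = (\<Union>i<K * Suc m. {\<omega> \<in> space M. 2 \<le> N (real (Suc i) / real (Suc m)) \<omega> - N (real i / real (Suc m)) \<omega>})"
    for K m :: nat
  have [measurable]: "D K m \<in> events" for K m unfolding D_def by measurable
  have le: "prob (D K m) \<le> real K * l\<^sup>2 * (1 / real (Suc m))" for K m
  proof -
    have "prob (D K m) \<le> (\<Sum>i<K * Suc m. prob {\<omega> \<in> space M. 2 \<le> N (real (Suc i) / real (Suc m)) \<omega> - N (real i / real (Suc m)) \<omega>})"
      unfolding D_def by (rule measure_UNION_le) auto
    also have "\<dots> \<le> (\<Sum>i<K * Suc m. (l * (1 / real (Suc m)))\<^sup>2)"
    proof (rule sum_mono)
      fix i
      have "prob {\<omega> \<in> space M. 2 \<le> N (real (Suc i) / real (Suc m)) \<omega> - N (real i / real (Suc m)) \<omega>}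
         \<le> (l * (real (Suc i) / real (Suc m) - real i / real (Suc m)))\<^sup>2"
        by (rule prob_two_jumps_le) (auto simp: field_simps)
      also have "real (Suc i) / real (Suc m) - real i / real (Suc m) = 1 / real (Suc m)"
        by (simp add: field_simps)
      finally show "prob {\<omega> \<in> space M. 2 \<le> N (real (Suc i) / real (Suc m)) \<omega> - N (real i / real (Suc m)) \<omega>}
         \<le> (l * (1 / real (Suc m)))\<^sup>2" .
    qed
    also have "\<dots> = real K * l\<^sup>2 * (1 / real (Suc m))"
      by (simp only: sum_constant card_lessThan of_nat_mult power2_eq_square) (simp add: field_simps del: of_nat_Suc)
    finally show ?thesis .
  qed
  have "AE \<omega> in M. \<forall>K. \<exists>m. \<omega> \<notin> D K m"
    unfolding AE_all_countable
  proof
    fix K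
    have "prob (\<Inter>m. D K m) \<le> 0"
    proof (rule tendsto_lowerbound[where F=sequentially])
      show "(\<lambda>m. real K * l\<^sup>2 * (1 / real (Suc m))) \<longlonglongrightarrow> 0"
        using tendsto_mult_right_zero[OF LIMSEQ_inverse_real_of_nat] by (simp add: inverse_eq_divide)
      show "\<forall>\<^sub>F m in sequentially. prob (\<Inter>m. D K m) \<le> real K * l\<^sup>2 * (1 / real (Suc m))"
      proof (intro always_eventually allI)
        fix m show "prob (\<Inter>m. D K m) \<le> real K * l\<^sup>2 * (1 / real (Suc m))"
          by (rule order_trans[OF finite_measure_mono le[of K m]]) auto
      qed
    qed simp
    then have "prob (\<Inter>m. D K m) = 0" using measure_nonneg[of M "\<Inter>m. D K m"] by linarith
    then have "AE \<omega> in M. \<omega> \<notin> (\<Inter>m. D K m)" by (subst (asm) prob_eq_0) auto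
    then show "AE \<omega> in M. \<exists>m. \<omega> \<notin> D K m" by eventually_elim auto
  qed
  with AE_space show ?thesis
  proof eventually_elim
    case (elim \<omega>)
    show ?case
    proof (intro allI impI)
      fix t :: real assume t: "t > 0"
      obtain K :: nat where K: "t \<le> real K" using real_arch_simple by blast
      obtain m where m: "\<omega> \<notin> D K m" using elim by blast
      define i where "i = nat (\<lceil>t * real (Suc m)\<rceil> - 1)"
      have c1: "\<lceil>t * real (Suc m)\<rceil> \<ge> 1" using t by (simp add: le_ceiling_iff)
      have ir: "real i = of_int \<lceil>t * real (Suc m)\<rceil> - 1" using c1 by (simp add: i_def)
      have i1: "real i < t * real (Suc m)" "t * real (Suc m) \<le> real i + 1"
        using ceiling_correct[of "t * real (Suc m)"] unfolding ir by linarith+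
      have "t * real (Suc m) \<le> real (K * Suc m)" using K mult_right_mono[of t "real K" "real (Suc m)"] by (simp del: of_nat_Suc mult_Suc_right)
      then have "real i < real (K * Suc m)" using i1(1) by linarith
      then have "i < K * Suc m" by (simp only: of_nat_less_iff)
      then have "\<not> 2 \<le> N (real (Suc i) / real (Suc m)) \<omega> - N (real i / real (Suc m)) \<omega>"
        using m elim(1) unfolding D_def by blast
      moreover have "N t \<omega> \<le> N (real (Suc i) / real (Suc m)) \<omega>"
        using i1 t elim(1) by (intro N_mono) (auto simp: field_simps)
      ultimately have "N t \<omega> \<le> N (real i / real (Suc m)) \<omega> + 1" by linarith
      moreover have "real i / real (Suc m) < t" using i1 by (simp add: field_simps)
      ultimately show "\<exists>r\<ge>0. r < t \<and> N t \<omega> \<le> N r \<omega> + 1"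
        by (intro exI[of _ "real i / real (Suc m)"]) auto
    qed
  qed
qed

text \<open>
  Right continuity makes the infimum in the definition of a jump time attained.
\<close>
lemma jump_time_le_iff:
  assumes "\<omega> \<in> space M" "\<exists>t\<ge>0. n \<le> N t \<omega>" "0 \<le> t"
  shows "jump_time N n \<omega> \<le> t \<longleftrightarrow> n \<le> N t \<omega>"
proof -
  let ?S = "{t. 0 \<le> t \<and> n \<le> N t \<omega>}"
  have ne: "?S \<noteq> {}" and bb: "bdd_below ?S" using assms by (auto intro!: bdd_belowI[of _ 0])
  have I0: "0 \<le> Inf ?S" using ne by (intro cInf_greatest) auto
  obtain d where d: "d > 0" "\<And>s. Inf ?S \<le> s \<Longrightarrow> s < Inf ?S + d \<Longrightarrow> N s \<omega> = N (Inf ?S) \<omega>"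
    using N_right_constant[OF assms(1) I0] by blast
  obtain s where s: "s \<in> ?S" "s < Inf ?S + d"
    using cInf_lessD[OF ne, of "Inf ?S + d"] d by auto
  have "Inf ?S \<le> s" using s bb by (intro cInf_lower) auto
  with d(2)[OF this s(2)] s have "n \<le> N (Inf ?S) \<omega>" by auto
  moreover have "jump_time N n \<omega> = Inf ?S" using assms by (auto simp: jump_time_def)
  ultimately show ?thesis
    using N_mono[OF assms(1) I0, of t] cInf_lower[OF _ bb, of t] assms(3) by auto
qed

lemma jump_time_nonneg: "0 \<le> jump_time N n \<omega>"
  unfolding jump_time_def by (auto intro!: cInf_greatest)

lemma jump_time_0: "\<omega> \<in> space M \<Longrightarrow> jump_time N 0 \<omega> = 0"
  using jump_time_le_iff[of \<omega> 0 0] jump_time_nonneg[of 0 \<omega>] by force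

lemma jump_time_measurable:
  assumes sp: "space A = space M" and A [measurable]: "\<And>t. 0 \<le> t \<Longrightarrow> N t \<in> measurable A (count_space UNIV)"
  shows "jump_time N n \<in> borel_measurable A"
proof (rule borel_measurableI_le)
  fix a :: real
  show "{\<omega> \<in> space A. jump_time N n \<omega> \<le> a} \<in> sets A"
  proof (cases "a < 0")
    case True
    have "\<not> jump_time N n \<omega> \<le> a" for \<omega> using jump_time_nonneg[of n \<omega>] True by linarith
    then have "{\<omega> \<in> space A. jump_time N n \<omega> \<le> a} = {}" by auto
    then show ?thesis by (simp only: sets.empty_sets)
  next
    case False
    have "{\<omega> \<in> space A. jump_time N n \<omega> \<le> a}
        = {\<omega> \<in> space A. n \<le> N a \<omega> \<or> (\<forall>m::nat. N (real m) \<omega> < n)}"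
    proof (intro Collect_cong conj_cong refl)
      fix \<omega> assume w: "\<omega> \<in> space A"
      show "(jump_time N n \<omega> \<le> a) = (n \<le> N a \<omega> \<or> (\<forall>m::nat. N (real m) \<omega> < n))"
      proof (cases "\<exists>t\<ge>0. n \<le> N t \<omega>")
        case True
        then obtain t where t: "t \<ge> 0" "n \<le> N t \<omega>" by blast
        obtain m :: nat where "t \<le> real m" using real_arch_simple by blast
        then have "n \<le> N (real m) \<omega>" using N_mono[of \<omega> t "real m"] t w sp by auto
        then show ?thesis using jump_time_le_iff[OF _ True, of a] w sp False by (metis linorder_not_le)
      next
        case F: False
        have "\<not> n \<le> N (real m) \<omega>" for m :: nat using F of_nat_0_le_iff by blast
        moreover have "jump_time N n \<omega> = 0" unfolding jump_time_def using F by (rule if_not_P)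
        ultimately show ?thesis using False by (simp add: not_le)
      qed
    qed
    also have "\<dots> \<in> sets A"
    proof -
      have [measurable]: "N a \<in> measurable A (count_space UNIV)" "\<And>m::nat. N (real m) \<in> measurable A (count_space UNIV)"
        using A False by auto
      show ?thesis by measurable
    qed
    finally show ?thesis .
  qed
qed

lemma jump_time_borel [measurable]: "jump_time N n \<in> borel_measurable M"
  by (rule jump_time_measurable) auto

lemma AE_count_at_jump: "AE \<omega> in M. (\<forall>n. \<exists>t\<ge>0. n \<le> N t \<omega>) \<and> (\<forall>n. N (jump_time N n \<omega>) \<omega> = n)"
  using AE_space AE_unbounded AE_simple_jumps
proof eventually_elim
  case (elim \<omega>)
  have iff: "jump_time N n \<omega> \<le> t \<longleftrightarrow> n \<le> N t \<omega>" if "0 \<le> t" for n t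
    using jump_time_le_iff[OF elim(1) _ that] elim(2) by blast
  have "N (jump_time N n \<omega>) \<omega> = n" for n
  proof (cases "jump_time N n \<omega> = 0")
    case True
    then have "n \<le> N 0 \<omega>" using iff[of 0 n] by simp
    then show ?thesis using True N_0[OF elim(1)] by simp
  next
    case False
    then have pos: "jump_time N n \<omega> > 0" using jump_time_nonneg[of n \<omega>] by simp
    then obtain r where r: "r \<ge> 0" "r < jump_time N n \<omega>" "N (jump_time N n \<omega>) \<omega> \<le> N r \<omega> + 1"
      using elim(3) by blast
    then have "N r \<omega> < n" using iff[of r n] by (simp add: not_le)
    moreover have "n \<le> N (jump_time N n \<omega>) \<omega>" using iff[of "jump_time N n \<omega>" n] pos by simp
    ultimately show ?thesis using r by simp
  qed
  then show ?case using elim(2) by blast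
qed


text \<open>
  The values on the grid up to time \<open>i h\<close> are sums of increments that precede \<open>i h\<close>, hence independent
  of the increment after \<open>i h\<close>. Any predicate \<open>P\<close> of them is measurable, because finitely many
  increments take values in a countable product. The strong Markov
  property below is a limit of such events.
\<close>
lemma grid_increment_independent:
  fixes i :: nat and P :: "(nat \<Rightarrow> nat) \<Rightarrow> bool"
  assumes h: "0 \<le> h" and s: "0 < s"
  shows "{\<omega> \<in> space M. P (\<lambda>j. N (real (min j i) * h) \<omega>)} \<in> events"
    and "prob {\<omega> \<in> space M. P (\<lambda>j. N (real (min j i) * h) \<omega>) \<and> N (real i * h + s) \<omega> = N (real i * h) \<omega>}
       = prob {\<omega> \<in> space M. P (\<lambda>j. N (real (min j i) * h) \<omega>)} * exp (- l * s)"
proof -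
  define \<tau> where "\<tau> k = (if k \<le> i then real k * h else real i * h + s)" for k
  define inc where "inc k \<omega> = N (\<tau> (Suc k)) \<omega> - N (\<tau> k) \<omega>" for k \<omega>
  have mono: "mono \<tau>"
    unfolding \<tau>_def by (rule monoI) (use h s in \<open>auto intro: mult_right_mono intro!: add_increasing2\<close>)
  have \<tau>0: "\<tau> 0 = 0" by (simp add: \<tau>_def)
  have \<tau>pos: "0 \<le> \<tau> k" for k using h s by (simp add: \<tau>_def)
  have ind: "indep_vars (\<lambda>_. count_space UNIV) inc UNIV"
    using process mono \<tau>0 unfolding poisson_process_def inc_def by simp
  have [measurable]: "inc k \<in> measurable M (count_space UNIV)" for k
    using ind by (simp add: indep_vars_def)
  have N_sum: "N (\<tau> j) \<omega> = (\<Sum>k<j. inc k \<omega>)" if "\<omega> \<in> space M" for j \<omega>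
  proof (induction j)
    case 0 then show ?case using N_0[OF that] \<tau>0 by simp
  next
    case (Suc j)
    have "N (\<tau> j) \<omega> \<le> N (\<tau> (Suc j)) \<omega>"
      using mono by (intro N_mono[OF that \<tau>pos]) (auto dest: monoD[of \<tau> j "Suc j"])
    then show ?case using Suc by (simp add: inc_def)
  qed
  let ?L = "PiM {..<i} (\<lambda>_. count_space (UNIV :: nat set))" and ?R = "PiM {i} (\<lambda>_. count_space (UNIV :: nat set))"
  let ?Q = "\<lambda>f. P (\<lambda>j. \<Sum>k<min j i. f k)"
  have grid: "N (real (min j i) * h) \<omega> = (\<Sum>k<min j i. (\<lambda>k\<in>{..<i}. inc k \<omega>) k)" if "\<omega> \<in> space M" for j \<omega>
    using N_sum[OF that, of "min j i"] by (simp add: \<tau>_def)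
  have last: "N (real i * h + s) \<omega> = N (real i * h) \<omega> \<longleftrightarrow> (\<lambda>k\<in>{i}. inc k \<omega>) i = 0" if "\<omega> \<in> space M" for \<omega>
    using N_mono[OF that \<tau>pos, of i "real i * h + s"] s h that by (auto simp: inc_def \<tau>_def)
  have PL: "{f \<in> space ?L. ?Q f} \<in> sets ?L"
  proof (rule sets.countable)
    fix f assume "f \<in> {f \<in> space ?L. ?Q f}"
    then have "f \<in> PiE {..<i} (\<lambda>_. UNIV)" by (simp add: space_PiM)
    then have "{f} = PiE {..<i} (\<lambda>k. {f k})"
      by (subst PiE_singleton) (auto simp: PiE_def)
    also have "\<dots> \<in> sets ?L" by (intro sets_PiM_I_finite) auto
    finally show "{f} \<in> sets ?L" .
  next
    have "countable (PiE {..<i} (\<lambda>_. UNIV :: nat set))" by (intro countable_PiE) auto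
    then show "countable {f \<in> space ?L. ?Q f}"
      by (rule countable_subset[rotated]) (auto simp: space_PiM)
  qed
  have PR: "{f \<in> space ?R. f i = 0} \<in> sets ?R" by measurable
  have eqL: "{\<omega> \<in> space M. P (\<lambda>j. N (real (min j i) * h) \<omega>)}
      = (\<lambda>\<omega>. \<lambda>k\<in>{..<i}. inc k \<omega>) -` {f \<in> space ?L. ?Q f} \<inter> space M"
    using grid by (auto simp: space_PiM)
  have mL: "(\<lambda>\<omega>. \<lambda>k\<in>{..<i}. inc k \<omega>) \<in> measurable M ?L" by measurable
  show A: "{\<omega> \<in> space M. P (\<lambda>j. N (real (min j i) * h) \<omega>)} \<in> events"
    unfolding eqL by (rule measurable_sets[OF mL PL])
  have "indep_var ?L (\<lambda>\<omega>. \<lambda>k\<in>{..<i}. inc k \<omega>) ?R (\<lambda>\<omega>. \<lambda>k\<in>{i}. inc k \<omega>)"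
    by (rule indep_var_restrict[OF ind]) auto
  from indep_varD[OF this PL PR]
  have "prob ((\<lambda>x. (\<lambda>k\<in>{..<i}. inc k x, \<lambda>k\<in>{i}. inc k x)) -` ({f \<in> space ?L. ?Q f} \<times> {f \<in> space ?R. f i = 0}) \<inter> space M)
    = prob ((\<lambda>\<omega>. \<lambda>k\<in>{..<i}. inc k \<omega>) -` {f \<in> space ?L. ?Q f} \<inter> space M)
      * prob ((\<lambda>\<omega>. \<lambda>k\<in>{i}. inc k \<omega>) -` {f \<in> space ?R. f i = 0} \<inter> space M)" .
  moreover have "(\<lambda>x. (\<lambda>k\<in>{..<i}. inc k x, \<lambda>k\<in>{i}. inc k x)) -` ({f \<in> space ?L. ?Q f} \<times> {f \<in> space ?R. f i = 0}) \<inter> space M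
    = {\<omega> \<in> space M. P (\<lambda>j. N (real (min j i) * h) \<omega>) \<and> N (real i * h + s) \<omega> = N (real i * h) \<omega>}"
    using grid last by (auto simp: space_PiM)
  moreover have "(\<lambda>\<omega>. \<lambda>k\<in>{i}. inc k \<omega>) -` {f \<in> space ?R. f i = 0} \<inter> space M
    = {\<omega> \<in> space M. N (real i * h + s) \<omega> - N (real i * h) \<omega> = 0}"
    by (auto simp: space_PiM inc_def \<tau>_def)
  moreover have "prob {\<omega> \<in> space M. N (real i * h + s) \<omega> - N (real i * h) \<omega> = 0} = exp (- l * s)"
    using h s by (subst prob_increment_eq) auto
  ultimately show "prob {\<omega> \<in> space M. P (\<lambda>j. N (real (min j i) * h) \<omega>) \<and> N (real i * h + s) \<omega> = N (real i * h) \<omega>}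
       = prob {\<omega> \<in> space M. P (\<lambda>j. N (real (min j i) * h) \<omega>)} * exp (- l * s)"
    unfolding eqL by simp
qed

text \<open>
  The index \<open>\<iota>\<close> of the first grid point with at least \<open>n\<close> arrivals takes countably many values, and
  the event that it equals \<open>i\<close> depends on the grid up to \<open>i h\<close>. Summing over \<open>i\<close> gives the strong
  Markov property at the \<open>n\<close>-th jump time rounded up to the grid. The second half of \<open>Q\<close> says that
  the \<open>k\<close>-th jump time, rounded up, lies before \<open>x k\<close>.
\<close>
lemma prob_grid_passage:
  fixes n :: nat and x :: "nat \<Rightarrow> real"
  assumes h: "0 < h" and s: "0 < s"
  defines "\<iota> \<equiv> \<lambda>\<omega>. LEAST i. n \<le> N (real i * h) \<omega>"
  defines "Q \<equiv> \<lambda>\<omega>. (\<exists>i. n \<le> N (real i * h) \<omega>) \<and> (\<forall>k\<in>{1..n}. \<exists>j. real j * h < x k \<and> k \<le> N (real j * h) \<omega>)"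
  shows "{\<omega> \<in> space M. Q \<omega>} \<in> events"
    and "{\<omega> \<in> space M. Q \<omega> \<and> N (real (\<iota> \<omega>) * h + s) \<omega> = N (real (\<iota> \<omega>) * h) \<omega>} \<in> events"
    and "prob {\<omega> \<in> space M. Q \<omega> \<and> N (real (\<iota> \<omega>) * h + s) \<omega> = N (real (\<iota> \<omega>) * h) \<omega>}
      = prob {\<omega> \<in> space M. Q \<omega>} * exp (- l * s)"
proof -
  define P where "P i v \<longleftrightarrow> n \<le> v i \<and> (\<forall>j<i. v j < n) \<and> (\<forall>k\<in>{1..n}. \<exists>j. real j * h < x k \<and> k \<le> v j)"
    for i :: nat and v :: "nat \<Rightarrow> nat"
  define A where "A i = {\<omega> \<in> space M. P i (\<lambda>j. N (real (min j i) * h) \<omega>)}" for i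
  define B where "B i = {\<omega> \<in> space M. P i (\<lambda>j. N (real (min j i) * h) \<omega>) \<and> N (real i * h + s) \<omega> = N (real i * h) \<omega>}" for i
  have Aev [measurable]: "A i \<in> events" for i
    unfolding A_def using h s by (intro grid_increment_independent) auto
  have "B i = A i \<inter> {\<omega> \<in> space M. N (real i * h + s) \<omega> = N (real i * h) \<omega>}" for i
    by (auto simp: A_def B_def)
  moreover have "{\<omega> \<in> space M. N (real i * h + s) \<omega> = N (real i * h) \<omega>} \<in> events" for i
  proof -
    have [measurable]: "N (real i * h + s) \<in> measurable M (count_space UNIV)" "N (real i * h) \<in> measurable M (count_space UNIV)"
      using h s by auto
    then show ?thesis by (rule measurable_eq_event)
  qed
  ultimately have Bev [measurable]: "B i \<in> events" for i by auto
  have pB: "prob (B i) = prob (A i) * exp (- l * s)" for i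
    unfolding A_def B_def using h s by (intro grid_increment_independent) auto
  have key: "P i (\<lambda>j. N (real (min j i) * h) \<omega>) \<longleftrightarrow> Q \<omega> \<and> \<iota> \<omega> = i" if w: "\<omega> \<in> space M" for \<omega> i
  proof
    assume *: "P i (\<lambda>j. N (real (min j i) * h) \<omega>)"
    have "\<iota> \<omega> = i"
      unfolding \<iota>_def
    proof (rule Least_equality)
      show "n \<le> N (real i * h) \<omega>" using * by (simp add: P_def)
    next
      fix j assume "n \<le> N (real j * h) \<omega>"
      then show "i \<le> j" using * unfolding P_def by (metis less_imp_le_nat min.absorb1 not_le)
    qed
    moreover have "Q \<omega>"
      unfolding Q_def
    proof (intro conjI ballI)
      show "\<exists>i. n \<le> N (real i * h) \<omega>" using * by (auto simp: P_def)
      fix k assume "k \<in> {1..n}"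
      then obtain j where j: "real j * h < x k" "k \<le> N (real (min j i) * h) \<omega>" using * unfolding P_def by blast
      have "real (min j i) * h \<le> real j * h" using h by (intro mult_right_mono) auto
      then show "\<exists>j. real j * h < x k \<and> k \<le> N (real j * h) \<omega>"
        using j by (intro exI[of _ "min j i"]) auto
    qed
    ultimately show "Q \<omega> \<and> \<iota> \<omega> = i" by blast
  next
    assume *: "Q \<omega> \<and> \<iota> \<omega> = i"
    then have ni: "n \<le> N (real i * h) \<omega>"
      unfolding Q_def \<iota>_def by (metis (mono_tags, lifting) LeastI)
    have lt: "N (real j * h) \<omega> < n" if "j < i" for j
      using not_less_Least[of j "\<lambda>i. n \<le> N (real i * h) \<omega>"] that * by (auto simp: \<iota>_def not_le)
    show "P i (\<lambda>j. N (real (min j i) * h) \<omega>)"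
      unfolding P_def
    proof (intro conjI ballI allI impI)
      show "n \<le> N (real (min i i) * h) \<omega>" using ni by simp
      show "N (real (min j i) * h) \<omega> < n" if "j < i" for j using lt that by simp
      fix k assume k: "k \<in> {1..n}"
      then obtain j where j: "real j * h < x k" "k \<le> N (real j * h) \<omega>" using * unfolding Q_def by blast
      show "\<exists>j. real j * h < x k \<and> k \<le> N (real (min j i) * h) \<omega>"
        using j k ni by (intro exI[of _ j]) (auto simp: min_def)
    qed
  qed
  have QA: "{\<omega> \<in> space M. Q \<omega>} = (\<Union>i. A i)" unfolding A_def using key by auto
  have QB: "{\<omega> \<in> space M. Q \<omega> \<and> N (real (\<iota> \<omega>) * h + s) \<omega> = N (real (\<iota> \<omega>) * h) \<omega>} = (\<Union>i. B i)"
    unfolding B_def using key by auto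
  show "{\<omega> \<in> space M. Q \<omega>} \<in> events" unfolding QA by measurable
  show "{\<omega> \<in> space M. Q \<omega> \<and> N (real (\<iota> \<omega>) * h + s) \<omega> = N (real (\<iota> \<omega>) * h) \<omega>} \<in> events"
    unfolding QB by measurable
  have "disjoint_family A" unfolding A_def disjoint_family_on_def using key by auto
  then have "(\<lambda>i. prob (A i)) sums prob (\<Union>i. A i)" by (intro finite_measure_UNION) auto
  then have "(\<lambda>i. prob (A i) * exp (- l * s)) sums (prob (\<Union>i. A i) * exp (- l * s))" by (rule sums_mult2)
  moreover have "disjoint_family B" unfolding B_def disjoint_family_on_def using key by auto
  then have "(\<lambda>i. prob (B i)) sums prob (\<Union>i. B i)" by (intro finite_measure_UNION) auto
  ultimately show "prob {\<omega> \<in> space M. Q \<omega> \<and> N (real (\<iota> \<omega>) * h + s) \<omega> = N (real (\<iota> \<omega>) * h) \<omega>}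
      = prob {\<omega> \<in> space M. Q \<omega>} * exp (- l * s)"
    unfolding QA QB pB by (rule sums_unique2[symmetric])
qed

lemma eventually_grid_ge:
  fixes t d :: real
  assumes "0 \<le> t" "0 < d"
  shows "eventually (\<lambda>m. \<exists>i. t \<le> real i * (1 / real (Suc m)) \<and> real i * (1 / real (Suc m)) < t + d) sequentially"
proof -
  have "eventually (\<lambda>m. 1 / real (Suc m) < d) sequentially"
    using LIMSEQ_inverse_real_of_nat \<open>0 < d\<close> by (auto simp: inverse_eq_divide dest: order_tendstoD(2))
  then show ?thesis
  proof eventually_elim
    case (elim m)
    have c: "real (nat \<lceil>t * real (Suc m)\<rceil>) = of_int \<lceil>t * real (Suc m)\<rceil>" using assms by simp
    have "t * real (Suc m) \<le> real (nat \<lceil>t * real (Suc m)\<rceil>)" "real (nat \<lceil>t * real (Suc m)\<rceil>) < t * real (Suc m) + 1"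
      unfolding c using ceiling_correct[of "t * real (Suc m)"] by linarith+
    moreover have "t * real (Suc m) + 1 < (t + d) * real (Suc m)"
      using elim by (simp add: field_simps)
    ultimately show ?case
      by (intro exI[of _ "nat \<lceil>t * real (Suc m)\<rceil>"]) (simp add: field_simps)
  qed
qed

text \<open>
  Strong Markov property at the \<open>n\<close>-th jump. Along the grids of mesh \<open>1 / (m + 1)\<close> the rounded jump
  times converge from above; by right continuity of the paths, each of the two events in
  \<open>prob_grid_passage\<close> eventually agrees with its limit at almost every \<open>\<omega>\<close>.
\<close>
lemma interarrival_strong_markov:
  fixes n :: nat and x :: "nat \<Rightarrow> real"
  assumes s: "0 < s"
  shows "prob {\<omega> \<in> space M. (\<forall>k\<in>{1..n}. jump_time N k \<omega> < x k) \<and> s < interarrival N n \<omega>}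
    = prob {\<omega> \<in> space M. \<forall>k\<in>{1..n}. jump_time N k \<omega> < x k} * exp (- l * s)"
proof -
  define h where "h m = 1 / real (Suc m)" for m
  have h: "0 < h m" for m by (simp add: h_def)
  define Q where "Q m \<omega> \<longleftrightarrow> (\<exists>i. n \<le> N (real i * h m) \<omega>) \<and> (\<forall>k\<in>{1..n}. \<exists>j. real j * h m < x k \<and> k \<le> N (real j * h m) \<omega>)" for m \<omega>
  define \<iota> where "\<iota> m \<omega> = (LEAST i. n \<le> N (real i * h m) \<omega>)" for m \<omega>
  let ?A = "\<lambda>m. {\<omega> \<in> space M. Q m \<omega>}"
  let ?B = "\<lambda>m. {\<omega> \<in> space M. Q m \<omega> \<and> N (real (\<iota> m \<omega>) * h m + s) \<omega> = N (real (\<iota> m \<omega>) * h m) \<omega>}"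
  have ev: "?A m \<in> events" "?B m \<in> events" and eq: "prob (?B m) = prob (?A m) * exp (- l * s)" for m
    using prob_grid_passage[OF h s, of n m x] unfolding Q_def \<iota>_def by blast+
  have AE: "AE \<omega> in M. (\<forall>\<^sub>F m in sequentially. Q m \<omega> \<longleftrightarrow> (\<forall>k\<in>{1..n}. jump_time N k \<omega> < x k))
      \<and> (\<forall>\<^sub>F m in sequentially. N (real (\<iota> m \<omega>) * h m + s) \<omega> = N (real (\<iota> m \<omega>) * h m) \<omega> \<longleftrightarrow> s < interarrival N n \<omega>)"
    using AE_space AE_count_at_jump
  proof eventually_elim
    case (elim \<omega>)
    let ?T = "\<lambda>n. jump_time N n \<omega>"
    have iff: "?T n \<le> t \<longleftrightarrow> n \<le> N t \<omega>" if "0 \<le> t" for n t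
      using jump_time_le_iff[OF elim(1) _ that] elim(2) by blast
    have Tn: "0 \<le> ?T n" for n by (rule jump_time_nonneg)
    have hit: "\<exists>i. n \<le> N (real i * h m) \<omega>" for m
    proof -
      obtain i :: nat where "?T n / h m \<le> real i" using real_arch_simple by blast
      then have "?T n \<le> real i * h m" using h[of m] by (simp add: field_simps)
      then show ?thesis using iff[of "real i * h m" n] h[of m] by auto
    qed
    have "\<forall>\<^sub>F m in sequentially. \<forall>k\<in>{1..n}. (\<exists>j. real j * h m < x k \<and> k \<le> N (real j * h m) \<omega>) \<longleftrightarrow> ?T k < x k"
    proof (intro eventually_ball_finite ballI)
      fix k assume "k \<in> {1..n}"
      show "\<forall>\<^sub>F m in sequentially. (\<exists>j. real j * h m < x k \<and> k \<le> N (real j * h m) \<omega>) \<longleftrightarrow> ?T k < x k"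
      proof (cases "?T k < x k")
        case True
        from eventually_grid_ge[OF Tn[of k], of "x k - ?T k"] True
        show ?thesis
        proof (simp, elim eventually_mono, clarsimp simp flip: of_nat_Suc)
          fix m i assume "?T k \<le> real i / real (Suc m)" "real i / real (Suc m) < x k"
          then show "\<exists>j. real j * h m < x k \<and> k \<le> N (real j * h m) \<omega>"
            using iff[of "real i * h m" k] h[of m] by (intro exI[of _ i]) (auto simp: h_def)
        qed
      next
        case False
        have "\<not> (real j * h m < x k \<and> k \<le> N (real j * h m) \<omega>)" for j m
          using iff[of "real j * h m" k] h[of m] False by auto
        then show ?thesis using False by simp
      qed
    qed simp
    then have 1: "\<forall>\<^sub>F m in sequentially. Q m \<omega> \<longleftrightarrow> (\<forall>k\<in>{1..n}. ?T k < x k)"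
      by eventually_elim (use hit in \<open>auto simp: Q_def\<close>)
    \<comment> \<open>the path is constant on short intervals to the right of the jump time and of the jump time plus \<open>s\<close>\<close>
    obtain d1 where d1: "d1 > 0" "\<And>t. ?T n \<le> t \<Longrightarrow> t < ?T n + d1 \<Longrightarrow> N t \<omega> = N (?T n) \<omega>"
      using N_right_constant[OF elim(1) Tn] by blast
    obtain d2 where d2: "d2 > 0" "\<And>t. ?T n + s \<le> t \<Longrightarrow> t < ?T n + s + d2 \<Longrightarrow> N t \<omega> = N (?T n + s) \<omega>"
      using N_right_constant[OF elim(1), of "?T n + s"] Tn[of n] s by auto
    have "\<forall>\<^sub>F m in sequentially. N (real (\<iota> m \<omega>) * h m + s) \<omega> = N (real (\<iota> m \<omega>) * h m) \<omega> \<longleftrightarrow> s < interarrival N n \<omega>"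
    proof (rule eventually_mono[OF eventually_grid_ge[OF Tn[of n], of "min d1 d2"]])
      show "0 < min d1 d2" using d1(1) d2(1) by simp
      fix m assume "\<exists>i. ?T n \<le> real i * (1 / real (Suc m)) \<and> real i * (1 / real (Suc m)) < ?T n + min d1 d2"
      then obtain i where i: "?T n \<le> real i * h m" "real i * h m < ?T n + min d1 d2" unfolding h_def by blast
      have "n \<le> N (real (\<iota> m \<omega>) * h m) \<omega>" unfolding \<iota>_def using hit by (rule LeastI_ex)
      then have ge: "?T n \<le> real (\<iota> m \<omega>) * h m" using iff[of "real (\<iota> m \<omega>) * h m" n] h[of m] by auto
      have "n \<le> N (real i * h m) \<omega>" using i iff[of "real i * h m" n] h[of m] by auto
      then have "\<iota> m \<omega> \<le> i" unfolding \<iota>_def by (rule Least_le)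
      then have "real (\<iota> m \<omega>) * h m \<le> real i * h m" using h[of m] by (intro mult_right_mono) auto
      then have lt: "real (\<iota> m \<omega>) * h m < ?T n + min d1 d2" using i by linarith
      have "N (real (\<iota> m \<omega>) * h m) \<omega> = n" using d1(2)[OF ge] lt elim(2) by auto
      moreover have "N (real (\<iota> m \<omega>) * h m + s) \<omega> = N (?T n + s) \<omega>"
        by (rule d2(2)) (use ge lt in linarith)+
      moreover have "n \<le> N (?T n + s) \<omega>" using iff[of "?T n + s" n] s Tn[of n] by auto
      moreover have "?T (Suc n) \<le> ?T n + s \<longleftrightarrow> Suc n \<le> N (?T n + s) \<omega>" using iff[of "?T n + s"] s Tn[of n] by auto
      ultimately show "N (real (\<iota> m \<omega>) * h m + s) \<omega> = N (real (\<iota> m \<omega>) * h m) \<omega> \<longleftrightarrow> s < interarrival N n \<omega>"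
        unfolding interarrival_def by linarith
    qed
    with 1 show ?case by blast
  qed
  have "(\<lambda>m. prob (?A m)) \<longlonglongrightarrow> prob {\<omega> \<in> space M. \<forall>k\<in>{1..n}. jump_time N k \<omega> < x k}"
    by (rule prob_tendsto_eventually[OF ev(1)]) (measurable, use AE AE_space in eventually_elim, auto)
  then have "(\<lambda>m. prob (?B m)) \<longlonglongrightarrow> prob {\<omega> \<in> space M. \<forall>k\<in>{1..n}. jump_time N k \<omega> < x k} * exp (- l * s)"
    unfolding eq by (rule tendsto_mult_right)
  moreover have "(\<lambda>m. prob (?B m)) \<longlonglongrightarrow> prob {\<omega> \<in> space M. (\<forall>k\<in>{1..n}. jump_time N k \<omega> < x k) \<and> s < interarrival N n \<omega>}"
  proof (rule prob_tendsto_eventually[OF ev(2)])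
    show "{\<omega> \<in> space M. (\<forall>k\<in>{1..n}. jump_time N k \<omega> < x k) \<and> s < interarrival N n \<omega>} \<in> events"
      unfolding interarrival_def by measurable
    show "AE \<omega> in M. \<forall>\<^sub>F m in sequentially. (\<omega> \<in> ?B m) =
       (\<omega> \<in> {\<omega> \<in> space M. (\<forall>k\<in>{1..n}. jump_time N k \<omega> < x k) \<and> s < interarrival N n \<omega>})"
      using AE AE_space
    proof eventually_elim
      case (elim \<omega>)
      from elim(1) have "\<forall>\<^sub>F m in sequentially. (Q m \<omega> \<longleftrightarrow> (\<forall>k\<in>{1..n}. jump_time N k \<omega> < x k))
        \<and> (N (real (\<iota> m \<omega>) * h m + s) \<omega> = N (real (\<iota> m \<omega>) * h m) \<omega> \<longleftrightarrow> s < interarrival N n \<omega>)"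
        by (simp add: eventually_conj_iff)
      then show ?case by eventually_elim (use elim(2) in auto)
    qed
  qed
  ultimately show ?thesis by (rule LIMSEQ_unique[symmetric])
qed

lemma interarrival_borel [measurable]: "interarrival N n \<in> borel_measurable M"
  unfolding interarrival_def[abs_def] by measurable

lemma AE_interarrival_pos: "AE \<omega> in M. \<forall>n. 0 < interarrival N n \<omega>"
  using AE_space AE_count_at_jump
proof eventually_elim
  case (elim \<omega>)
  show ?case
  proof
    fix n
    have "jump_time N (Suc n) \<omega> \<le> jump_time N n \<omega> \<longleftrightarrow> Suc n \<le> N (jump_time N n \<omega>) \<omega>"
      using jump_time_le_iff[OF elim(1)] elim(2) jump_time_nonneg by blast
    then show "0 < interarrival N n \<omega>" using elim(2) by (simp add: interarrival_def not_le)
  qed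
qed

lemma prob_interarrival_gt:
  assumes "0 \<le> s"
  shows "prob {\<omega> \<in> space M. s < interarrival N n \<omega>} = exp (- l * s)"
proof (cases "s = 0")
  case True
  have "prob {\<omega> \<in> space M. 0 < interarrival N n \<omega>} = 1"
    using AE_interarrival_pos by (subst prob_eq_1) auto
  then show ?thesis using True by simp
next
  case False
  then have s: "0 < s" using assms by simp
  let ?C = "\<lambda>m::nat. {\<omega> \<in> space M. \<forall>k\<in>{1..n}. jump_time N k \<omega> < real m}"
  have ev: "eventually (\<lambda>m::nat. \<forall>k\<in>{1..n}. jump_time N k \<omega> < real m) sequentially" for \<omega>
    by (intro eventually_ball_finite ballI) (auto intro!: filterlim_at_top_dense[THEN iffD1, rule_format] filterlim_real_sequentially)
  have 1: "(\<lambda>m. prob (?C m)) \<longlonglongrightarrow> prob (space M)"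
  proof (rule prob_tendsto_eventually)
    show "AE \<omega> in M. \<forall>\<^sub>F m in sequentially. (\<omega> \<in> ?C m) = (\<omega> \<in> space M)"
      by (intro AE_I2 eventually_mono[OF ev]) auto
  qed measurable
  have 2: "(\<lambda>m::nat. prob {\<omega> \<in> space M. (\<forall>k\<in>{1..n}. jump_time N k \<omega> < real m) \<and> s < interarrival N n \<omega>})
     \<longlonglongrightarrow> prob {\<omega> \<in> space M. s < interarrival N n \<omega>}"
  proof (rule prob_tendsto_eventually)
    show "AE \<omega> in M. \<forall>\<^sub>F m in sequentially. (\<omega> \<in> {\<omega> \<in> space M. (\<forall>k\<in>{1..n}. jump_time N k \<omega> < real m) \<and> s < interarrival N n \<omega>}) = (\<omega> \<in> {\<omega> \<in> space M. s < interarrival N n \<omega>})"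
      by (intro AE_I2 eventually_mono[OF ev]) auto
  qed measurable
  from tendsto_mult_right[OF 1, of "exp (- l * s)"]
  have "(\<lambda>m::nat. prob {\<omega> \<in> space M. (\<forall>k\<in>{1..n}. jump_time N k \<omega> < real m) \<and> s < interarrival N n \<omega>}) \<longlonglongrightarrow> exp (- l * s)"
    unfolding interarrival_strong_markov[OF s] by (simp add: prob_space)
  from LIMSEQ_unique[OF 2 this] show ?thesis .
qed

lemma distr_interarrival:
  "distr M borel (interarrival N n) = density lborel (exponential_density l)"
proof -
  have "distributed M lborel (interarrival N n) (exponential_density l)"
  proof (subst exponential_distributed_iff[OF rate_pos], intro conjI allI impI)
    fix a :: real assume "0 \<le> a"
    have "prob {\<omega> \<in> space M. interarrival N n \<omega> \<le> a} = prob (space M - {\<omega> \<in> space M. a < interarrival N n \<omega>})"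
      by (intro arg_cong[where f=prob]) auto
    also have "\<dots> = 1 - exp (- l * a)"
      using \<open>0 \<le> a\<close> by (subst prob_compl) (auto simp: prob_interarrival_gt)
    finally show "prob {\<omega> \<in> space M. interarrival N n \<omega> \<le> a} = 1 - exp (- a * l)" by (simp add: mult.commute)
  qed measurable
  then show ?thesis by (simp add: distributed_distr_eq_density[symmetric] cong: distr_cong)
qed

lemma interarrival_indep_past:
  "indep_set (sigma_sets (space M) {{\<omega> \<in> space M. \<forall>k\<in>{1..n}. jump_time N k \<omega> < x k} | x. True})
     (sigma_sets (space M) {{\<omega> \<in> space M. s < interarrival N n \<omega>} | s. True})"
proof (rule indep_set_sigma_sets)
  show "indep_set {{\<omega> \<in> space M. \<forall>k\<in>{1..n}. jump_time N k \<omega> < x k} | x. True}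
     {{\<omega> \<in> space M. s < interarrival N n \<omega>} | s. True}"
  proof (rule indep_setI)
    fix A B assume "A \<in> {{\<omega> \<in> space M. \<forall>k\<in>{1..n}. jump_time N k \<omega> < x k} | x. True}"
      and "B \<in> {{\<omega> \<in> space M. s < interarrival N n \<omega>} | s. True}"
    then obtain x s where A: "A = {\<omega> \<in> space M. \<forall>k\<in>{1..n}. jump_time N k \<omega> < x k}"
      and B: "B = {\<omega> \<in> space M. s < interarrival N n \<omega>}" by blast
    show "prob (A \<inter> B) = prob A * prob B"
    proof (cases "0 < s")
      case True
      have "A \<inter> B = {\<omega> \<in> space M. (\<forall>k\<in>{1..n}. jump_time N k \<omega> < x k) \<and> s < interarrival N n \<omega>}"
        using A B by auto
      then show ?thesis using interarrival_strong_markov[OF True, of n x] prob_interarrival_gt[of s n] True A B by simp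
    next
      case False
      have ev [measurable]: "A \<in> events" "B \<in> events" unfolding A B by measurable
      have "AE \<omega> in M. \<omega> \<in> B" using AE_interarrival_pos AE_space
        by eventually_elim (use False B in \<open>auto intro: le_less_trans[of s 0] simp: not_less\<close>)
      then have "prob B = 1" "prob (A \<inter> B) = prob A"
        by (auto simp: prob_eq_1 intro!: finite_measure_eq_AE)
      then show ?thesis by simp
    qed
  qed auto
  show "Int_stable {{\<omega> \<in> space M. \<forall>k\<in>{1..n}. jump_time N k \<omega> < x k} | x. True}"
  proof (rule Int_stableI, safe)
    fix x y
    show "\<exists>z. {\<omega> \<in> space M. \<forall>k\<in>{1..n}. jump_time N k \<omega> < x k} \<inter> {\<omega> \<in> space M. \<forall>k\<in>{1..n}. jump_time N k \<omega> < y k}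
      = {\<omega> \<in> space M. \<forall>k\<in>{1..n}. jump_time N k \<omega> < z k} \<and> True"
      by (intro exI[of _ "\<lambda>k. min (x k) (y k)"]) auto
  qed
  show "Int_stable {{\<omega> \<in> space M. s < interarrival N n \<omega>} | s. True}"
  proof (rule Int_stableI, safe)
    fix s t
    show "\<exists>z. {\<omega> \<in> space M. s < interarrival N n \<omega>} \<inter> {\<omega> \<in> space M. t < interarrival N n \<omega>}
      = {\<omega> \<in> space M. z < interarrival N n \<omega>} \<and> True"
      by (intro exI[of _ "max s t"]) auto
  qed
qed

text \<open>
  Induction on \<open>n\<close>: the first \<open>n\<close> waiting times are functions of the first \<open>n\<close> jump times, and the
  next waiting time is independent of those.
\<close>
lemma prob_interarrivals:
  assumes "\<And>i. i < n \<Longrightarrow> B i \<in> sets borel"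
  shows "prob {\<omega> \<in> space M. \<forall>i<n. interarrival N i \<omega> \<in> B i} = (\<Prod>i<n. prob {\<omega> \<in> space M. interarrival N i \<omega> \<in> B i})"
  using assms
proof (induction n)
  case 0 then show ?case by (simp add: prob_space)
next
  case (Suc n)
  let ?G = "{{\<omega> \<in> space M. \<forall>k\<in>{1..n}. jump_time N k \<omega> < x k} | x. True}"
  let ?H = "{{\<omega> \<in> space M. s < interarrival N n \<omega>} | s. True}"
  \<comment> \<open>\<open>SG\<close> is the \<open>\<sigma>\<close>-algebra of the first \<open>n\<close> jump times, \<open>SH\<close> that of the next waiting time\<close>
  define SG where "SG = sigma (space M) ?G"
  define SH where "SH = sigma (space M) ?H"
  have sG: "sets SG = sigma_sets (space M) ?G" and spG: "space SG = space M"
    unfolding SG_def by (auto intro!: sets_measure_of space_measure_of)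
  have sH: "sets SH = sigma_sets (space M) ?H" and spH: "space SH = space M"
    unfolding SH_def by (auto intro!: sets_measure_of space_measure_of)
  have T [measurable]: "jump_time N k \<in> borel_measurable SG" if "k \<in> {0..n}" for k
  proof (cases "k = 0")
    case True
    have "jump_time N 0 \<in> borel_measurable SG \<longleftrightarrow> (\<lambda>_. 0::real) \<in> borel_measurable SG"
      by (rule measurable_cong) (simp add: spG jump_time_0)
    then show ?thesis using True by simp
  next
    case False
    then have k: "k \<in> {1..n}" using that by auto
    show ?thesis
    proof (rule borel_measurableI_less)
      fix y :: real
      have "{\<omega> \<in> space SG. jump_time N k \<omega> < y}
        = (\<Union>m::nat. {\<omega> \<in> space M. \<forall>i\<in>{1..n}. jump_time N i \<omega> < (if i = k then y else real m)})" (is "_ = (\<Union>m. ?D m)")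
      proof (intro set_eqI iffI)
        fix \<omega> assume w: "\<omega> \<in> {\<omega> \<in> space SG. jump_time N k \<omega> < y}"
        obtain m :: nat where m: "Max ((\<lambda>i. jump_time N i \<omega>) ` {1..n}) < real m"
          using reals_Archimedean2 by blast
        have "jump_time N i \<omega> < real m" if "i \<in> {1..n}" for i
          using that by (intro le_less_trans[OF Max_ge m]) auto
        then show "\<omega> \<in> (\<Union>m. ?D m)" using w by (auto simp: spG intro!: exI[of _ m])
      qed (use k in \<open>auto simp: spG dest!: bspec[where x=k]\<close>)
      also have "\<dots> \<in> sets SG"
        unfolding sG by (intro sigma_sets.Union sigma_sets.Basic CollectI exI[of _ "\<lambda>i. if i = k then y else real _"]) simp
      finally show "{\<omega> \<in> space SG. jump_time N k \<omega> < y} \<in> sets SG" .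
    qed
  qed
  have WG [measurable]: "interarrival N i \<in> borel_measurable SG" if "i < n" for i
  proof -
    have [measurable]: "jump_time N i \<in> borel_measurable SG" "jump_time N (Suc i) \<in> borel_measurable SG"
      using that by auto
    show ?thesis unfolding interarrival_def[abs_def] by measurable
  qed
  have WH [measurable]: "interarrival N n \<in> borel_measurable SH"
  proof (rule borel_measurableI_greater)
    fix y show "{\<omega> \<in> space SH. y < interarrival N n \<omega>} \<in> sets SH"
      unfolding sH spH by (intro sigma_sets.Basic) auto
  qed
  have A: "{\<omega> \<in> space M. \<forall>i<n. interarrival N i \<omega> \<in> B i} \<in> sets SG"
  proof -
    have "{\<omega> \<in> space SG. interarrival N i \<omega> \<in> B i} \<in> sets SG" if "i < n" for i
      using measurable_sets[OF WG[OF that] Suc.prems[of i]] that by (simp add: vimage_def Int_def conj_commute)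
    then have "{\<omega> \<in> space SG. \<forall>i\<in>{..<n}. interarrival N i \<omega> \<in> B i} \<in> sets SG"
      by (intro sets.sets_Collect_finite_All) auto
    moreover have "{\<omega> \<in> space SG. \<forall>i\<in>{..<n}. interarrival N i \<omega> \<in> B i} = {\<omega> \<in> space M. \<forall>i<n. interarrival N i \<omega> \<in> B i}"
      by (auto simp: spG)
    ultimately show ?thesis by (simp only:)
  qed
  have B: "{\<omega> \<in> space M. interarrival N n \<omega> \<in> B n} \<in> sets SH"
    using measurable_sets[OF WH Suc.prems[of n]] by (simp add: vimage_def Int_def conj_commute spH)
  have "prob ({\<omega> \<in> space M. \<forall>i<n. interarrival N i \<omega> \<in> B i} \<inter> {\<omega> \<in> space M. interarrival N n \<omega> \<in> B n})
    = prob {\<omega> \<in> space M. \<forall>i<n. interarrival N i \<omega> \<in> B i} * prob {\<omega> \<in> space M. interarrival N n \<omega> \<in> B n}"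
    using interarrival_indep_past[of n] A B unfolding sG sH indep_sets2_eq by blast
  moreover have "{\<omega> \<in> space M. \<forall>i<n. interarrival N i \<omega> \<in> B i} \<inter> {\<omega> \<in> space M. interarrival N n \<omega> \<in> B n}
     = {\<omega> \<in> space M. \<forall>i<Suc n. interarrival N i \<omega> \<in> B i}" by (auto simp: less_Suc_eq)
  ultimately show ?case using Suc by simp
qed

lemma indep_interarrivals: "indep_vars (\<lambda>_. borel) (interarrival N) UNIV"
  unfolding indep_vars_def2
proof (intro conjI ballI indep_setsI)
  fix A J
  assume J: "J \<noteq> {}" "J \<subseteq> (UNIV::nat set)" "finite J"
    and A: "\<forall>j\<in>J. A j \<in> {interarrival N j -` S \<inter> space M |S. S \<in> sets borel}"
  then have "\<forall>j\<in>J. \<exists>S. A j = interarrival N j -` S \<inter> space M \<and> S \<in> sets borel" by blast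
  from bchoice[OF this] obtain S where S: "\<And>j. j \<in> J \<Longrightarrow> A j = interarrival N j -` S j \<inter> space M" "\<And>j. j \<in> J \<Longrightarrow> S j \<in> sets borel"
    by blast
  define B where "B j = (if j \<in> J then S j else UNIV)" for j
  define n where "n = Suc (Max J)"
  have Jn: "J \<subseteq> {..<n}" using J by (auto simp: n_def less_Suc_eq_le)
  have "(\<Inter>j\<in>J. A j) = {\<omega> \<in> space M. \<forall>i<n. interarrival N i \<omega> \<in> B i}"
    using S J(1) Jn by (auto simp: B_def split: if_splits)
  also have "prob \<dots> = (\<Prod>i<n. prob {\<omega> \<in> space M. interarrival N i \<omega> \<in> B i})"
    by (rule prob_interarrivals) (auto simp: B_def S)
  also have "\<dots> = (\<Prod>i\<in>J. prob {\<omega> \<in> space M. interarrival N i \<omega> \<in> B i})"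
    by (rule prod.mono_neutral_right) (use Jn in \<open>auto simp: B_def prob_space\<close>)
  also have "\<dots> = (\<Prod>j\<in>J. prob (A j))"
    by (intro prod.cong refl arg_cong[where f=prob]) (auto simp: S B_def)
  finally show "prob (\<Inter>j\<in>J. A j) = (\<Prod>j\<in>J. prob (A j))" .
qed auto

lemma distr_interarrivals:
  "distr M (PiM UNIV (\<lambda>_. borel)) (\<lambda>\<omega> i. interarrival N i \<omega>) = PiM UNIV (\<lambda>_. density lborel (exponential_density l))"
  using indep_vars_iff_distr_eq_PiM[where I=UNIV and M'="\<lambda>_. borel" and X="interarrival N"] indep_interarrivals
  by (simp add: distr_interarrival restrict_UNIV)

end

section \<open>The first-step equation\<close>

text \<open>
  Functionals of Gerber--Shiu type. A claim arrives when the reserve is \<open>v\<close>; if it causes ruin, the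
  deficit is penalized by \<open>w\<close>, otherwise the process goes on from the remaining reserve with value \<open>\<phi>\<close>.
\<close>
definition after_claim :: "real measure \<Rightarrow> (real \<Rightarrow> ennreal) \<Rightarrow> (real \<Rightarrow> ennreal) \<Rightarrow> real \<Rightarrow> ennreal" where
  "after_claim \<nu> w \<phi> v = (\<integral>\<^sup>+z. (if v < z then w (z - v) else \<phi> (v - z)) \<partial>\<nu>)"

definition first_step :: "real \<Rightarrow> real \<Rightarrow> real measure \<Rightarrow> (real \<Rightarrow> ennreal) \<Rightarrow> (real \<Rightarrow> ennreal) \<Rightarrow> real \<Rightarrow> ennreal" where
  "first_step l c \<nu> w \<phi> u = (\<integral>\<^sup>+s. after_claim \<nu> w \<phi> (u + c * s) \<partial>density lborel (exponential_density l))"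

text \<open>
  Ruin is counted if it occurs at one of the first \<open>n\<close> claims; letting \<open>n\<close> grow gives the expected
  penalty of the deficit as a function of the initial reserve.
\<close>
definition ruin_iter :: "real \<Rightarrow> real \<Rightarrow> real measure \<Rightarrow> (real \<Rightarrow> ennreal) \<Rightarrow> nat \<Rightarrow> real \<Rightarrow> ennreal" where
  "ruin_iter l c \<nu> w n = (first_step l c \<nu> w ^^ n) (\<lambda>_. 0)"

definition ruin_value :: "real \<Rightarrow> real \<Rightarrow> real measure \<Rightarrow> (real \<Rightarrow> ennreal) \<Rightarrow> real \<Rightarrow> ennreal" where
  "ruin_value l c \<nu> w u = (SUP n. ruin_iter l c \<nu> w n u)"

lemma one_plus_ennreal: "0 \<le> x \<Longrightarrow> 1 + ennreal x = ennreal (1 + x)"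
  by (subst ennreal_plus) auto

locale claim_law = prob_space \<nu> for \<nu> :: "real measure" +
  fixes l c :: real
  assumes sets_law [measurable_cong]: "sets \<nu> = sets borel"
    and claim_pos: "AE z in \<nu>. 0 < z"
    and l_pos: "0 < l" and c_pos: "0 < c"
begin

definition tail :: "real \<Rightarrow> ennreal" where "tail x = emeasure \<nu> {x<..}"
definition \<kappa> :: real where "\<kappa> = l / c"
text \<open>
  This is \<open>f_I / (1 + \<theta>)\<close>, the defective density of the ladder heights of the claim surplus.
\<close>
definition ladder :: "real \<Rightarrow> ennreal" where "ladder x = ennreal \<kappa> * tail x"

lemma kappa_pos: "0 < \<kappa>" using l_pos c_pos by (simp add: \<kappa>_def)

lemma space_law [simp]: "space \<nu> = UNIV"
  using sets_eq_imp_space_eq[OF sets_law] by simp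

lemma tail_antimono: "x \<le> y \<Longrightarrow> tail y \<le> tail x"
  unfolding tail_def by (rule emeasure_mono) auto

lemma tail_measurable [measurable]: "tail \<in> borel_measurable borel"
proof -
  have "{x \<in> space (borel \<Otimes>\<^sub>M \<nu>). fst x < snd x} \<in> sets (borel \<Otimes>\<^sub>M \<nu>)" by measurable
  from measurable_emeasure_Pair[OF this]
  have "(\<lambda>x. emeasure \<nu> (Pair x -` {x \<in> space (borel \<Otimes>\<^sub>M \<nu>). fst x < snd x})) \<in> borel_measurable borel" by simp
  moreover have "Pair x -` {x \<in> space (borel \<Otimes>\<^sub>M \<nu>). fst x < snd x} = {x<..}" for x :: real
    by (auto simp: space_pair_measure)
  ultimately show ?thesis unfolding tail_def[abs_def] by (simp only:)
qed

lemma ladder_measurable [measurable]: "ladder \<in> borel_measurable borel"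
  unfolding ladder_def[abs_def] by measurable

lemma tail_le_1: "tail x \<le> 1"
  unfolding tail_def by (rule emeasure_le_1)

lemma sf_law: "sigma_finite_measure \<nu>" by unfold_locales

lemma nn_integral_swap:
  assumes [measurable]: "(\<lambda>(x, z). f x z) \<in> borel_measurable (borel \<Otimes>\<^sub>M borel)"
  shows "(\<integral>\<^sup>+z. (\<integral>\<^sup>+x. f x z \<partial>lborel) \<partial>\<nu>) = (\<integral>\<^sup>+x. (\<integral>\<^sup>+z. f x z \<partial>\<nu>) \<partial>lborel)"
proof -
  interpret pair_sigma_finite lborel \<nu> ..
  have "(\<lambda>(x, z). f x z) \<in> borel_measurable (lborel \<Otimes>\<^sub>M \<nu>)" by measurable
  from Fubini'[OF this] show ?thesis by simp
qed

text \<open>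
  Layer cake formula: \<open>x\<close> lies below the claim \<open>z\<close> with probability \<open>tail x\<close>.
\<close>
lemma nn_integral_tail:
  assumes [measurable]: "h \<in> borel_measurable borel"
  shows "(\<integral>\<^sup>+z. (\<integral>\<^sup>+x. h x * indicator {v..<z} x \<partial>lborel) \<partial>\<nu>) = (\<integral>\<^sup>+x. h x * tail x * indicator {v..} x \<partial>lborel)"
proof -
  have "(\<integral>\<^sup>+z. (\<integral>\<^sup>+x. h x * indicator {v..<z} x \<partial>lborel) \<partial>\<nu>)
     = (\<integral>\<^sup>+z. (\<integral>\<^sup>+x. h x * indicator {v..} x * indicator {x<..} z \<partial>lborel) \<partial>\<nu>)"
    by (intro nn_integral_cong) (auto simp: indicator_def)
  also have "\<dots> = (\<integral>\<^sup>+x. (\<integral>\<^sup>+z. h x * indicator {v..} x * indicator {x<..} z \<partial>\<nu>) \<partial>lborel)"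
  proof (rule nn_integral_swap)
    have "(\<lambda>p. h (fst p) * indicator {v..} (fst p) * (indicator {p. fst p < snd p} p :: ennreal)) \<in> borel_measurable (borel \<Otimes>\<^sub>M borel)"
      by measurable
    then show "(\<lambda>(x, z). h x * indicator {v..} x * indicator {x<..} z) \<in> borel_measurable (borel \<Otimes>\<^sub>M (borel :: real measure))"
      by (rule measurable_cong[THEN iffD1, rotated]) (auto simp: indicator_def)
  qed
  also have "\<dots> = (\<integral>\<^sup>+x. h x * tail x * indicator {v..} x \<partial>lborel)"
    by (subst nn_integral_cmult_indicator) (auto simp: tail_def ac_simps sets_law)
  finally show ?thesis .
qed

lemma after_claim_measurable [measurable]:
  assumes [measurable]: "w \<in> borel_measurable borel" "\<phi> \<in> borel_measurable borel"
  shows "after_claim \<nu> w \<phi> \<in> borel_measurable borel"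
proof -
  interpret sigma_finite_measure \<nu> by (rule sf_law)
  show ?thesis unfolding after_claim_def[abs_def] by measurable
qed

lemma AE_expo_pos: "AE s in density lborel (exponential_density l). 0 \<le> s"
  by (subst AE_density) (auto simp: exponential_density_def)

lemma first_step_measurable [measurable]:
  assumes [measurable]: "w \<in> borel_measurable borel" "\<phi> \<in> borel_measurable borel"
  shows "first_step l c \<nu> w \<phi> \<in> borel_measurable borel"
proof -
  interpret E: prob_space "density lborel (exponential_density l)"
    by (rule prob_space_exponential_density[OF l_pos])
  have "after_claim \<nu> w \<phi> \<in> borel_measurable borel" by measurable
  note [measurable] = this
  show ?thesis unfolding first_step_def[abs_def] by measurable
qed

lemma ruin_iter_0: "ruin_iter l c \<nu> w 0 = (\<lambda>_. 0)"
  by (simp add: ruin_iter_def)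

lemma ruin_iter_Suc: "ruin_iter l c \<nu> w (Suc n) = first_step l c \<nu> w (ruin_iter l c \<nu> w n)"
  by (simp add: ruin_iter_def)

lemma ruin_iter_measurable [measurable]:
  assumes [measurable]: "w \<in> borel_measurable borel"
  shows "ruin_iter l c \<nu> w n \<in> borel_measurable borel"
  by (induction n) (simp_all add: ruin_iter_0 ruin_iter_Suc)

lemma ruin_value_measurable [measurable]:
  assumes [measurable]: "w \<in> borel_measurable borel"
  shows "ruin_value l c \<nu> w \<in> borel_measurable borel"
  unfolding ruin_value_def[abs_def] by measurable

lemma first_step_mono:
  assumes "\<And>y. 0 < y \<Longrightarrow> w y \<le> w' y" "\<And>y. 0 \<le> y \<Longrightarrow> \<phi> y \<le> \<phi>' y"
  shows "first_step l c \<nu> w \<phi> u \<le> first_step l c \<nu> w' \<phi>' u"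
  unfolding first_step_def after_claim_def
  by (intro nn_integral_mono) (auto intro!: assms)

lemma ruin_iter_incseq: "ruin_iter l c \<nu> w n u \<le> ruin_iter l c \<nu> w (Suc n) u"
proof (induction n arbitrary: u)
  case 0 show ?case by (simp add: ruin_iter_0)
next
  case (Suc n)
  have "first_step l c \<nu> w (ruin_iter l c \<nu> w n) u \<le> first_step l c \<nu> w (ruin_iter l c \<nu> w (Suc n)) u"
    by (rule first_step_mono) (auto intro: Suc)
  then show ?case by (simp only: ruin_iter_Suc)
qed

lemma ruin_value_fixed_point:
  assumes [measurable]: "w \<in> borel_measurable borel"
  shows "first_step l c \<nu> w (ruin_value l c \<nu> w) u = ruin_value l c \<nu> w u"
proof -
  let ?Q = "ruin_iter l c \<nu> w"
  have inc: "incseq ?Q" by (rule incseq_SucI) (simp add: le_fun_def ruin_iter_incseq)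
  have ac: "after_claim \<nu> w (ruin_value l c \<nu> w) v = (SUP n. after_claim \<nu> w (?Q n) v)" for v
  proof -
    have "after_claim \<nu> w (ruin_value l c \<nu> w) v = (\<integral>\<^sup>+z. (SUP n. if v < z then w (z - v) else ?Q n (v - z)) \<partial>\<nu>)"
      unfolding after_claim_def ruin_value_def by (intro nn_integral_cong) auto
    also have "\<dots> = (SUP n. after_claim \<nu> w (?Q n) v)"
      unfolding after_claim_def
      by (rule nn_integral_monotone_convergence_SUP)
        (use inc in \<open>auto simp: incseq_def le_fun_def\<close>)
    finally show ?thesis .
  qed
  have "first_step l c \<nu> w (ruin_value l c \<nu> w) u = (SUP n. first_step l c \<nu> w (?Q n) u)"
    unfolding first_step_def ac
  proof (rule nn_integral_monotone_convergence_SUP)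
    show "incseq (\<lambda>n s. after_claim \<nu> w (?Q n) (u + c * s))"
      unfolding after_claim_def using inc by (auto simp: incseq_def le_fun_def intro!: nn_integral_mono)
  qed measurable
  also have "\<dots> = (SUP n. ?Q (Suc n) u)" by (simp add: ruin_iter_Suc)
  also have "\<dots> = (SUP n. ?Q n u)"
  proof (rule antisym)
    show "(SUP n. ?Q (Suc n) u) \<le> (SUP n. ?Q n u)" by (rule SUP_least) (rule SUP_upper, simp)
    show "(SUP n. ?Q n u) \<le> (SUP n. ?Q (Suc n) u)"
      by (rule SUP_mono) (blast intro: ruin_iter_incseq)
  qed
  finally show ?thesis by (simp add: ruin_value_def)
qed

text \<open>
  The substitution \<open>v = u + c s\<close> replaces the waiting time by the reserve just before the claim.
\<close>
lemma first_step_lborel: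
  assumes [measurable]: "w \<in> borel_measurable borel" "\<phi> \<in> borel_measurable borel"
  shows "first_step l c \<nu> w \<phi> u
    = (\<integral>\<^sup>+v. ennreal (\<kappa> * exp (- \<kappa> * (v - u))) * indicator {u..} v * after_claim \<nu> w \<phi> v \<partial>lborel)"
proof -
  let ?m = "after_claim \<nu> w \<phi>"
  have [measurable]: "?m \<in> borel_measurable borel" by measurable
  have "(\<integral>\<^sup>+v. ennreal (\<kappa> * exp (- \<kappa> * (v - u))) * indicator {u..} v * ?m v \<partial>lborel)
    = ennreal \<bar>c\<bar> * (\<integral>\<^sup>+s. ennreal (\<kappa> * exp (- \<kappa> * ((u + c * s) - u))) * indicator {u..} (u + c * s) * ?m (u + c * s) \<partial>lborel)"
    using c_pos by (intro nn_integral_real_affine) auto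
  also have "\<dots> = (\<integral>\<^sup>+s. ennreal c * (ennreal (\<kappa> * exp (- \<kappa> * (c * s))) * indicator {u..} (u + c * s) * ?m (u + c * s)) \<partial>lborel)"
    using c_pos by (subst nn_integral_cmult[symmetric]) auto
  also have "\<dots> = (\<integral>\<^sup>+s. ennreal (exponential_density l s) * ?m (u + c * s) \<partial>lborel)"
  proof (rule nn_integral_cong)
    fix s :: real
    have "ennreal c * ennreal (\<kappa> * exp (- \<kappa> * (c * s))) = ennreal (l * exp (- s * l))"
      using c_pos l_pos kappa_pos by (subst ennreal_mult[symmetric]) (auto simp: field_simps \<kappa>_def)
    moreover have "u \<le> u + c * s \<longleftrightarrow> 0 \<le> s" using c_pos by (simp add: zero_le_mult_iff)
    ultimately show "ennreal c * (ennreal (\<kappa> * exp (- \<kappa> * (c * s))) * indicator {u..} (u + c * s) * ?m (u + c * s))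
       = ennreal (exponential_density l s) * ?m (u + c * s)"
      by (auto simp: exponential_density_def indicator_def mult.assoc[symmetric])
  qed
  also have "\<dots> = first_step l c \<nu> w \<phi> u"
    unfolding first_step_def by (subst nn_integral_density) auto
  finally show ?thesis by simp
qed

end

locale lundberg = claim_law +
  fixes R :: real
  assumes R_pos: "0 < R"
    and lundberg_eq: "(\<integral>\<^sup>+s. ennreal (exp (R * s)) * ladder s * indicator {0..} s \<partial>lborel) = 1"
begin


text \<open>
  Integration by parts turns the Lundberg equation for the tail into one for the law of the claims.
\<close>
lemma claim_mgf: "(\<integral>\<^sup>+z. ennreal (exp (R * z)) \<partial>\<nu>) = ennreal (1 + R / \<kappa>)"
proof -
  have inner: "(\<integral>\<^sup>+x. ennreal (R * exp (R * x)) * indicator {0..<z} x \<partial>lborel) = ennreal (exp (R * z) - 1)" if "0 < z" for z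
  proof -
    have "(\<integral>\<^sup>+x. ennreal (R * exp (R * x)) * indicator {0..<z} x \<partial>lborel) = (\<integral>\<^sup>+x. ennreal (R * exp (R * x)) * indicator {0..z} x \<partial>lborel)"
      by (intro nn_integral_cong_AE eventually_mono[OF AE_lborel_singleton[of z]]) (auto simp: indicator_def)
    also have "\<dots> = ennreal (exp (R * z) - exp (R * 0))"
      by (rule nn_integral_FTC_Icc) (use R_pos that in \<open>auto intro!: derivative_eq_intros\<close>)
    finally show ?thesis by simp
  qed
  have "ennreal \<kappa> * (\<integral>\<^sup>+z. ennreal (exp (R * z) - 1) \<partial>\<nu>) = ennreal \<kappa> * (\<integral>\<^sup>+z. (\<integral>\<^sup>+x. ennreal (R * exp (R * x)) * indicator {0..<z} x \<partial>lborel) \<partial>\<nu>)"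
    by (intro arg_cong2[where f="(*)"] refl nn_integral_cong_AE eventually_mono[OF claim_pos]) (simp add: inner)
  also have "\<dots> = ennreal \<kappa> * (\<integral>\<^sup>+x. ennreal (R * exp (R * x)) * tail x * indicator {0..} x \<partial>lborel)"
    by (subst nn_integral_tail) auto
  also have "\<dots> = ennreal R * (\<integral>\<^sup>+x. ennreal (exp (R * x)) * ladder x * indicator {0..} x \<partial>lborel)"
    using R_pos by (subst (1 2) nn_integral_cmult[symmetric]) (auto simp: ladder_def ennreal_mult ac_simps)
  also have "\<dots> = ennreal R" by (simp add: lundberg_eq)
  finally have "ennreal \<kappa> * (\<integral>\<^sup>+z. ennreal (exp (R * z) - 1) \<partial>\<nu>) = ennreal R" .
  then have "ennreal (1 / \<kappa>) * ennreal \<kappa> * (\<integral>\<^sup>+z. ennreal (exp (R * z) - 1) \<partial>\<nu>) = ennreal (1 / \<kappa>) * ennreal R"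
    by (simp only: mult.assoc)
  moreover have "ennreal (1 / \<kappa>) * ennreal \<kappa> = 1" "ennreal (1 / \<kappa>) * ennreal R = ennreal (R / \<kappa>)"
    using kappa_pos R_pos l_pos c_pos by (auto simp: ennreal_mult[symmetric])
  ultimately have *: "(\<integral>\<^sup>+z. ennreal (exp (R * z) - 1) \<partial>\<nu>) = ennreal (R / \<kappa>)"
    by (simp only: mult_1)
  have "(\<integral>\<^sup>+z. ennreal (exp (R * z)) \<partial>\<nu>) = (\<integral>\<^sup>+z. 1 + ennreal (exp (R * z) - 1) \<partial>\<nu>)"
  proof (intro nn_integral_cong_AE eventually_mono[OF claim_pos])
    fix z :: real assume "0 < z"
    then have "1 \<le> exp (R * z)" using R_pos by simp
    then show "ennreal (exp (R * z)) = 1 + ennreal (exp (R * z) - 1)"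
      by (subst ennreal_1[symmetric], subst ennreal_plus[symmetric]) auto
  qed
  also have "\<dots> = 1 + ennreal (R / \<kappa>)"
    by (subst nn_integral_add) (auto simp: * emeasure_space_1[simplified])
  also have "\<dots> = ennreal (1 + R / \<kappa>)"
    using kappa_pos R_pos by (intro one_plus_ennreal) simp
  finally show ?thesis .
qed

text \<open>
  The step of the random walk multiplies \<open>exp (- R u)\<close> by \<open>E exp (R Z) = (l + R c) / l\<close> and by the
  Laplace transform \<open>l / (l + R c)\<close> of \<open>c W\<close> at \<open>R\<close>, where \<open>W\<close> is the waiting time. The two cancel.
\<close>
lemma first_step_exp:
  assumes w: "\<And>y. 0 < y \<Longrightarrow> w y \<le> C * ennreal (exp (R * y))" and [measurable]: "w \<in> borel_measurable borel"
    and [measurable]: "\<phi> \<in> borel_measurable borel" and phi: "\<And>y. 0 \<le> y \<Longrightarrow> \<phi> y \<le> C * ennreal (exp (- R * y))"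
    and u: "0 \<le> u"
  shows "first_step l c \<nu> w \<phi> u \<le> C * ennreal (exp (- R * u))"
proof -
  have ac: "after_claim \<nu> w \<phi> v \<le> C * ennreal ((1 + R / \<kappa>) * exp (- R * v))" for v
  proof -
    have "after_claim \<nu> w \<phi> v \<le> (\<integral>\<^sup>+z. (C * ennreal (exp (- R * v))) * ennreal (exp (R * z)) \<partial>\<nu>)"
      unfolding after_claim_def
    proof (rule nn_integral_mono)
      fix z
      have *: "(C * ennreal (exp (- R * v))) * ennreal (exp (R * z)) = C * ennreal (exp (R * (z - v)))"
        by (simp add: mult.assoc ennreal_mult[symmetric] exp_add[symmetric] algebra_simps)
      show "(if v < z then w (z - v) else \<phi> (v - z)) \<le> (C * ennreal (exp (- R * v))) * ennreal (exp (R * z))"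
        unfolding * using w[of "z - v"] phi[of "v - z"] by (auto simp: algebra_simps)
    qed
    also have "\<dots> = (C * ennreal (exp (- R * v))) * ennreal (1 + R / \<kappa>)"
      by (subst nn_integral_cmult) (auto simp: claim_mgf)
    also have "\<dots> = C * ennreal ((1 + R / \<kappa>) * exp (- R * v))"
    proof -
      have "0 \<le> 1 + R / \<kappa>" using kappa_pos R_pos by (simp add: add_nonneg_nonneg)
      from ennreal_mult[OF this exp_ge_zero] show ?thesis by (simp only: ac_simps)
    qed
    finally show ?thesis .
  qed
  have "first_step l c \<nu> w \<phi> u \<le> (\<integral>\<^sup>+s. C * ennreal ((1 + R / \<kappa>) * exp (- R * (u + c * s))) \<partial>density lborel (exponential_density l))"
    unfolding first_step_def by (intro nn_integral_mono ac)
  also have "\<dots> = (\<integral>\<^sup>+s. ennreal (exponential_density l s) * (C * ennreal ((1 + R / \<kappa>) * exp (- R * (u + c * s)))) \<partial>lborel)"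
    by (subst nn_integral_density) auto
  also have "\<dots> = (\<integral>\<^sup>+s. (C * ennreal (exp (- R * u))) * ennreal (exponential_density (l + R * c) s) \<partial>lborel)"
  proof (rule nn_integral_cong)
    fix s
    have *: "exponential_density l s * ((1 + R / \<kappa>) * exp (- R * (u + c * s))) = exp (- R * u) * exponential_density (l + R * c) s"
      using l_pos c_pos by (simp add: exponential_density_def \<kappa>_def field_simps exp_add[symmetric] exp_diff exp_minus)
    have "ennreal (exponential_density l s) * ennreal ((1 + R / \<kappa>) * exp (- R * (u + c * s)))
       = ennreal (exp (- R * u)) * ennreal (exponential_density (l + R * c) s)"
    proof -
      have "0 \<le> (1 + R / \<kappa>) * exp (- R * (u + c * s))" using kappa_pos R_pos by simp
      moreover have "0 \<le> exponential_density (l + R * c) s"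
        using l_pos c_pos R_pos by (intro exponential_density_nonneg) (simp add: add_pos_pos)
      ultimately show ?thesis
        using ennreal_mult[of "exponential_density l s" "(1 + R / \<kappa>) * exp (- R * (u + c * s))"]
          ennreal_mult[of "exp (- R * u)" "exponential_density (l + R * c) s"] * exponential_density_nonneg[OF l_pos, of s]
        by (simp only: exp_ge_zero)
    qed
    then show "ennreal (exponential_density l s) * (C * ennreal ((1 + R / \<kappa>) * exp (- R * (u + c * s))))
       = (C * ennreal (exp (- R * u))) * ennreal (exponential_density (l + R * c) s)"
      by (metis mult.assoc mult.left_commute)
  qed
  also have "\<dots> = C * ennreal (exp (- R * u)) * (\<integral>\<^sup>+s. ennreal (exponential_density (l + R * c) s) \<partial>lborel)"
    by (rule nn_integral_cmult) auto
  also have "(\<integral>\<^sup>+s. ennreal (exponential_density (l + R * c) s) \<partial>lborel) = 1"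
  proof -
    have "prob_space (density lborel (exponential_density (l + R * c)))"
      using l_pos R_pos c_pos by (intro prob_space_exponential_density) (simp add: add_pos_pos)
    then show ?thesis by (auto dest: prob_space.emeasure_space_1 simp: emeasure_density)
  qed
  finally show ?thesis by simp
qed

text \<open>
  Lundberg's inequality: a supersolution of the first-step equation dominates all iterates.
\<close>
lemma ruin_value_exp_bound:
  assumes w: "\<And>y. 0 < y \<Longrightarrow> w y \<le> C * ennreal (exp (R * y))" and [measurable]: "w \<in> borel_measurable borel"
    and u: "0 \<le> u"
  shows "ruin_value l c \<nu> w u \<le> C * ennreal (exp (- R * u))"
proof -
  have "ruin_iter l c \<nu> w n u \<le> C * ennreal (exp (- R * u))" if "0 \<le> u" for n u
    using that
  proof (induction n arbitrary: u)
    case 0 then show ?case by (simp add: ruin_iter_0)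
  next
    case (Suc n)
    show ?case unfolding ruin_iter_Suc by (rule first_step_exp[OF w]) (use Suc in auto)
  qed
  then show ?thesis unfolding ruin_value_def using u by (intro SUP_least)
qed

end

section \<open>The defective renewal equation\<close>

definition renewal_op :: "(real \<Rightarrow> ennreal) \<Rightarrow> (real \<Rightarrow> ennreal) \<Rightarrow> real \<Rightarrow> ennreal" where
  "renewal_op a \<phi> x = (\<integral>\<^sup>+s. \<phi> (x - s) * a s * indicator {0..x} s \<partial>lborel)"

lemma renewal_op_mono:
  assumes "\<And>y. 0 \<le> y \<Longrightarrow> \<phi> y \<le> \<psi> y"
  shows "renewal_op a \<phi> x \<le> renewal_op a \<psi> x"
  unfolding renewal_op_def
  by (intro nn_integral_mono) (auto simp: indicator_def intro!: mult_right_mono assms)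

text \<open>
  The kernel has mass at most \<open>q < 1\<close>, so every use of the two inequalities multiplies a uniform bound
  for the excess of \<open>f\<close> over \<open>g\<close> by \<open>q\<close>.
\<close>
lemma renewal_comparison:
  fixes a :: "real \<Rightarrow> ennreal"
  assumes [measurable]: "a \<in> borel_measurable borel" "g \<in> borel_measurable borel"
    and q: "(\<integral>\<^sup>+s. a s * indicator {0..} s \<partial>lborel) \<le> ennreal q" "0 \<le> q" "q < 1"
    and f: "\<And>x. 0 \<le> x \<Longrightarrow> f x \<le> renewal_op a f x + b x"
    and g: "\<And>x. 0 \<le> x \<Longrightarrow> renewal_op a g x + b x \<le> g x"
    and bound: "\<And>x. 0 \<le> x \<Longrightarrow> f x \<le> ennreal C" and "0 \<le> x"
  shows "f x \<le> g x"
proof -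
  have "f x \<le> g x + ennreal (q ^ n * \<bar>C\<bar>)" if "0 \<le> x" for n x
    using that
  proof (induction n arbitrary: x)
    case 0
    have "f x \<le> ennreal \<bar>C\<bar>" by (rule order_trans[OF bound[OF 0] ennreal_leI]) simp
    also have "\<dots> \<le> g x + ennreal \<bar>C\<bar>" by (rule add_increasing) auto
    finally show ?case by simp
  next
    case (Suc n)
    have "renewal_op a f x \<le> renewal_op a (\<lambda>y. g y + ennreal (q ^ n * \<bar>C\<bar>)) x"
      by (rule renewal_op_mono) (rule Suc.IH)
    also have "\<dots> = renewal_op a g x + ennreal (q ^ n * \<bar>C\<bar>) * (\<integral>\<^sup>+s. a s * indicator {0..x} s \<partial>lborel)"
      unfolding renewal_op_def
      by (subst nn_integral_cmult[symmetric], simp, subst nn_integral_add[symmetric]) (auto simp: distrib_right mult.assoc intro!: nn_integral_cong)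
    also have "\<dots> \<le> renewal_op a g x + ennreal (q ^ n * \<bar>C\<bar>) * ennreal q"
    proof (intro add_left_mono mult_left_mono)
      have "(\<integral>\<^sup>+s. a s * indicator {0..x} s \<partial>lborel) \<le> (\<integral>\<^sup>+s. a s * indicator {0..} s \<partial>lborel)"
        by (intro nn_integral_mono) (auto simp: indicator_def)
      then show "(\<integral>\<^sup>+s. a s * indicator {0..x} s \<partial>lborel) \<le> ennreal q" using q(1) by (rule order_trans)
    qed simp
    also have "ennreal (q ^ n * \<bar>C\<bar>) * ennreal q = ennreal (q ^ Suc n * \<bar>C\<bar>)"
      using q by (simp add: ennreal_mult[symmetric] ac_simps)
    finally have "f x \<le> renewal_op a g x + ennreal (q ^ Suc n * \<bar>C\<bar>) + b x"
      using f[OF Suc.prems] by (meson add_right_mono order_trans)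
    also have "\<dots> = (renewal_op a g x + b x) + ennreal (q ^ Suc n * \<bar>C\<bar>)" by (simp add: ac_simps)
    also have "\<dots> \<le> g x + ennreal (q ^ Suc n * \<bar>C\<bar>)" by (intro add_right_mono g Suc.prems)
    finally show ?case .
  qed
  moreover have "(\<lambda>n. g x + ennreal (q ^ n * \<bar>C\<bar>)) \<longlonglongrightarrow> g x + ennreal (0 * \<bar>C\<bar>)"
    using q by (intro tendsto_intros tendsto_ennrealI LIMSEQ_realpow_zero) auto
  ultimately show ?thesis using \<open>0 \<le> x\<close>
    by (intro LIMSEQ_le_const[where X="\<lambda>n. g x + ennreal (q ^ n * \<bar>C\<bar>)"]) auto
qed

context claim_law
begin

definition forcing :: "(real \<Rightarrow> ennreal) \<Rightarrow> real \<Rightarrow> ennreal" where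
  "forcing w x = (\<integral>\<^sup>+y. w y * ladder (x + y) * indicator {0..} y \<partial>lborel)"

definition overshoot_rate :: "(real \<Rightarrow> ennreal) \<Rightarrow> real \<Rightarrow> ennreal" where
  "overshoot_rate w v = (\<integral>\<^sup>+z. w (z - v) * indicator {v<..} z \<partial>\<nu>)"

text \<open>
  Where \<open>s > 0\<close> the integrand grows strictly with the exponent, unless the density vanishes there.
\<close>
lemma tilt_strict:
  assumes "r < R" and R: "(\<integral>\<^sup>+s. ennreal (exp (R * s)) * ladder s * indicator {0..} s \<partial>lborel) = 1"
  shows "(\<integral>\<^sup>+s. ennreal (exp (r * s)) * ladder s * indicator {0..} s \<partial>lborel) < 1"
proof -
  let ?I = "\<integral>\<^sup>+s. ennreal (exp (r * s)) * ladder s * indicator {0..} s \<partial>lborel"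
  let ?D = "\<integral>\<^sup>+s. ennreal (exp (R * s) - exp (r * s)) * ladder s * indicator {0..} s \<partial>lborel"
  have split: "ennreal (exp (R * s)) * ladder s * indicator {0..} s
     = ennreal (exp (r * s)) * ladder s * indicator {0..} s + ennreal (exp (R * s) - exp (r * s)) * ladder s * indicator {0..} s" for s
  proof (cases "0 \<le> s")
    case True
    then have "exp (r * s) \<le> exp (R * s)" using assms(1) by (simp add: mult_right_mono)
    then have "ennreal (exp (R * s)) = ennreal (exp (r * s)) + ennreal (exp (R * s) - exp (r * s))"
      by (subst ennreal_plus[symmetric]) auto
    then show ?thesis by (simp add: distrib_right)
  qed simp
  have sum: "1 = ?I + ?D"
    unfolding R[symmetric] split by (rule nn_integral_add) auto
  have "?I \<noteq> 1"
  proof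
    assume eq: "?I = 1"
    then have "1 + 0 = 1 + ?D" using sum by simp
    then have "?D = 0" unfolding ennreal_add_left_cancel by simp
    then have "AE s in lborel. ennreal (exp (R * s) - exp (r * s)) * ladder s * indicator {0..} s = 0"
      by (subst (asm) nn_integral_0_iff_AE) auto
    with AE_lborel_singleton[of 0] have "AE s in lborel. ennreal (exp (r * s)) * ladder s * indicator {0..} s = 0"
    proof eventually_elim
      case (elim s)
      show ?case
      proof (cases "0 < s")
        case True
        then have "ennreal (exp (R * s) - exp (r * s)) \<noteq> 0" using assms(1) by (simp add: ennreal_eq_0_iff)
        then show ?thesis using elim(2) by auto
      qed (use elim(1) in \<open>auto simp: indicator_def\<close>)
    qed
    then have "?I = 0" by (subst nn_integral_0_iff_AE) auto
    then show False using eq by simp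
  qed
  moreover have "?I \<le> 1" unfolding sum by simp
  ultimately show ?thesis by simp
qed

lemma overshoot_rate_measurable [measurable]:
  assumes [measurable]: "w \<in> borel_measurable borel"
  shows "overshoot_rate w \<in> borel_measurable borel"
proof -
  have "overshoot_rate w = after_claim \<nu> w (\<lambda>_. 0)"
    unfolding overshoot_rate_def after_claim_def by (intro ext nn_integral_cong) (auto simp: indicator_def)
  then show ?thesis by simp
qed

lemma after_claim_split:
  assumes [measurable]: "w \<in> borel_measurable borel" "\<phi> \<in> borel_measurable borel"
  shows "after_claim \<nu> w \<phi> v = (\<integral>\<^sup>+z. \<phi> (v - z) * indicator {..v} z \<partial>\<nu>) + overshoot_rate w v"
  unfolding after_claim_def overshoot_rate_def
  by (subst nn_integral_add[symmetric]) (auto simp: indicator_def intro!: nn_integral_cong)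

text \<open>
  In the double integral of \<open>first_step_integrated\<close> this is the weight of the value just before a
  claim at \<open>v\<close>, the second summand being the share of \<open>D 0\<close>. It equals 1 for \<open>v \<le> x\<close>, and for \<open>v \<ge> x\<close>
  it is the weight in the first-step equation at \<open>x\<close>, up to the factor \<open>\<kappa>\<close>.
\<close>
lemma exp_kernel_integral:
  assumes "0 \<le> v" "0 \<le> x"
  shows "(\<integral>\<^sup>+u. ennreal (\<kappa> * exp (\<kappa> * (u - v))) * indicator {0..x} u * indicator {u..} v \<partial>lborel) + ennreal (exp (- \<kappa> * v))
    = ennreal (exp (\<kappa> * (min v x - v)))"
proof -
  have "(\<integral>\<^sup>+u. ennreal (\<kappa> * exp (\<kappa> * (u - v))) * indicator {0..x} u * indicator {u..} v \<partial>lborel)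
     = (\<integral>\<^sup>+u. ennreal (\<kappa> * exp (\<kappa> * (u - v))) * indicator {0..min v x} u \<partial>lborel)"
    by (intro nn_integral_cong) (auto simp: indicator_def)
  also have "\<dots> = ennreal (exp (\<kappa> * (min v x - v)) - exp (\<kappa> * (0 - v)))"
    by (rule nn_integral_FTC_Icc) (use kappa_pos assms in \<open>auto intro!: derivative_eq_intros\<close>)
  also have "\<dots> + ennreal (exp (- \<kappa> * v)) = ennreal (exp (\<kappa> * (min v x - v)))"
  proof -
    have "0 \<le> \<kappa> * min v x" using kappa_pos assms by simp
    then have "exp (- \<kappa> * v) \<le> exp (\<kappa> * (min v x - v))" by (simp add: right_diff_distrib)
    then show ?thesis by (subst ennreal_plus[symmetric]) auto
  qed
  finally show ?thesis .
qed

text \<open>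
  The first-step equation represents \<open>exp (- \<kappa> u) * D u\<close> as an integral from \<open>u\<close> to infinity, so
  formally \<open>D' = \<kappa> (D - m)\<close> where \<open>m\<close> is the value just before a claim. This is the integral of that
  differential equation over \<open>[0, x]\<close>, with all terms on the side where they are positive; it
  follows by exchanging the order of integration instead of differentiating.
\<close>
lemma first_step_integrated:
  assumes [measurable]: "w \<in> borel_measurable borel" "D \<in> borel_measurable borel"
    and fp: "\<And>u. 0 \<le> u \<Longrightarrow> D u = first_step l c \<nu> w D u" and x: "0 \<le> x"
  shows "(\<integral>\<^sup>+u. ennreal \<kappa> * D u * indicator {0..x} u \<partial>lborel) + D 0
    = D x + (\<integral>\<^sup>+v. ennreal \<kappa> * after_claim \<nu> w D v * indicator {0..x} v \<partial>lborel)"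
proof -
  let ?m = "after_claim \<nu> w D"
  let ?e = "\<lambda>u v. ennreal (\<kappa> * exp (\<kappa> * (u - v))) * indicator {0..x} u * (indicator {u..} v :: ennreal)"
  have [measurable]: "?m \<in> borel_measurable borel" by measurable
  have m1: "(\<lambda>u. ennreal (\<kappa> * exp (\<kappa> * (u - v))) * indicator {0..x} u * indicator {u..} v) \<in> borel_measurable lborel" for v
  proof -
    have "(\<lambda>u. ennreal (\<kappa> * exp (\<kappa> * (u - v))) * indicator {0..x} u * (indicator {..v} u :: ennreal)) \<in> borel_measurable lborel" by measurable
    then show ?thesis by (rule measurable_cong[THEN iffD1, rotated]) (auto simp: indicator_def)
  qed
  have D: "D u = (\<integral>\<^sup>+v. ennreal (\<kappa> * exp (\<kappa> * (u - v))) * indicator {u..} v * ?m v \<partial>lborel)" if "0 \<le> u" for u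
    using fp[OF that] first_step_lborel[of w D u] by (simp add: right_diff_distrib)
  have "(\<integral>\<^sup>+u. ennreal \<kappa> * D u * indicator {0..x} u \<partial>lborel)
    = (\<integral>\<^sup>+u. (\<integral>\<^sup>+v. ennreal \<kappa> * ?m v * ?e u v \<partial>lborel) \<partial>lborel)"
  proof (rule nn_integral_cong)
    fix u :: real
    show "ennreal \<kappa> * D u * indicator {0..x} u
       = (\<integral>\<^sup>+v. ennreal \<kappa> * ?m v * ?e u v \<partial>lborel)"
    proof (cases "u \<in> {0..x}")
      case True
      then have u: "0 \<le> u" by simp
      have "ennreal \<kappa> * D u = (\<integral>\<^sup>+v. ennreal \<kappa> * (ennreal (\<kappa> * exp (\<kappa> * (u - v))) * indicator {u..} v * ?m v) \<partial>lborel)"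
        unfolding D[OF u] by (rule nn_integral_cmult[symmetric]) measurable
      then show ?thesis using True by (simp add: ac_simps)
    qed simp
  qed
  also have "\<dots> = (\<integral>\<^sup>+v. (\<integral>\<^sup>+u. ennreal \<kappa> * ?m v * ?e u v \<partial>lborel) \<partial>lborel)"
  proof (rule lborel_pair.Fubini'[symmetric])
    have "(\<lambda>p. ennreal \<kappa> * ?m (snd p) * (ennreal (\<kappa> * exp (\<kappa> * (fst p - snd p))) * indicator {0..x} (fst p) * (indicator {p. fst p \<le> snd p} p :: ennreal))) \<in> borel_measurable (borel \<Otimes>\<^sub>M borel)"
      by measurable
    then have "(\<lambda>(u, v). ennreal \<kappa> * ?m v * ?e u v) \<in> borel_measurable (borel \<Otimes>\<^sub>M borel)"
      by (rule measurable_cong[THEN iffD1, rotated]) (auto simp: indicator_def)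
    then show "(\<lambda>(u, v). ennreal \<kappa> * ?m v * ?e u v) \<in> borel_measurable (lborel \<Otimes>\<^sub>M lborel)"
      by measurable
  qed
  also have "\<dots> = (\<integral>\<^sup>+v. ennreal \<kappa> * ?m v * (\<integral>\<^sup>+u. ?e u v \<partial>lborel) \<partial>lborel)"
    by (intro nn_integral_cong nn_integral_cmult m1)
  also have "\<dots> = (\<integral>\<^sup>+v. ennreal \<kappa> * ?m v * (\<integral>\<^sup>+u. ?e u v \<partial>lborel) * indicator {0..} v \<partial>lborel)" (is "_ = ?I1")
  proof (rule nn_integral_cong)
    fix v :: real
    show "ennreal \<kappa> * ?m v * (\<integral>\<^sup>+u. ?e u v \<partial>lborel)
      = ennreal \<kappa> * ?m v * (\<integral>\<^sup>+u. ?e u v \<partial>lborel) * indicator {0..} v"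
    proof (cases "0 \<le> v")
      case False
      have "(\<integral>\<^sup>+u. ?e u v \<partial>lborel) = (\<integral>\<^sup>+(u::real). 0 \<partial>lborel)"
        by (intro nn_integral_cong) (use False in \<open>auto simp: indicator_def\<close>)
      then show ?thesis by simp
    qed simp
  qed
  finally have L: "(\<integral>\<^sup>+u. ennreal \<kappa> * D u * indicator {0..x} u \<partial>lborel) = ?I1" .
  have D0: "D 0 = (\<integral>\<^sup>+v. ennreal \<kappa> * ?m v * ennreal (exp (- \<kappa> * v)) * indicator {0..} v \<partial>lborel)"
    unfolding D[OF order_refl] using kappa_pos by (auto simp: ennreal_mult ac_simps intro!: nn_integral_cong)
  have Dx: "D x = (\<integral>\<^sup>+v. ennreal \<kappa> * ?m v * ennreal (exp (\<kappa> * (x - v))) * indicator {x..} v \<partial>lborel)"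
    unfolding D[OF x] using kappa_pos by (auto simp: ennreal_mult ac_simps intro!: nn_integral_cong)
  have I1m: "(\<lambda>v. ennreal \<kappa> * ?m v * (\<integral>\<^sup>+u. ?e u v \<partial>lborel) * indicator {0..} v) \<in> borel_measurable lborel"
  proof -
    have "(\<lambda>p. (ennreal (\<kappa> * exp (\<kappa> * (snd p - fst p))) * indicator {0..x} (snd p) * (indicator {p. snd p \<le> fst p} p :: ennreal))) \<in> borel_measurable (borel \<Otimes>\<^sub>M lborel)"
      by measurable
    from lborel.borel_measurable_nn_integral_fst[OF this]
    have "(\<lambda>v. \<integral>\<^sup>+u. ennreal (\<kappa> * exp (\<kappa> * (u - v))) * indicator {0..x} u * indicator {p. snd p \<le> fst p} (v, u) \<partial>lborel) \<in> borel_measurable borel" by simp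
    moreover have "indicator {p. snd p \<le> fst p} (v, u) = (indicator {u..} v :: ennreal)" for u v :: real by (simp add: indicator_def)
    ultimately have [measurable]: "(\<lambda>v. \<integral>\<^sup>+u. ?e u v \<partial>lborel) \<in> borel_measurable borel" by simp
    show ?thesis by measurable
  qed
  have "?I1 + D 0 = (\<integral>\<^sup>+v. ennreal \<kappa> * ?m v * (\<integral>\<^sup>+u. ?e u v \<partial>lborel) * indicator {0..} v
      + ennreal \<kappa> * ?m v * ennreal (exp (- \<kappa> * v)) * indicator {0..} v \<partial>lborel)"
    unfolding D0 by (rule nn_integral_add[symmetric, OF I1m]) measurable
  also have "\<dots> = (\<integral>\<^sup>+v. ennreal \<kappa> * ?m v * ennreal (exp (\<kappa> * (x - v))) * indicator {x..} v + ennreal \<kappa> * ?m v * indicator {0..x} v \<partial>lborel)"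
  proof (intro nn_integral_cong_AE eventually_mono[OF AE_lborel_singleton[of x]])
    fix v assume "v \<noteq> x"
    show "ennreal \<kappa> * ?m v * (\<integral>\<^sup>+u. ?e u v \<partial>lborel) * indicator {0..} v
      + ennreal \<kappa> * ?m v * ennreal (exp (- \<kappa> * v)) * indicator {0..} v
      = ennreal \<kappa> * ?m v * ennreal (exp (\<kappa> * (x - v))) * indicator {x..} v + ennreal \<kappa> * ?m v * indicator {0..x} v"
    proof (cases "0 \<le> v")
      case True
      have "ennreal \<kappa> * ?m v * (\<integral>\<^sup>+u. ?e u v \<partial>lborel) * indicator {0..} v
        + ennreal \<kappa> * ?m v * ennreal (exp (- \<kappa> * v)) * indicator {0..} v = ennreal \<kappa> * ?m v * ennreal (exp (\<kappa> * (min v x - v)))"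
        using True by (simp add: distrib_left[symmetric] exp_kernel_integral[OF True x, simplified])
      then show ?thesis using True \<open>v \<noteq> x\<close> by (cases "v \<le> x") auto
    qed (use x in auto)
  qed
  also have "\<dots> = D x + (\<integral>\<^sup>+v. ennreal \<kappa> * ?m v * indicator {0..x} v \<partial>lborel)"
    unfolding Dx by (rule nn_integral_add) measurable
  finally show ?thesis unfolding L .
qed


lemma nn_integral_reflect:
  fixes f :: "real \<Rightarrow> ennreal"
  assumes [measurable]: "f \<in> borel_measurable borel"
  shows "(\<integral>\<^sup>+s. f (x - s) \<partial>lborel) = (\<integral>\<^sup>+s. f s \<partial>lborel)"
  using nn_integral_real_affine[of f "-1" x] by simp

lemma nn_integral_shift:
  fixes f :: "real \<Rightarrow> ennreal"
  assumes [measurable]: "f \<in> borel_measurable borel"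
  shows "(\<integral>\<^sup>+s. f (x + s) \<partial>lborel) = (\<integral>\<^sup>+s. f s \<partial>lborel)"
  using nn_integral_real_affine[of f 1 x] by simp

lemma emeasure_atMost_tail: "emeasure \<nu> {..x} + tail x = 1"
proof -
  have "emeasure \<nu> ({..x} \<union> {x<..}) = emeasure \<nu> {..x} + emeasure \<nu> {x<..}"
    by (rule plus_emeasure[symmetric]) (auto simp: sets_law)
  moreover have "{..x} \<union> {x<..} = space \<nu>" by auto
  ultimately show ?thesis by (simp only: tail_def emeasure_space_1)
qed

lemma emeasure_atMost_measurable [measurable]: "(\<lambda>x. emeasure \<nu> {..x}) \<in> borel_measurable borel"
proof -
  have "(\<lambda>x. 1 - tail x) \<in> borel_measurable borel" by measurable
  moreover have "1 - tail x = emeasure \<nu> {..x}" for x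
    using emeasure_atMost_tail[of x] tail_le_1[of x]
    by (metis ennreal_add_diff_cancel_right neq_top_trans ennreal_one_neq_top)
  ultimately show ?thesis by simp
qed

lemma renewal_op_ladder:
  assumes [measurable]: "D \<in> borel_measurable borel"
  shows "renewal_op ladder D x = (\<integral>\<^sup>+y. ennreal \<kappa> * D y * tail (x - y) * indicator {0..x} y \<partial>lborel)"
proof -
  have "renewal_op ladder D x = (\<integral>\<^sup>+s. (\<lambda>y. ennreal \<kappa> * D y * tail (x - y) * indicator {0..x} y) (x - s) \<partial>lborel)"
    unfolding renewal_op_def ladder_def by (intro nn_integral_cong) (auto simp: indicator_def ac_simps)
  also have "\<dots> = (\<integral>\<^sup>+y. ennreal \<kappa> * D y * tail (x - y) * indicator {0..x} y \<partial>lborel)"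
    by (rule nn_integral_reflect) measurable
  finally show ?thesis .
qed

text \<open>
  Fubini: integrating the convolution with the law of the claims in the reserve replaces the law by its
  distribution function.
\<close>
lemma convolution_law:
  assumes [measurable]: "D \<in> borel_measurable borel"
  shows "(\<integral>\<^sup>+v. ennreal \<kappa> * (\<integral>\<^sup>+z. D (v - z) * indicator {..v} z \<partial>\<nu>) * indicator {0..x} v \<partial>lborel)
    = (\<integral>\<^sup>+y. ennreal \<kappa> * D y * emeasure \<nu> {..x - y} * indicator {0..x} y \<partial>lborel)"
proof -
  have m: "(\<lambda>(v, z). ennreal \<kappa> * (D (v - z) * indicator {..v} z) * indicator {0..x} v) \<in> borel_measurable (borel \<Otimes>\<^sub>M (borel :: real measure))"
  proof -
    have "(\<lambda>p. ennreal \<kappa> * (D (fst p - snd p) * (indicator {p. snd p \<le> fst p} p :: ennreal)) * indicator {0..x} (fst p)) \<in> borel_measurable (borel \<Otimes>\<^sub>M (borel :: real measure))"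
      by measurable
    then show ?thesis by (rule measurable_cong[THEN iffD1, rotated]) (auto simp: indicator_def)
  qed
  have m2: "(\<lambda>(y, z). ennreal \<kappa> * D y * indicator {0..x} y * indicator {..x - y} z) \<in> borel_measurable (borel \<Otimes>\<^sub>M (borel :: real measure))"
  proof -
    have "(\<lambda>p. ennreal \<kappa> * D (fst p) * indicator {0..x} (fst p) * (indicator {p. snd p \<le> x - fst p} p :: ennreal)) \<in> borel_measurable (borel \<Otimes>\<^sub>M (borel :: real measure))"
      by measurable
    then show ?thesis by (rule measurable_cong[THEN iffD1, rotated]) (auto simp: indicator_def)
  qed
  have "(\<integral>\<^sup>+v. ennreal \<kappa> * (\<integral>\<^sup>+z. D (v - z) * indicator {..v} z \<partial>\<nu>) * indicator {0..x} v \<partial>lborel)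
     = (\<integral>\<^sup>+v. (\<integral>\<^sup>+z. ennreal \<kappa> * (D (v - z) * indicator {..v} z) * indicator {0..x} v \<partial>\<nu>) \<partial>lborel)"
  proof (rule nn_integral_cong)
    fix v :: real
    have [measurable]: "(\<lambda>z. D (v - z) * indicator {..v} z) \<in> borel_measurable \<nu>" by measurable
    show "ennreal \<kappa> * (\<integral>\<^sup>+z. D (v - z) * indicator {..v} z \<partial>\<nu>) * indicator {0..x} v
       = (\<integral>\<^sup>+z. ennreal \<kappa> * (D (v - z) * indicator {..v} z) * indicator {0..x} v \<partial>\<nu>)"
      by (simp add: nn_integral_cmult nn_integral_multc)
  qed
  also have "\<dots> = (\<integral>\<^sup>+z. (\<integral>\<^sup>+v. ennreal \<kappa> * (D (v - z) * indicator {..v} z) * indicator {0..x} v \<partial>lborel) \<partial>\<nu>)"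
    by (rule nn_integral_swap[symmetric, OF m])
  also have "\<dots> = (\<integral>\<^sup>+z. (\<integral>\<^sup>+y. ennreal \<kappa> * D y * indicator {0..x} y * indicator {..x - y} z \<partial>lborel) \<partial>\<nu>)"
  proof (rule nn_integral_cong_AE, rule eventually_mono[OF claim_pos])
    fix z :: real assume z: "0 < z"
    have "(\<integral>\<^sup>+v. ennreal \<kappa> * (D (v - z) * indicator {..v} z) * indicator {0..x} v \<partial>lborel)
       = (\<integral>\<^sup>+y. ennreal \<kappa> * (D ((z + y) - z) * indicator {z..} (z + y)) * indicator {0..x} (z + y) \<partial>lborel)"
      by (subst nn_integral_shift[of "\<lambda>v. ennreal \<kappa> * (D (v - z) * indicator {z..} v) * indicator {0..x} v"])
        (auto simp: indicator_def intro!: nn_integral_cong)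
    also have "\<dots> = (\<integral>\<^sup>+y. ennreal \<kappa> * D y * indicator {0..x} y * indicator {..x - y} z \<partial>lborel)"
      using z by (intro nn_integral_cong) (auto simp: indicator_def)
    finally show "(\<integral>\<^sup>+v. ennreal \<kappa> * (D (v - z) * indicator {..v} z) * indicator {0..x} v \<partial>lborel)
      = (\<integral>\<^sup>+y. ennreal \<kappa> * D y * indicator {0..x} y * indicator {..x - y} z \<partial>lborel)" .
  qed
  also have "\<dots> = (\<integral>\<^sup>+y. (\<integral>\<^sup>+z. ennreal \<kappa> * D y * indicator {0..x} y * indicator {..x - y} z \<partial>\<nu>) \<partial>lborel)"
    by (rule nn_integral_swap[OF m2])
  also have "\<dots> = (\<integral>\<^sup>+y. ennreal \<kappa> * D y * emeasure \<nu> {..x - y} * indicator {0..x} y \<partial>lborel)"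
    by (subst nn_integral_cmult_indicator) (auto simp: ac_simps sets_law)
  finally show ?thesis .
qed

text \<open>
  Fubini: integrating the expected penalty at a claim over the reserve replaces the law of the claims
  by its tail, that is, by the density of the ladder heights.
\<close>
lemma forcing_as_rate:
  assumes [measurable]: "w \<in> borel_measurable borel"
  shows "(\<integral>\<^sup>+v. ennreal \<kappa> * overshoot_rate w v * indicator {x<..} v \<partial>lborel) = forcing w x"
proof -
  have m: "(\<lambda>(v, z). ennreal \<kappa> * (w (z - v) * indicator {v<..} z) * indicator {x<..} v) \<in> borel_measurable (borel \<Otimes>\<^sub>M (borel :: real measure))"
  proof -
    have "(\<lambda>p. ennreal \<kappa> * (w (snd p - fst p) * (indicator {p. fst p < snd p} p :: ennreal)) * indicator {x<..} (fst p)) \<in> borel_measurable (borel \<Otimes>\<^sub>M (borel :: real measure))"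
      by measurable
    then show ?thesis by (rule measurable_cong[THEN iffD1, rotated]) (auto simp: indicator_def)
  qed
  have m2: "(\<lambda>(y, z). ennreal \<kappa> * w y * indicator {0<..} y * indicator {x + y<..} z) \<in> borel_measurable (borel \<Otimes>\<^sub>M (borel :: real measure))"
  proof -
    have "(\<lambda>p. ennreal \<kappa> * w (fst p) * indicator {0<..} (fst p) * (indicator {p. x + fst p < snd p} p :: ennreal)) \<in> borel_measurable (borel \<Otimes>\<^sub>M (borel :: real measure))"
      by measurable
    then show ?thesis by (rule measurable_cong[THEN iffD1, rotated]) (auto simp: indicator_def)
  qed
  have "(\<integral>\<^sup>+v. ennreal \<kappa> * overshoot_rate w v * indicator {x<..} v \<partial>lborel)
     = (\<integral>\<^sup>+v. (\<integral>\<^sup>+z. ennreal \<kappa> * (w (z - v) * indicator {v<..} z) * indicator {x<..} v \<partial>\<nu>) \<partial>lborel)"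
  proof (rule nn_integral_cong)
    fix v :: real
    have [measurable]: "(\<lambda>z. w (z - v) * indicator {v<..} z) \<in> borel_measurable \<nu>" by measurable
    show "ennreal \<kappa> * overshoot_rate w v * indicator {x<..} v
       = (\<integral>\<^sup>+z. ennreal \<kappa> * (w (z - v) * indicator {v<..} z) * indicator {x<..} v \<partial>\<nu>)"
      unfolding overshoot_rate_def by (simp add: nn_integral_cmult nn_integral_multc)
  qed
  also have "\<dots> = (\<integral>\<^sup>+z. (\<integral>\<^sup>+v. ennreal \<kappa> * (w (z - v) * indicator {v<..} z) * indicator {x<..} v \<partial>lborel) \<partial>\<nu>)"
    by (rule nn_integral_swap[symmetric, OF m])
  also have "\<dots> = (\<integral>\<^sup>+z. (\<integral>\<^sup>+y. ennreal \<kappa> * w y * indicator {0<..} y * indicator {x + y<..} z \<partial>lborel) \<partial>\<nu>)"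
  proof (rule nn_integral_cong)
    fix z :: real
    have "(\<integral>\<^sup>+v. ennreal \<kappa> * (w (z - v) * indicator {v<..} z) * indicator {x<..} v \<partial>lborel)
      = (\<integral>\<^sup>+v. (\<lambda>y. ennreal \<kappa> * w y * indicator {0<..} y * indicator {..<z - x} y) (z - v) \<partial>lborel)"
      by (intro nn_integral_cong) (auto simp: indicator_def)
    also have "\<dots> = (\<integral>\<^sup>+y. ennreal \<kappa> * w y * indicator {0<..} y * indicator {..<z - x} y \<partial>lborel)"
      by (rule nn_integral_reflect) measurable
    also have "\<dots> = (\<integral>\<^sup>+y. ennreal \<kappa> * w y * indicator {0<..} y * indicator {x + y<..} z \<partial>lborel)"
      by (intro nn_integral_cong) (auto simp: indicator_def)
    finally show "(\<integral>\<^sup>+v. ennreal \<kappa> * (w (z - v) * indicator {v<..} z) * indicator {x<..} v \<partial>lborel)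
      = (\<integral>\<^sup>+y. ennreal \<kappa> * w y * indicator {0<..} y * indicator {x + y<..} z \<partial>lborel)" .
  qed
  also have "\<dots> = (\<integral>\<^sup>+y. (\<integral>\<^sup>+z. ennreal \<kappa> * w y * indicator {0<..} y * indicator {x + y<..} z \<partial>\<nu>) \<partial>lborel)"
    by (rule nn_integral_swap[OF m2])
  also have "\<dots> = (\<integral>\<^sup>+y. ennreal \<kappa> * w y * indicator {0<..} y * tail (x + y) \<partial>lborel)"
    by (subst nn_integral_cmult_indicator) (auto simp: tail_def sets_law)
  also have "\<dots> = forcing w x"
    unfolding forcing_def ladder_def
    by (intro nn_integral_cong_AE eventually_mono[OF AE_lborel_singleton[of 0]]) (auto simp: indicator_def ac_simps)
  finally show ?thesis .
qed

end

context lundberg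
begin

lemma ladder_le_tilted: "0 \<le> s \<Longrightarrow> ladder s \<le> ennreal (exp (R * s)) * ladder s"
proof -
  assume "0 \<le> s"
  then have "ennreal 1 \<le> ennreal (exp (R * s))" using R_pos by (intro ennreal_leI) simp
  then have "1 * ladder s \<le> ennreal (exp (R * s)) * ladder s" by (intro mult_right_mono) auto
  then show ?thesis by simp
qed

text \<open>
  The exponent 0 in \<open>tilt_strict\<close>.
\<close>
lemma ladder_mass: "\<exists>q. 0 \<le> q \<and> q < 1 \<and> (\<integral>\<^sup>+s. ladder s * indicator {0..} s \<partial>lborel) \<le> ennreal q"
proof -
  let ?I = "\<integral>\<^sup>+s. ladder s * indicator {0..} s \<partial>lborel"
  have less: "?I < 1" using tilt_strict[OF R_pos lundberg_eq] by simp
  then obtain q where "?I = ennreal q" "0 \<le> q" by (cases ?I) auto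
  with less show ?thesis by (intro exI[of _ q]) auto
qed

lemma renewal_op_exp_bound:
  assumes "\<And>u. 0 \<le> u \<Longrightarrow> D u \<le> C * ennreal (exp (- R * u))"
  shows "renewal_op ladder D x \<le> C * ennreal (exp (- R * x))"
proof -
  have "renewal_op ladder D x \<le> (\<integral>\<^sup>+s. (C * ennreal (exp (- R * x))) * (ennreal (exp (R * s)) * ladder s * indicator {0..} s) \<partial>lborel)"
    unfolding renewal_op_def
  proof (rule nn_integral_mono)
    fix s
    show "D (x - s) * ladder s * indicator {0..x} s \<le> (C * ennreal (exp (- R * x))) * (ennreal (exp (R * s)) * ladder s * indicator {0..} s)"
    proof (cases "s \<in> {0..x}")
      case True
      have "(C * ennreal (exp (- R * x))) * ennreal (exp (R * s)) = C * ennreal (exp (- R * (x - s)))"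
        by (simp add: mult.assoc ennreal_mult[symmetric] exp_add[symmetric] algebra_simps)
      then have "D (x - s) \<le> (C * ennreal (exp (- R * x))) * ennreal (exp (R * s))" using assms[of "x - s"] True by simp
      then show ?thesis using True by (auto simp: mult.assoc[symmetric] intro!: mult_right_mono)
    qed simp
  qed
  also have "\<dots> = C * ennreal (exp (- R * x))"
    by (subst nn_integral_cmult) (auto simp: lundberg_eq)
  finally show ?thesis .
qed

text \<open>
  In \<open>first_step_integrated\<close> both sides contain the integral \<open>I x\<close> of \<open>\<kappa> D y P (Z \<le> x - y)\<close>. When it
  is cancelled, \<open>K D x + D 0 = D x + G x\<close> remains, with \<open>G x\<close> the integral of the penalty rate over
  \<open>[0, x]\<close>. By the exponential bound \<open>D x\<close> and \<open>K D x\<close> vanish as \<open>x\<close> tends to infinity, so \<open>D 0\<close> is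
  the integral of the rate over the half-line; the part of it beyond \<open>x\<close> is the forcing term.
\<close>
lemma renewal_equation:
  assumes [measurable]: "w \<in> borel_measurable borel" "D \<in> borel_measurable borel"
    and fp: "\<And>u. 0 \<le> u \<Longrightarrow> D u = first_step l c \<nu> w D u"
    and bound: "\<And>u. 0 \<le> u \<Longrightarrow> D u \<le> ennreal C * ennreal (exp (- R * u))" and C: "0 \<le> C"
    and x: "0 \<le> x"
  shows "D x = renewal_op ladder D x + forcing w x"
proof -
  define G where "G x = (\<integral>\<^sup>+v. ennreal \<kappa> * overshoot_rate w v * indicator {0..x} v \<partial>lborel)" for x
  define I where "I x = (\<integral>\<^sup>+y. ennreal \<kappa> * D y * emeasure \<nu> {..x - y} * indicator {0..x} y \<partial>lborel)" for x
  have Dle: "D u \<le> ennreal C" if "0 \<le> u" for u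
  proof -
    have "C * exp (- R * u) \<le> C * 1" using R_pos that C by (intro mult_left_mono) auto
    then show ?thesis using bound[OF that] C by (simp add: ennreal_mult[symmetric]) (meson ennreal_leI order_trans)
  qed
  have I_fin: "I x < \<infinity>" if "0 \<le> x" for x
  proof -
    have "I x \<le> (\<integral>\<^sup>+y. ennreal \<kappa> * ennreal C * indicator {0..x} y \<partial>lborel)"
      unfolding I_def
    proof (rule nn_integral_mono)
      fix y
      have "ennreal \<kappa> * D y * emeasure \<nu> {..x - y} \<le> ennreal \<kappa> * ennreal C * 1" if "y \<in> {0..x}"
        by (intro mult_mono Dle emeasure_le_1) (use that in auto)
      then show "ennreal \<kappa> * D y * emeasure \<nu> {..x - y} * indicator {0..x} y \<le> ennreal \<kappa> * ennreal C * indicator {0..x} y"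
        by (auto simp: indicator_def)
    qed
    also have "\<dots> < \<infinity>"
      using that by (subst nn_integral_cmult_indicator) (auto simp: ennreal_mult_less_top)
    finally show ?thesis .
  qed
  \<comment> \<open>\<open>P (Z \<le> x - y)\<close> and the tail at \<open>x - y\<close> add up to 1, which splits the left side of \<open>first_step_integrated\<close>\<close>
  have bal: "renewal_op ladder D x + D 0 = D x + G x" if x: "0 \<le> x" for x
  proof -
    have "(\<integral>\<^sup>+u. ennreal \<kappa> * D u * indicator {0..x} u \<partial>lborel) = I x + renewal_op ladder D x"
      unfolding renewal_op_ladder[OF assms(2)] I_def
      by (subst nn_integral_add[symmetric], measurable, measurable, intro nn_integral_cong)
        (simp add: distrib_left[symmetric] distrib_right[symmetric] emeasure_atMost_tail)
    moreover have "(\<integral>\<^sup>+v. ennreal \<kappa> * after_claim \<nu> w D v * indicator {0..x} v \<partial>lborel) = I x + G x"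
    proof -
      have [measurable]: "(\<lambda>v. \<integral>\<^sup>+z. D (v - z) * indicator {..v} z \<partial>\<nu>) \<in> borel_measurable borel"
      proof -
        have "(\<lambda>v. \<integral>\<^sup>+z. D (v - z) * indicator {..v} z \<partial>\<nu>) = after_claim \<nu> (\<lambda>_. 0) D"
          unfolding after_claim_def by (intro ext nn_integral_cong) (auto simp: indicator_def)
        then show ?thesis by simp
      qed
      have "(\<integral>\<^sup>+v. ennreal \<kappa> * after_claim \<nu> w D v * indicator {0..x} v \<partial>lborel)
        = (\<integral>\<^sup>+v. ennreal \<kappa> * (\<integral>\<^sup>+z. D (v - z) * indicator {..v} z \<partial>\<nu>) * indicator {0..x} v
            + ennreal \<kappa> * overshoot_rate w v * indicator {0..x} v \<partial>lborel)"
        unfolding after_claim_split[OF assms(1,2)] by (intro nn_integral_cong) (simp add: distrib_left distrib_right)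
      also have "\<dots> = I x + G x"
        unfolding I_def G_def convolution_law[OF assms(2), symmetric] by (rule nn_integral_add) measurable
      finally show ?thesis .
    qed
    ultimately have "I x + (renewal_op ladder D x + D 0) = I x + (D x + G x)"
      using first_step_integrated[OF assms(1,2) fp x] by (simp add: ac_simps)
    then show ?thesis using I_fin[OF x] by (auto simp: ennreal_add_left_cancel)
  qed
  have G_forcing: "(\<integral>\<^sup>+v. ennreal \<kappa> * overshoot_rate w v * indicator {0..} v \<partial>lborel) = G x + forcing w x" if "0 \<le> x" for x
    unfolding forcing_as_rate[OF assms(1), symmetric] G_def using that
    by (subst nn_integral_add[symmetric]) (auto simp: indicator_def intro!: nn_integral_cong)
  define Ginf where "Ginf = (\<integral>\<^sup>+v. ennreal \<kappa> * overshoot_rate w v * indicator {0..} v \<partial>lborel)"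
  have e0: "(\<lambda>n. ennreal C * ennreal (exp (- R * real n))) \<longlonglongrightarrow> 0"
  proof -
    have "(\<lambda>n. exp (- R) ^ n) \<longlonglongrightarrow> 0" using R_pos by (intro LIMSEQ_realpow_zero) auto
    moreover have "exp (- R) ^ n = exp (- R * real n)" for n by (simp add: exp_of_nat_mult[symmetric] mult.commute)
    ultimately have "(\<lambda>n. exp (- R * real n)) \<longlonglongrightarrow> 0" by simp
    then have "(\<lambda>n. ennreal (C * exp (- R * real n))) \<longlonglongrightarrow> ennreal (C * 0)" by (intro tendsto_ennrealI tendsto_mult tendsto_const)
    then show ?thesis using C by (simp add: ennreal_mult)
  qed
  have Glim: "(\<lambda>n. G (real n)) \<longlonglongrightarrow> Ginf"
  proof -
    have inc: "incseq (\<lambda>n v. ennreal \<kappa> * overshoot_rate w v * indicator {0..real n} v)"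
      by (auto simp: incseq_def le_fun_def indicator_def)
    have sup: "(SUP n. ennreal \<kappa> * overshoot_rate w v * indicator {0..real n} v) = ennreal \<kappa> * overshoot_rate w v * indicator {0..} v" for v
    proof (rule antisym)
      show "(SUP n. ennreal \<kappa> * overshoot_rate w v * indicator {0..real n} v) \<le> ennreal \<kappa> * overshoot_rate w v * indicator {0..} v"
        by (rule SUP_least) (auto simp: indicator_def)
      obtain n :: nat where "v \<le> real n" using real_arch_simple by blast
      then show "ennreal \<kappa> * overshoot_rate w v * indicator {0..} v \<le> (SUP n. ennreal \<kappa> * overshoot_rate w v * indicator {0..real n} v)"
        by (intro SUP_upper2[of n]) (auto simp: indicator_def)
    qed
    have "Ginf = (SUP n. G (real n))"
      unfolding Ginf_def G_def sup[symmetric] by (rule nn_integral_monotone_convergence_SUP[OF inc]) measurable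
    moreover have "incseq (\<lambda>n. G (real n))"
      unfolding G_def using inc by (auto simp: incseq_def le_fun_def intro!: nn_integral_mono)
    ultimately show ?thesis by (simp add: LIMSEQ_SUP)
  qed
  have "Ginf \<le> D 0"
  proof (rule LIMSEQ_le[OF Glim])
    show "(\<lambda>n. ennreal C * ennreal (exp (- R * real n)) + D 0) \<longlonglongrightarrow> D 0"
      using tendsto_add[OF e0 tendsto_const[of "D 0"]] by simp
    have "G (real n) \<le> ennreal C * ennreal (exp (- R * real n)) + D 0" for n
    proof -
      have "G (real n) \<le> renewal_op ladder D (real n) + D 0" unfolding bal[OF of_nat_0_le_iff] by simp
      also have "\<dots> \<le> ennreal C * ennreal (exp (- R * real n)) + D 0"
        by (intro add_right_mono renewal_op_exp_bound bound)
      finally show ?thesis .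
    qed
    then show "\<exists>N. \<forall>n\<ge>N. G (real n) \<le> ennreal C * ennreal (exp (- R * real n)) + D 0" by blast
  qed
  moreover have "D 0 \<le> Ginf"
  proof (rule LIMSEQ_le[OF tendsto_const])
    show "(\<lambda>n. ennreal C * ennreal (exp (- R * real n)) + G (real n)) \<longlonglongrightarrow> Ginf"
      using tendsto_add[OF e0 Glim] by simp
    have "D 0 \<le> ennreal C * ennreal (exp (- R * real n)) + G (real n)" for n
    proof -
      have "D 0 \<le> renewal_op ladder D (real n) + D 0" by simp
      also have "\<dots> = D (real n) + G (real n)" by (rule bal) simp
      also have "\<dots> \<le> ennreal C * ennreal (exp (- R * real n)) + G (real n)"
        by (intro add_right_mono bound) simp
      finally show ?thesis .
    qed
    then show "\<exists>N. \<forall>n\<ge>N. D 0 \<le> ennreal C * ennreal (exp (- R * real n)) + G (real n)" by blast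
  qed
  ultimately have "D 0 = G x + forcing w x" using G_forcing[OF x] by (simp add: Ginf_def)
  then have "G x + (renewal_op ladder D x + forcing w x) = G x + D x"
    using bal[OF x] by (simp add: ac_simps)
  moreover have "G x \<noteq> \<infinity>"
  proof -
    have "G x \<le> Ginf" unfolding Ginf_def G_forcing[OF x] by simp
    also have "\<dots> \<le> ennreal C" using \<open>Ginf \<le> D 0\<close> Dle[of 0] by (rule order_trans) simp
    finally show ?thesis by (auto simp: top_unique)
  qed
  ultimately show ?thesis by (auto simp: ennreal_add_left_cancel)
qed

end

section \<open>Two-sided bounds in the Lundberg scale\<close>

lemma power_le_fact_exp:
  fixes x :: real assumes "0 \<le> x"
  shows "x ^ j \<le> fact j * exp x"
proof -
  have "(\<Sum>n\<in>{j}. x ^ n /\<^sub>R fact n) \<le> (\<Sum>n. x ^ n /\<^sub>R fact n)"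
    by (rule sum_le_suminf[OF summable_exp_generic]) (use assms in auto)
  then have "x ^ j / fact j \<le> exp x" by (simp add: exp_def divide_inverse mult.commute)
  then show ?thesis by (simp add: field_simps)
qed

lemma nn_integral_lborel_swap:
  fixes f :: "real \<Rightarrow> real \<Rightarrow> ennreal"
  assumes "(\<lambda>(v, s). f v s) \<in> borel_measurable (borel \<Otimes>\<^sub>M borel)"
  shows "(\<integral>\<^sup>+v. (\<integral>\<^sup>+s. f v s \<partial>lborel) \<partial>lborel) = (\<integral>\<^sup>+s. (\<integral>\<^sup>+v. f v s \<partial>lborel) \<partial>lborel)"
proof -
  have "(\<lambda>(v, s). f v s) \<in> borel_measurable (lborel \<Otimes>\<^sub>M lborel)" using assms by measurable
  from lborel_pair.Fubini'[OF this] show ?thesis by simp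
qed

context lundberg
begin

definition tilted :: "real \<Rightarrow> ennreal" where "tilted s = ennreal (exp (R * s)) * ladder s"

definition tilted_moment :: "nat \<Rightarrow> ennreal" where
  "tilted_moment j = (\<integral>\<^sup>+s. ennreal (s ^ j) * tilted s * indicator {0..} s \<partial>lborel)"

text \<open>
  For a random variable \<open>S\<close> with density \<open>tilted\<close> this is the \<open>j\<close>-th moment of the positive part of
  \<open>S - v\<close>, the rate of overshoot moments of the tilted renewal process.
\<close>
definition excess :: "nat \<Rightarrow> real \<Rightarrow> ennreal" where
  "excess j v = (\<integral>\<^sup>+s. ennreal ((s - v) ^ j) * tilted s * indicator {v..} s \<partial>lborel)"

lemma tilted_measurable [measurable]: "tilted \<in> borel_measurable borel"
  unfolding tilted_def[abs_def] by measurable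

lemma tilted_mass: "(\<integral>\<^sup>+s. tilted s * indicator {0..} s \<partial>lborel) = 1"
  using lundberg_eq by (simp add: tilted_def)

lemma excess_mono: "v \<le> v' \<Longrightarrow> excess j v' \<le> excess j v"
  unfolding excess_def
  by (intro nn_integral_mono) (auto simp: indicator_def intro!: mult_right_mono ennreal_leI power_mono)

lemma excess_0: "excess j 0 = tilted_moment j"
  by (simp add: excess_def tilted_moment_def)

lemma excess_pair_measurable:
  "(\<lambda>(v, s). ennreal ((s - v) ^ j) * tilted s * indicator {v..} s) \<in> borel_measurable (borel \<Otimes>\<^sub>M borel)"
proof -
  have "(\<lambda>p. ennreal ((snd p - fst p) ^ j) * tilted (snd p) * (indicator {p. fst p \<le> snd p} p :: ennreal)) \<in> borel_measurable (borel \<Otimes>\<^sub>M borel)"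
    by measurable
  then show ?thesis by (rule measurable_cong[THEN iffD1, rotated]) (auto simp: indicator_def)
qed

lemma excess_measurable [measurable]: "excess j \<in> borel_measurable borel"
proof -
  have "(\<lambda>(v, s). ennreal ((s - v) ^ j) * tilted s * indicator {v..} s) \<in> borel_measurable (borel \<Otimes>\<^sub>M lborel)"
    using excess_pair_measurable by measurable
  from lborel.borel_measurable_nn_integral[OF this] show ?thesis unfolding excess_def[abs_def] .
qed

text \<open>
  By Fubini each \<open>s\<close> contributes the integral of \<open>(s - v) ^ j \<le> s ^ j\<close> over \<open>v\<close> in \<open>[0, s]\<close>.
\<close>
lemma excess_integral_le: "(\<integral>\<^sup>+v. excess j v * indicator {0..u} v \<partial>lborel) \<le> tilted_moment (Suc j)"
proof -
  have m: "(\<lambda>(v, s). ennreal ((s - v) ^ j) * tilted s * indicator {v..} s * indicator {0..u} v) \<in> borel_measurable (borel \<Otimes>\<^sub>M borel)"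
  proof -
    have "(\<lambda>p. (case p of (v, s) \<Rightarrow> ennreal ((s - v) ^ j) * tilted s * indicator {v..} s) * indicator {0..u} (fst p)) \<in> borel_measurable (borel \<Otimes>\<^sub>M (borel :: real measure))"
      using excess_pair_measurable by measurable
    then show ?thesis by (simp add: case_prod_unfold)
  qed
  have "(\<integral>\<^sup>+v. excess j v * indicator {0..u} v \<partial>lborel)
     = (\<integral>\<^sup>+v. (\<integral>\<^sup>+s. ennreal ((s - v) ^ j) * tilted s * indicator {v..} s * indicator {0..u} v \<partial>lborel) \<partial>lborel)"
    unfolding excess_def
  proof (rule nn_integral_cong, rule nn_integral_multc[symmetric])
    fix v :: real
    show "(\<lambda>s. ennreal ((s - v) ^ j) * tilted s * indicator {v..} s) \<in> borel_measurable lborel" by measurable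
  qed
  also have "\<dots> = (\<integral>\<^sup>+s. (\<integral>\<^sup>+v. ennreal ((s - v) ^ j) * tilted s * indicator {v..} s * indicator {0..u} v \<partial>lborel) \<partial>lborel)"
    by (rule nn_integral_lborel_swap[OF m])
  also have "\<dots> \<le> (\<integral>\<^sup>+s. ennreal (s ^ Suc j) * tilted s * indicator {0..} s \<partial>lborel)"
  proof (rule nn_integral_mono)
    fix s :: real
    show "(\<integral>\<^sup>+v. ennreal ((s - v) ^ j) * tilted s * indicator {v..} s * indicator {0..u} v \<partial>lborel)
       \<le> ennreal (s ^ Suc j) * tilted s * indicator {0..} s"
    proof (cases "0 \<le> s")
      case True
      have "(\<integral>\<^sup>+v. ennreal ((s - v) ^ j) * tilted s * indicator {v..} s * indicator {0..u} v \<partial>lborel)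
         \<le> (\<integral>\<^sup>+v. ennreal (s ^ j) * tilted s * indicator {0..s} v \<partial>lborel)"
        by (intro nn_integral_mono) (auto simp: indicator_def intro!: mult_right_mono ennreal_leI power_mono)
      also have "\<dots> = ennreal (s ^ j) * tilted s * ennreal s"
        using True by (subst nn_integral_cmult_indicator) auto
      also have "\<dots> = ennreal (s ^ Suc j) * tilted s"
        using True by (simp add: ennreal_mult ac_simps)
      finally show ?thesis using True by simp
    next
      case False
      have "(\<integral>\<^sup>+v. ennreal ((s - v) ^ j) * tilted s * indicator {v..} s * indicator {0..u} v \<partial>lborel) = (\<integral>\<^sup>+(v::real). 0 \<partial>lborel)"
        using False by (intro nn_integral_cong) (auto simp: indicator_def)
      then show ?thesis by simp
    qed
  qed
  finally show ?thesis unfolding tilted_moment_def .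
qed

lemma excess_integral_split:
  assumes "0 \<le> s" "s \<le> u"
  shows "(\<integral>\<^sup>+v. excess j v * indicator {0..u - s} v \<partial>lborel) + ennreal s * excess j u
    \<le> (\<integral>\<^sup>+v. excess j v * indicator {0..u} v \<partial>lborel)"
proof -
  have "ennreal s * excess j u = (\<integral>\<^sup>+v. excess j u * indicator {u - s<..u} v \<partial>lborel)"
    using assms by (subst nn_integral_cmult_indicator) (auto simp: mult.commute)
  then have "(\<integral>\<^sup>+v. excess j v * indicator {0..u - s} v \<partial>lborel) + ennreal s * excess j u
     = (\<integral>\<^sup>+v. excess j v * indicator {0..u - s} v + excess j u * indicator {u - s<..u} v \<partial>lborel)"
    by (simp add: nn_integral_add)
  also have "\<dots> \<le> (\<integral>\<^sup>+v. excess j v * indicator {0..u} v \<partial>lborel)"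
    using assms by (intro nn_integral_mono) (auto simp: indicator_def intro!: excess_mono)
  finally show ?thesis .
qed

text \<open>
  An upper bound for the \<open>j\<close>-th overshoot moment of the tilted renewal process above the level \<open>u\<close>.
  The first term pays for levels below \<open>u0\<close>, the integral for the steps that lead down from higher
  levels.
\<close>
definition lyapunov :: "real \<Rightarrow> real \<Rightarrow> nat \<Rightarrow> real \<Rightarrow> ennreal" where
  "lyapunov p u0 j u = ennreal (1 / p) * excess j 0
     + ennreal (1 / (u0 * p)) * (\<integral>\<^sup>+v. excess j v * indicator {0..u} v \<partial>lborel)"

lemma lyapunov_le:
  "lyapunov p u0 j u \<le> ennreal (1 / p) * tilted_moment j + ennreal (1 / (u0 * p)) * tilted_moment (Suc j)"
  unfolding lyapunov_def excess_0 by (intro add_left_mono mult_left_mono excess_integral_le) simp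

lemma lyapunov_measurable [measurable]: "lyapunov p u0 j \<in> borel_measurable borel"
proof -
  have "(\<lambda>p. excess j (snd p) * indicator {0..} (snd p) * (indicator {p. snd p \<le> fst p} p :: ennreal)) \<in> borel_measurable (borel \<Otimes>\<^sub>M lborel)"
    by measurable
  then have "(\<lambda>(u, v). excess j v * indicator {0..u} v) \<in> borel_measurable (borel \<Otimes>\<^sub>M lborel)"
    by (rule measurable_cong[THEN iffD1, rotated]) (auto simp: indicator_def)
  from lborel.borel_measurable_nn_integral[OF this]
  have [measurable]: "(\<lambda>u. \<integral>\<^sup>+v. excess j v * indicator {0..u} v \<partial>lborel) \<in> borel_measurable borel" .
  show ?thesis unfolding lyapunov_def[abs_def] by measurable
qed

text \<open>
  Let \<open>V\<close> be the Lyapunov function and \<open>\<beta> = excess j\<close>, which is decreasing. A step of size \<open>s \<le> u\<close>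
  lowers the integral in \<open>V\<close> by at least \<open>s * \<beta> u\<close>. A step beyond \<open>u\<close> ends the passage and frees all of
  \<open>V u\<close>, at least the constant term plus a multiple of \<open>u * \<beta> u\<close>. Steps of size at least \<open>u0\<close> have
  probability at least \<open>p\<close>. If \<open>u \<ge> u0\<close>, the expected size of the step cut off at \<open>u\<close> is at least
  \<open>u0 * p\<close>; if \<open>u < u0\<close>, the passage ends with probability at least \<open>p\<close>. The weights
  \<open>1 / (u0 * p)\<close> and \<open>1 / p\<close> make the expected decrease at least \<open>\<beta> u\<close> in both cases.
\<close>
lemma lyapunov_drift:
  assumes p: "0 < p" and u0: "0 < u0" and u: "0 \<le> u"
    and mass: "ennreal p \<le> (\<integral>\<^sup>+s. tilted s * indicator {u0..} s \<partial>lborel)"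
  shows "renewal_op tilted (lyapunov p u0 j) u + excess j u \<le> lyapunov p u0 j u"
proof -
  let ?V = "lyapunov p u0 j"
  let ?short = "\<integral>\<^sup>+s. ennreal (min s u) * tilted s * indicator {0..} s \<partial>lborel"
  let ?far = "\<integral>\<^sup>+s. tilted s * indicator {u<..} s \<partial>lborel"
  define A where "A = ennreal (1 / p) * excess j 0"
  define B where "B = ennreal (1 / (u0 * p)) * excess j u"
  have pt: "?V (u - s) * tilted s * indicator {0..u} s + (A * (tilted s * indicator {u<..} s) + B * (ennreal (min s u) * tilted s * indicator {0..} s))
     \<le> ?V u * (tilted s * indicator {0..} s)" for s
  proof -
    consider "s < 0" | "0 \<le> s" "s \<le> u" | "u < s" by linarith
    then show ?thesis
    proof cases
      case 2
      have "?V (u - s) + B * ennreal s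
        = ennreal (1 / p) * excess j 0 + ennreal (1 / (u0 * p)) * ((\<integral>\<^sup>+v. excess j v * indicator {0..u - s} v \<partial>lborel) + ennreal s * excess j u)"
        unfolding lyapunov_def B_def by (simp add: distrib_left ac_simps)
      also have "\<dots> \<le> ?V u"
        unfolding lyapunov_def by (intro add_left_mono mult_left_mono excess_integral_split 2) simp
      finally have "(?V (u - s) + B * ennreal s) * tilted s \<le> ?V u * tilted s" by (intro mult_right_mono) auto
      then show ?thesis using 2 by (simp add: distrib_right min_def mult.assoc)
    next
      case 3
      have "A + B * ennreal u \<le> ?V u"
      proof -
        have "ennreal u * excess j u \<le> (\<integral>\<^sup>+v. excess j v * indicator {0..u} v \<partial>lborel)"
          by (rule order_trans[OF add_increasing excess_integral_split[OF u order_refl]]) auto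
        then have "ennreal (1 / (u0 * p)) * (ennreal u * excess j u) \<le> ennreal (1 / (u0 * p)) * (\<integral>\<^sup>+v. excess j v * indicator {0..u} v \<partial>lborel)"
          by (rule mult_left_mono) simp
        then show ?thesis unfolding lyapunov_def A_def B_def by (simp add: ac_simps add_left_mono)
      qed
      then have "(A + B * ennreal u) * tilted s \<le> ?V u * tilted s" by (intro mult_right_mono) auto
      then show ?thesis using 3 u by (simp add: distrib_right min_def mult.assoc)
    qed (use u in simp)
  qed
  have "renewal_op tilted ?V u + (A * ?far
      + B * ?short)
    = (\<integral>\<^sup>+s. ?V (u - s) * tilted s * indicator {0..u} s + (A * (tilted s * indicator {u<..} s) + B * (ennreal (min s u) * tilted s * indicator {0..} s)) \<partial>lborel)"
    unfolding renewal_op_def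
    by (simp add: nn_integral_add nn_integral_cmult)
  also have "\<dots> \<le> (\<integral>\<^sup>+s. ?V u * (tilted s * indicator {0..} s) \<partial>lborel)"
    by (intro nn_integral_mono pt)
  also have "\<dots> = ?V u"
    by (subst nn_integral_cmult) (auto simp: tilted_mass)
  finally have *: "renewal_op tilted ?V u + (A * ?far
      + B * ?short) \<le> ?V u" .
  have "excess j u \<le> A * ?far
      + B * ?short"
  proof (cases "u0 \<le> u")
    case True
    have "excess j u = B * ennreal (u0 * p)"
    proof -
      have "ennreal (1 / (u0 * p)) * ennreal (u0 * p) = 1" using u0 p by (simp add: ennreal_mult[symmetric])
      then show ?thesis unfolding B_def by (metis mult.assoc mult.commute mult_1)
    qed
    also have "\<dots> = B * (ennreal u0 * ennreal p)" using u0 p by (simp add: ennreal_mult)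
    also have "\<dots> \<le> B * (ennreal u0 * (\<integral>\<^sup>+s. tilted s * indicator {u0..} s \<partial>lborel))"
      by (intro mult_left_mono mass) auto
    also have "\<dots> = B * (\<integral>\<^sup>+s. ennreal u0 * (tilted s * indicator {u0..} s) \<partial>lborel)"
      by (subst nn_integral_cmult) auto
    also have "\<dots> \<le> B * ?short"
      using True u0 by (intro mult_left_mono nn_integral_mono) (auto simp: indicator_def intro!: mult_right_mono ennreal_leI)
    finally show ?thesis by (rule order_trans) (rule add_increasing, auto)
  next
    case False
    have "excess j u \<le> excess j 0" using u by (rule excess_mono)
    also have "\<dots> = A * ennreal p"
    proof -
      have "ennreal (1 / p) * ennreal p = 1" using p by (simp add: ennreal_mult[symmetric])
      then show ?thesis unfolding A_def by (metis mult.assoc mult.commute mult_1)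
    qed
    also have "\<dots> \<le> A * (\<integral>\<^sup>+s. tilted s * indicator {u0..} s \<partial>lborel)" by (intro mult_left_mono mass) simp
    also have "\<dots> \<le> A * ?far"
      using False by (intro mult_left_mono nn_integral_mono) (auto simp: indicator_def)
    finally show ?thesis by (rule order_trans) (rule add_increasing2, auto)
  qed
  then have "renewal_op tilted ?V u + excess j u \<le> renewal_op tilted ?V u + (A * ?far
      + B * ?short)"
    by (rule add_left_mono)
  then show ?thesis using * by (rule order_trans)
qed

text \<open>
  Conjugation with \<open>exp (- R x)\<close> tilts the kernel.
\<close>
lemma renewal_op_exp:
  assumes [measurable]: "V \<in> borel_measurable borel"
  shows "renewal_op ladder (\<lambda>x. ennreal (exp (- R * x)) * V x) u = ennreal (exp (- R * u)) * renewal_op tilted V u"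
proof -
  have "renewal_op ladder (\<lambda>x. ennreal (exp (- R * x)) * V x) u
     = (\<integral>\<^sup>+s. ennreal (exp (- R * u)) * (V (u - s) * tilted s * indicator {0..u} s) \<partial>lborel)"
    unfolding renewal_op_def
  proof (rule nn_integral_cong)
    fix s
    have "ennreal (exp (- R * (u - s))) = ennreal (exp (- R * u)) * ennreal (exp (R * s))"
      by (simp add: ennreal_mult[symmetric] exp_add[symmetric] algebra_simps)
    then show "ennreal (exp (- R * (u - s))) * V (u - s) * ladder s * indicator {0..u} s
       = ennreal (exp (- R * u)) * (V (u - s) * tilted s * indicator {0..u} s)"
      by (simp add: tilted_def ac_simps)
  qed
  also have "\<dots> = ennreal (exp (- R * u)) * renewal_op tilted V u"
    unfolding renewal_op_def by (rule nn_integral_cmult) measurable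
  finally show ?thesis .
qed

lemma forcing_exp:
  assumes [measurable]: "w \<in> borel_measurable borel"
  shows "forcing w u = ennreal (exp (- R * u)) * (\<integral>\<^sup>+s. w (s - u) * ennreal (exp (- R * (s - u))) * tilted s * indicator {u..} s \<partial>lborel)"
proof -
  have "forcing w u = (\<integral>\<^sup>+y. (\<lambda>s. w (s - u) * ladder s * indicator {u..} s) (u + y) \<partial>lborel)"
    unfolding forcing_def by (intro nn_integral_cong) (auto simp: indicator_def)
  also have "\<dots> = (\<integral>\<^sup>+s. w (s - u) * ladder s * indicator {u..} s \<partial>lborel)"
    by (rule nn_integral_shift) measurable
  also have "\<dots> = (\<integral>\<^sup>+s. ennreal (exp (- R * u)) * (w (s - u) * ennreal (exp (- R * (s - u))) * tilted s * indicator {u..} s) \<partial>lborel)"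
  proof (rule nn_integral_cong)
    fix s
    have "ennreal (exp (- R * u)) * ennreal (exp (- R * (s - u))) * ennreal (exp (R * s)) = 1"
      by (simp add: ennreal_mult[symmetric] exp_add[symmetric] algebra_simps)
    then have "w (s - u) * ladder s * indicator {u..} s
       = (ennreal (exp (- R * u)) * ennreal (exp (- R * (s - u))) * ennreal (exp (R * s))) * (w (s - u) * ladder s * indicator {u..} s)"
      by simp
    then show "w (s - u) * ladder s * indicator {u..} s
       = ennreal (exp (- R * u)) * (w (s - u) * ennreal (exp (- R * (s - u))) * tilted s * indicator {u..} s)"
      by (simp only: tilted_def ac_simps)
  qed
  also have "\<dots> = ennreal (exp (- R * u)) * (\<integral>\<^sup>+s. w (s - u) * ennreal (exp (- R * (s - u))) * tilted s * indicator {u..} s \<partial>lborel)"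
    by (rule nn_integral_cmult) measurable
  finally show ?thesis .
qed

lemma power_weight_exp_bound:
  assumes "0 < y"
  shows "ennreal (y ^ j) \<le> ennreal (fact j / R ^ j) * ennreal (exp (R * y))"
proof -
  have "(R * y) ^ j \<le> fact j * exp (R * y)" using R_pos assms by (intro power_le_fact_exp) simp
  then have "y ^ j \<le> fact j / R ^ j * exp (R * y)" using R_pos by (simp add: field_simps power_mult_distrib)
  then show ?thesis using R_pos by (subst ennreal_mult[symmetric]) (auto intro!: ennreal_leI)
qed

lemma power_ruin_value_bound:
  assumes "0 \<le> u"
  shows "ruin_value l c \<nu> (\<lambda>y. ennreal (y ^ j)) u \<le> ennreal (fact j / R ^ j) * ennreal (exp (- R * u))"
  by (rule ruin_value_exp_bound[OF power_weight_exp_bound]) (use assms in auto)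

lemma power_ruin_value_le:
  assumes "0 \<le> u"
  shows "ruin_value l c \<nu> (\<lambda>y. ennreal (y ^ j)) u \<le> ennreal (fact j / R ^ j)"
proof -
  have "fact j / R ^ j * exp (- R * u) \<le> fact j / R ^ j * 1"
    using R_pos assms by (intro mult_left_mono) auto
  then have "ennreal (fact j / R ^ j) * ennreal (exp (- R * u)) \<le> ennreal (fact j / R ^ j)"
    using R_pos by (subst ennreal_mult[symmetric]) (auto intro!: ennreal_leI)
  then show ?thesis using power_ruin_value_bound[OF assms] by (rule order_trans[rotated])
qed

lemma power_renewal_equation:
  assumes "0 \<le> u"
  shows "ruin_value l c \<nu> (\<lambda>y. ennreal (y ^ j)) u
    = renewal_op ladder (ruin_value l c \<nu> (\<lambda>y. ennreal (y ^ j))) u + forcing (\<lambda>y. ennreal (y ^ j)) u"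
proof (rule renewal_equation[where C = "fact j / R ^ j"])
  show "ruin_value l c \<nu> (\<lambda>y. ennreal (y ^ j)) v = first_step l c \<nu> (\<lambda>y. ennreal (y ^ j)) (ruin_value l c \<nu> (\<lambda>y. ennreal (y ^ j))) v" for v
    by (rule ruin_value_fixed_point[symmetric]) measurable
qed (use assms R_pos power_ruin_value_bound in auto)

theorem ruin_value_upper:
  assumes p: "0 < p" and u0: "0 < u0" and u: "0 \<le> u"
    and mass: "ennreal p \<le> (\<integral>\<^sup>+s. tilted s * indicator {u0..} s \<partial>lborel)"
  shows "ruin_value l c \<nu> (\<lambda>y. ennreal (y ^ j)) u \<le> ennreal (exp (- R * u)) * lyapunov p u0 j u"
proof -
  obtain q where q: "0 \<le> q" "q < 1" "(\<integral>\<^sup>+s. ladder s * indicator {0..} s \<partial>lborel) \<le> ennreal q"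
    using ladder_mass by blast
  show ?thesis
  proof (rule renewal_comparison[where a=ladder and b="forcing (\<lambda>y. ennreal (y ^ j))" and q=q and C="fact j / R ^ j"])
    fix x :: real assume x: "0 \<le> x"
    have "forcing (\<lambda>y. ennreal (y ^ j)) x \<le> ennreal (exp (- R * x)) * excess j x"
    proof (subst forcing_exp, measurable, rule mult_left_mono)
      show "(\<integral>\<^sup>+s. ennreal ((s - x) ^ j) * ennreal (exp (- R * (s - x))) * tilted s * indicator {x..} s \<partial>lborel) \<le> excess j x"
        unfolding excess_def
      proof (rule nn_integral_mono)
        fix s
        have "ennreal ((s - x) ^ j) * ennreal (exp (- R * (s - x))) \<le> ennreal ((s - x) ^ j) * 1" if "x \<le> s"
          using that R_pos by (intro mult_left_mono) (auto simp flip: ennreal_1 intro!: ennreal_leI)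
        then show "ennreal ((s - x) ^ j) * ennreal (exp (- R * (s - x))) * tilted s * indicator {x..} s
          \<le> ennreal ((s - x) ^ j) * tilted s * indicator {x..} s"
          by (auto simp: indicator_def intro!: mult_right_mono)
      qed
    qed simp
    then have "renewal_op ladder (\<lambda>x. ennreal (exp (- R * x)) * lyapunov p u0 j x) x + forcing (\<lambda>y. ennreal (y ^ j)) x
      \<le> ennreal (exp (- R * x)) * (renewal_op tilted (lyapunov p u0 j) x + excess j x)"
      by (subst renewal_op_exp) (auto simp: distrib_left intro!: add_left_mono)
    also have "\<dots> \<le> ennreal (exp (- R * x)) * lyapunov p u0 j x"
      by (intro mult_left_mono lyapunov_drift p u0 x mass) simp
    finally show "renewal_op ladder (\<lambda>x. ennreal (exp (- R * x)) * lyapunov p u0 j x) x + forcing (\<lambda>y. ennreal (y ^ j)) x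
      \<le> ennreal (exp (- R * x)) * lyapunov p u0 j x" .
  qed (use q u power_ruin_value_le in \<open>auto simp flip: power_renewal_equation\<close>)
qed

text \<open>
  For the overshoot \<open>O\<close> of the tilted renewal process, \<open>exp (R u)\<close> times the ruin probability is
  \<open>E exp (- R O) \<ge> exp (- R M)\<close> by Jensen's inequality, as \<open>M\<close> bounds the mean of \<open>O\<close>. The proof works
  with the renewal equation only: \<open>1 + R * M \<le> exp (R * (M - y)) + R * y\<close>, so that
  \<open>exp (R * M)\<close> times the ruin probability plus \<open>R * exp (- R u)\<close> times the Lyapunov function of order 1
  is a supersolution for the forcing term of which \<open>(1 + R * M) * exp (- R u)\<close> is a subsolution.
\<close>
theorem ruin_value_lower:
  assumes p: "0 < p" and u0: "0 < u0" and u: "0 \<le> u"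
    and mass: "ennreal p \<le> (\<integral>\<^sup>+s. tilted s * indicator {u0..} s \<partial>lborel)"
    and M: "\<And>u. 0 \<le> u \<Longrightarrow> lyapunov p u0 1 u \<le> ennreal M" "0 \<le> M"
  shows "ennreal (exp (- R * u)) \<le> ennreal (exp (R * M)) * ruin_value l c \<nu> (\<lambda>y. ennreal (y ^ 0)) u"
proof -
  let ?psi = "ruin_value l c \<nu> (\<lambda>y. ennreal (y ^ 0))"
  let ?T = "\<lambda>u. \<integral>\<^sup>+s. tilted s * indicator {u..} s \<partial>lborel"
  obtain q where q: "0 \<le> q" "q < 1" "(\<integral>\<^sup>+s. ladder s * indicator {0..} s \<partial>lborel) \<le> ennreal q"
    using ladder_mass by blast
  have RM: "0 \<le> 1 + R * M" using R_pos M by (simp add: add_nonneg_nonneg)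
  have "ennreal (exp (- R * u)) * ennreal (1 + R * M)
     \<le> ennreal (exp (R * M)) * ?psi u + ennreal (exp (- R * u)) * (ennreal R * lyapunov p u0 1 u)"
  proof (rule renewal_comparison[where a=ladder and q=q and C="1 + R * M"
      and b="\<lambda>u. ennreal (exp (- R * u)) * (ennreal (1 + R * M) * ?T u)"
      and g="\<lambda>u. ennreal (exp (R * M)) * ?psi u + ennreal (exp (- R * u)) * (ennreal R * lyapunov p u0 1 u)"
      and f="\<lambda>u. ennreal (exp (- R * u)) * ennreal (1 + R * M)"])
    fix x :: real assume x: "0 \<le> x"
    have "1 \<le> (\<integral>\<^sup>+s. tilted s * indicator {0..x} s \<partial>lborel) + ?T x"
      unfolding tilted_mass[symmetric]
      by (subst nn_integral_add[symmetric]) (use x in \<open>auto simp: indicator_def intro!: nn_integral_mono\<close>)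
    then have "ennreal (1 + R * M) * 1 \<le> ennreal (1 + R * M) * ((\<integral>\<^sup>+s. tilted s * indicator {0..x} s \<partial>lborel) + ?T x)"
      by (rule mult_left_mono) simp
    also have "\<dots> = renewal_op tilted (\<lambda>_. ennreal (1 + R * M)) x + ennreal (1 + R * M) * ?T x"
      unfolding renewal_op_def by (simp add: distrib_left nn_integral_cmult mult.assoc)
    finally show "ennreal (exp (- R * x)) * ennreal (1 + R * M)
      \<le> renewal_op ladder (\<lambda>u. ennreal (exp (- R * u)) * ennreal (1 + R * M)) x + ennreal (exp (- R * x)) * (ennreal (1 + R * M) * ?T x)"
      by (subst renewal_op_exp) (auto simp: distrib_left[symmetric] intro!: mult_left_mono)
    have "exp (- R * x) * (1 + R * M) \<le> 1 * (1 + R * M)"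
      using R_pos x RM by (intro mult_right_mono) auto
    then show "ennreal (exp (- R * x)) * ennreal (1 + R * M) \<le> ennreal (1 + R * M)"
      using RM by (subst ennreal_mult[symmetric]) (auto intro!: ennreal_leI)
    have split: "renewal_op ladder (\<lambda>u. ennreal (exp (R * M)) * ?psi u + ennreal (exp (- R * u)) * (ennreal R * lyapunov p u0 1 u)) x
       = ennreal (exp (R * M)) * renewal_op ladder ?psi x + ennreal (exp (- R * x)) * (ennreal R * renewal_op tilted (lyapunov p u0 1) x)"
    proof -
      have "renewal_op ladder (\<lambda>u. ennreal (exp (R * M)) * ?psi u + ennreal (exp (- R * u)) * (ennreal R * lyapunov p u0 1 u)) x
        = renewal_op ladder (\<lambda>u. ennreal (exp (R * M)) * ?psi u) x + renewal_op ladder (\<lambda>u. ennreal (exp (- R * u)) * (ennreal R * lyapunov p u0 1 u)) x"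
        unfolding renewal_op_def distrib_right by (rule nn_integral_add) measurable
      also have "renewal_op ladder (\<lambda>u. ennreal (exp (R * M)) * ?psi u) x = ennreal (exp (R * M)) * renewal_op ladder ?psi x"
        unfolding renewal_op_def mult.assoc by (rule nn_integral_cmult) measurable
      also have "renewal_op ladder (\<lambda>u. ennreal (exp (- R * u)) * (ennreal R * lyapunov p u0 1 u)) x
         = ennreal (exp (- R * x)) * renewal_op tilted (\<lambda>u. ennreal R * lyapunov p u0 1 u) x"
        by (rule renewal_op_exp) measurable
      also have "renewal_op tilted (\<lambda>u. ennreal R * lyapunov p u0 1 u) x = ennreal R * renewal_op tilted (lyapunov p u0 1) x"
        unfolding renewal_op_def mult.assoc by (rule nn_integral_cmult) measurable
      finally show ?thesis .
    qed
    have force: "ennreal (exp (- R * x)) * (ennreal (1 + R * M) * ?T x)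
      \<le> ennreal (exp (R * M)) * forcing (\<lambda>y. ennreal (y ^ 0)) x + ennreal (exp (- R * x)) * (ennreal R * excess 1 x)"
    proof -
      have "ennreal (1 + R * M) * ?T x = (\<integral>\<^sup>+s. ennreal (1 + R * M) * (tilted s * indicator {x..} s) \<partial>lborel)"
        by (rule nn_integral_cmult[symmetric]) measurable
      also have "\<dots> \<le> (\<integral>\<^sup>+s. ennreal (exp (R * M)) * (ennreal ((s - x) ^ 0) * ennreal (exp (- R * (s - x))) * tilted s * indicator {x..} s)
           + ennreal R * (ennreal ((s - x) ^ 1) * tilted s * indicator {x..} s) \<partial>lborel)"
      proof (rule nn_integral_mono)
        fix s
        show "ennreal (1 + R * M) * (tilted s * indicator {x..} s)
          \<le> ennreal (exp (R * M)) * (ennreal ((s - x) ^ 0) * ennreal (exp (- R * (s - x))) * tilted s * indicator {x..} s)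
           + ennreal R * (ennreal ((s - x) ^ 1) * tilted s * indicator {x..} s)"
        proof (cases "x \<le> s")
          case True
          have "1 + R * M \<le> exp (R * M) * exp (- R * (s - x)) + R * (s - x)"
            using exp_ge_add_one_self[of "R * M + - R * (s - x)"] unfolding exp_add by simp
          then have "ennreal (1 + R * M) \<le> ennreal (exp (R * M)) * ennreal (exp (- R * (s - x))) + ennreal R * ennreal (s - x)"
            using True R_pos by (simp add: ennreal_mult[symmetric] ennreal_plus[symmetric] ennreal_leI del: ennreal_plus)
          then have "ennreal (1 + R * M) * tilted s \<le> (ennreal (exp (R * M)) * ennreal (exp (- R * (s - x))) + ennreal R * ennreal (s - x)) * tilted s"
            by (rule mult_right_mono) simp
          then show ?thesis using True by (simp add: distrib_right mult.assoc)
        qed simp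
      qed
      also have "\<dots> = ennreal (exp (R * M)) * (\<integral>\<^sup>+s. ennreal ((s - x) ^ 0) * ennreal (exp (- R * (s - x))) * tilted s * indicator {x..} s \<partial>lborel)
           + ennreal R * excess 1 x"
        unfolding excess_def by (subst nn_integral_add, measurable, measurable, subst (1 2) nn_integral_cmult) auto
      finally have "ennreal (exp (- R * x)) * (ennreal (1 + R * M) * ?T x) \<le> ennreal (exp (- R * x)) * (ennreal (exp (R * M)) * (\<integral>\<^sup>+s. ennreal ((s - x) ^ 0) * ennreal (exp (- R * (s - x))) * tilted s * indicator {x..} s \<partial>lborel)
           + ennreal R * excess 1 x)" by (rule mult_left_mono) simp
      then show ?thesis
        by (subst forcing_exp, measurable) (simp only: distrib_left ac_simps)
    qed
    have "renewal_op ladder (\<lambda>u. ennreal (exp (R * M)) * ?psi u + ennreal (exp (- R * u)) * (ennreal R * lyapunov p u0 1 u)) x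
       + ennreal (exp (- R * x)) * (ennreal (1 + R * M) * ?T x)
      \<le> (ennreal (exp (R * M)) * renewal_op ladder ?psi x + ennreal (exp (- R * x)) * (ennreal R * renewal_op tilted (lyapunov p u0 1) x))
        + (ennreal (exp (R * M)) * forcing (\<lambda>y. ennreal (y ^ 0)) x + ennreal (exp (- R * x)) * (ennreal R * excess 1 x))"
      unfolding split by (rule add_left_mono[OF force])
    also have "\<dots> = ennreal (exp (R * M)) * (renewal_op ladder ?psi x + forcing (\<lambda>y. ennreal (y ^ 0)) x)
        + ennreal (exp (- R * x)) * (ennreal R * (renewal_op tilted (lyapunov p u0 1) x + excess 1 x))"
      by (simp only: distrib_left ac_simps)
    also have "\<dots> \<le> ennreal (exp (R * M)) * ?psi x + ennreal (exp (- R * x)) * (ennreal R * lyapunov p u0 1 x)"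
      unfolding power_renewal_equation[OF x, symmetric]
      by (intro add_left_mono mult_left_mono lyapunov_drift p u0 x mass) auto
    finally show "renewal_op ladder (\<lambda>u. ennreal (exp (R * M)) * ?psi u + ennreal (exp (- R * u)) * (ennreal R * lyapunov p u0 1 u)) x
       + ennreal (exp (- R * x)) * (ennreal (1 + R * M) * ?T x)
      \<le> ennreal (exp (R * M)) * ?psi x + ennreal (exp (- R * x)) * (ennreal R * lyapunov p u0 1 x)" .
  qed (use q u in auto)
  also have "\<dots> \<le> ennreal (exp (R * M)) * ?psi u + ennreal (exp (- R * u)) * (ennreal R * ennreal M)"
    by (intro add_left_mono mult_left_mono M u) auto
  finally have "ennreal (exp (- R * u)) * (1 + ennreal R * ennreal M)
    \<le> ennreal (exp (R * M)) * ?psi u + ennreal (exp (- R * u)) * (ennreal R * ennreal M)"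
    using R_pos M one_plus_ennreal[of "R * M"] by (simp add: ennreal_mult[symmetric] del: ennreal_plus)
  then have "ennreal (exp (- R * u)) * (ennreal R * ennreal M) + ennreal (exp (- R * u))
    \<le> ennreal (exp (- R * u)) * (ennreal R * ennreal M) + ennreal (exp (R * M)) * ?psi u"
    by (simp add: distrib_left ac_simps)
  then show ?thesis
    by (subst (asm) ennreal_add_left_cancel_le) (auto simp: ennreal_mult[symmetric] ennreal_mult_eq_top_iff)
qed

lemma tilted_moment_le:
  assumes "i \<le> k"
  shows "tilted_moment i \<le> 1 + tilted_moment k"
proof -
  have "tilted_moment i \<le> (\<integral>\<^sup>+s. tilted s * indicator {0..} s + ennreal (s ^ k) * tilted s * indicator {0..} s \<partial>lborel)"
    unfolding tilted_moment_def
  proof (rule nn_integral_mono)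
    fix s :: real
    show "ennreal (s ^ i) * tilted s * indicator {0..} s \<le> tilted s * indicator {0..} s + ennreal (s ^ k) * tilted s * indicator {0..} s"
    proof (cases "0 \<le> s")
      case True
      have "s ^ i \<le> 1 + s ^ k"
      proof (cases "s \<le> 1")
        case True then show ?thesis using \<open>0 \<le> s\<close> power_le_one[of s i] zero_le_power[of s k] by linarith
      next
        case False then show ?thesis using power_increasing[OF assms, of s] by linarith
      qed
      then have "ennreal (s ^ i) \<le> 1 + ennreal (s ^ k)"
        using True by (subst one_plus_ennreal) (auto intro: ennreal_leI simp del: ennreal_plus)
      then have "ennreal (s ^ i) * tilted s \<le> (1 + ennreal (s ^ k)) * tilted s" by (rule mult_right_mono) simp
      then show ?thesis using True by (simp add: distrib_right)
    qed simp
  qed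
  also have "\<dots> = 1 + tilted_moment k"
    unfolding tilted_moment_def by (subst nn_integral_add) (auto simp: tilted_mass)
  finally show ?thesis .
qed

text \<open>
  The factors \<open>exp (- R u)\<close> of the upper and the lower bound cancel. Neither \<open>R\<close> nor its reciprocal is
  left in the constant: \<open>exp (R * u0) * p \<le> 1\<close>, since the tilted density has mass 1, and this controls
  \<open>exp (R * M)\<close>.
\<close>
theorem ruin_value_ratio:
  assumes p: "0 < p" and u0: "0 < u0" and u: "0 \<le> u"
    and far: "ennreal p \<le> (\<integral>\<^sup>+s. ladder s * indicator {u0..} s \<partial>lborel)"
    and E: "tilted_moment k \<le> ennreal E" "0 \<le> E" and j: "j < k" and k: "2 \<le> k"
    and M_def: "M = (1 + E) * (1 / p + 1 / (u0 * p))"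
  shows "ruin_value l c \<nu> (\<lambda>y. ennreal (y ^ j)) u
      \<le> ennreal (M * (1 / p) powr (M / u0)) * ruin_value l c \<nu> (\<lambda>y. ennreal (y ^ 0)) u"
    and "0 < ruin_value l c \<nu> (\<lambda>y. ennreal (y ^ 0)) u"
    and "ruin_value l c \<nu> (\<lambda>y. ennreal (y ^ 0)) u < \<infinity>"
proof -
  have mass: "ennreal p \<le> (\<integral>\<^sup>+s. tilted s * indicator {u0..} s \<partial>lborel)"
    using u0 unfolding tilted_def
    by (intro order_trans[OF far] nn_integral_mono) (auto simp: indicator_def intro!: ladder_le_tilted)
  have M0: "0 \<le> M" using p u0 E by (simp add: M_def)
  have ly: "lyapunov p u0 i v \<le> ennreal M" if "i < k" for i v
  proof -
    have mom: "tilted_moment i' \<le> ennreal (1 + E)" if "i' \<le> k" for i'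
    proof -
      have "tilted_moment i' \<le> 1 + ennreal E" using tilted_moment_le[OF that] E(1) by (meson add_left_mono order_trans)
      then show ?thesis using one_plus_ennreal[OF E(2)] by simp
    qed
    have "lyapunov p u0 i v \<le> ennreal (1 / p) * ennreal (1 + E) + ennreal (1 / (u0 * p)) * ennreal (1 + E)"
      using that by (intro order_trans[OF lyapunov_le] add_mono mult_left_mono mom) auto
    also have "\<dots> = ennreal M"
      using p u0 E unfolding M_def by (simp add: ennreal_mult[symmetric] ennreal_plus[symmetric] algebra_simps del: ennreal_plus)
    finally show ?thesis .
  qed
  have eR: "exp (R * u0) \<le> 1 / p"
  proof -
    have "ennreal (exp (R * u0)) * ennreal p \<le> ennreal (exp (R * u0)) * (\<integral>\<^sup>+s. ladder s * indicator {u0..} s \<partial>lborel)"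
      by (rule mult_left_mono[OF far]) simp
    also have "\<dots> = (\<integral>\<^sup>+s. ennreal (exp (R * u0)) * (ladder s * indicator {u0..} s) \<partial>lborel)"
      by (rule nn_integral_cmult[symmetric]) measurable
    also have "\<dots> \<le> (\<integral>\<^sup>+s. tilted s * indicator {0..} s \<partial>lborel)"
      using R_pos u0 by (intro nn_integral_mono) (auto simp: indicator_def tilted_def intro!: mult_right_mono ennreal_leI)
    finally have "ennreal (exp (R * u0) * p) \<le> ennreal 1"
      using p by (simp add: tilted_mass ennreal_mult)
    then have "exp (R * u0) * p \<le> 1" by (subst (asm) ennreal_le_iff) auto
    then show ?thesis using p by (simp add: field_simps)
  qed
  have eRM: "exp (R * M) \<le> (1 / p) powr (M / u0)"
  proof -
    have "exp (R * M) = exp (R * u0) powr (M / u0)" using u0 by (simp add: powr_def field_simps)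
    also have "\<dots> \<le> (1 / p) powr (M / u0)" using M0 u0 eR by (intro powr_mono2) auto
    finally show ?thesis .
  qed
  let ?psi = "ruin_value l c \<nu> (\<lambda>y. ennreal (y ^ 0))"
  have low: "ennreal (exp (- R * u)) \<le> ennreal (exp (R * M)) * ?psi u"
    by (rule ruin_value_lower[OF p u0 u mass _ M0]) (use ly[of 1] k in auto)
  have "ruin_value l c \<nu> (\<lambda>y. ennreal (y ^ j)) u \<le> ennreal (exp (- R * u)) * lyapunov p u0 j u"
    by (rule ruin_value_upper[OF p u0 u mass])
  also have "\<dots> \<le> ennreal (exp (R * M)) * ?psi u * ennreal M"
    by (intro mult_mono low ly j) auto
  also have "\<dots> = ennreal (M * exp (R * M)) * ?psi u" using M0 by (simp add: ennreal_mult ac_simps)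
  also have "\<dots> \<le> ennreal (M * (1 / p) powr (M / u0)) * ?psi u"
    using M0 eRM by (intro mult_right_mono ennreal_leI mult_left_mono) auto
  finally show "ruin_value l c \<nu> (\<lambda>y. ennreal (y ^ j)) u \<le> ennreal (M * (1 / p) powr (M / u0)) * ?psi u" .
  show "0 < ?psi u"
  proof (rule ccontr)
    assume "\<not> 0 < ?psi u"
    then have "?psi u = 0" by (simp only: not_gr_zero)
    then show False using low by (simp add: ennreal_eq_0_iff)
  qed
  show "?psi u < \<infinity>"
    using power_ruin_value_le[OF u, of 0] by (simp add: le_less_trans)
qed

end

section \<open>Deficits are not small\<close>

context claim_law
begin

lemma mean_excess_tail:
  "(\<integral>\<^sup>+z. ennreal (z - v) * indicator {v<..} z \<partial>\<nu>) = (\<integral>\<^sup>+x. tail x * indicator {v..} x \<partial>lborel)"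
proof -
  have "(\<integral>\<^sup>+z. ennreal (z - v) * indicator {v<..} z \<partial>\<nu>) = (\<integral>\<^sup>+z. (\<integral>\<^sup>+x. 1 * indicator {v..<z} x \<partial>lborel) \<partial>\<nu>)"
  proof (rule nn_integral_cong)
    fix z
    show "ennreal (z - v) * indicator {v<..} z = (\<integral>\<^sup>+x. 1 * indicator {v..<z} x \<partial>lborel)"
      by (cases "v < z") simp_all
  qed
  also have "\<dots> = (\<integral>\<^sup>+x. 1 * tail x * indicator {v..} x \<partial>lborel)"
    by (rule nn_integral_tail) simp
  finally show ?thesis by simp
qed

lemma overshoot_rate_0: "overshoot_rate (\<lambda>y. ennreal (y ^ 0)) v = tail v"
  unfolding overshoot_rate_def tail_def by (simp add: sets_law)

text \<open>
  The tangent to \<open>y ^ j\<close> at \<open>a\<close>, a lower bound by Bernoulli's inequality, is integrated over the claims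
  \<open>z > v\<close> at \<open>y = z - v\<close>; by hypothesis the mean of \<open>z - v\<close> over these claims is at least \<open>a\<close>.
\<close>
lemma overshoot_rate_lower:
  assumes a: "0 < a" and h: "\<And>v. 0 \<le> v \<Longrightarrow> ennreal a * tail v \<le> (\<integral>\<^sup>+x. tail x * indicator {v..} x \<partial>lborel)"
    and v: "0 \<le> v"
  shows "ennreal (a ^ j) * tail v \<le> overshoot_rate (\<lambda>y. ennreal (y ^ j)) v"
proof (cases j)
  case 0
  then show ?thesis using overshoot_rate_0 by simp
next
  case (Suc i)
  have [measurable]: "(\<lambda>z. ennreal ((z - v) ^ j) * indicator {v<..} z) \<in> borel_measurable \<nu>"
    "(\<lambda>z. ennreal (z - v) * indicator {v<..} z) \<in> borel_measurable \<nu>" "(indicator {v<..} :: real \<Rightarrow> ennreal) \<in> borel_measurable \<nu>"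
    by measurable
  have pt: "ennreal (a ^ j) * indicator {v<..} z + ennreal (real j * a ^ i) * (ennreal (z - v) * indicator {v<..} z)
      \<le> ennreal ((z - v) ^ j) * indicator {v<..} z + ennreal (real j * a ^ j) * indicator {v<..} z" for z
  proof (cases "v < z")
    case True
    have "1 + real j * ((z - v) / a - 1) \<le> (1 + ((z - v) / a - 1)) ^ j"
      using True a by (intro Bernoulli_inequality) simp
    then have "a ^ j * (1 + real j * ((z - v) / a - 1)) \<le> a ^ j * ((z - v) / a) ^ j"
      using a by (intro mult_left_mono) auto
    also have "a ^ j * ((z - v) / a) ^ j = (z - v) ^ j" using a by (simp add: power_divide)
    also have "a ^ j * (1 + real j * ((z - v) / a - 1)) = a ^ j + real j * a ^ i * (z - v) - real j * a ^ j"
      using a by (simp add: Suc field_simps)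
    finally have "a ^ j + real j * a ^ i * (z - v) \<le> (z - v) ^ j + real j * a ^ j" by simp
    then have "ennreal (a ^ j) + ennreal (real j * a ^ i) * ennreal (z - v) \<le> ennreal ((z - v) ^ j) + ennreal (real j * a ^ j)"
      using True a by (simp add: ennreal_mult[symmetric] ennreal_plus[symmetric] ennreal_leI del: ennreal_plus)
    then show ?thesis using True by simp
  qed simp
  have "ennreal (a ^ j) * tail v + ennreal (real j * a ^ i) * (\<integral>\<^sup>+z. ennreal (z - v) * indicator {v<..} z \<partial>\<nu>)
     = (\<integral>\<^sup>+z. ennreal (a ^ j) * indicator {v<..} z + ennreal (real j * a ^ i) * (ennreal (z - v) * indicator {v<..} z) \<partial>\<nu>)"
    by (subst nn_integral_add, measurable, subst (1 2) nn_integral_cmult) (auto simp: tail_def sets_law)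
  also have "\<dots> \<le> (\<integral>\<^sup>+z. ennreal ((z - v) ^ j) * indicator {v<..} z + ennreal (real j * a ^ j) * indicator {v<..} z \<partial>\<nu>)"
    by (intro nn_integral_mono pt)
  also have "\<dots> = overshoot_rate (\<lambda>y. ennreal (y ^ j)) v + ennreal (real j * a ^ j) * tail v"
    unfolding overshoot_rate_def by (subst nn_integral_add, measurable, simp add: nn_integral_cmult_indicator tail_def sets_law)
  finally have 1: "ennreal (a ^ j) * tail v + ennreal (real j * a ^ i) * (\<integral>\<^sup>+z. ennreal (z - v) * indicator {v<..} z \<partial>\<nu>)
     \<le> overshoot_rate (\<lambda>y. ennreal (y ^ j)) v + ennreal (real j * a ^ j) * tail v" .
  have "ennreal (real j * a ^ j) * tail v = ennreal (real j * a ^ i) * (ennreal a * tail v)"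
  proof -
    have "ennreal (real j * a ^ j) = ennreal (real j * a ^ i) * ennreal a"
      using a by (subst ennreal_mult[symmetric]) (auto simp: Suc)
    then show ?thesis by (simp only: mult.assoc)
  qed
  also have "\<dots> \<le> ennreal (real j * a ^ i) * (\<integral>\<^sup>+z. ennreal (z - v) * indicator {v<..} z \<partial>\<nu>)"
    unfolding mean_excess_tail by (intro mult_left_mono h v) simp
  finally have "ennreal (a ^ j) * tail v + ennreal (real j * a ^ j) * tail v
     \<le> overshoot_rate (\<lambda>y. ennreal (y ^ j)) v + ennreal (real j * a ^ j) * tail v"
    by (rule order_trans[OF add_left_mono 1])
  then have "ennreal (real j * a ^ j) * tail v + ennreal (a ^ j) * tail v
     \<le> ennreal (real j * a ^ j) * tail v + overshoot_rate (\<lambda>y. ennreal (y ^ j)) v"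
    by (simp only: add.commute)
  moreover have "ennreal (real j * a ^ j) * tail v < top"
    using tail_le_1[of v] by (auto simp: ennreal_mult_less_top intro: le_less_trans)
  ultimately show ?thesis by (subst (asm) ennreal_add_left_cancel_le) auto
qed

text \<open>
  The bound \<open>overshoot_rate_lower\<close> holds at every claim, whatever the reserve before it, so it survives
  the iteration of the first-step operator.
\<close>
lemma ruin_value_moment_lower:
  assumes a: "0 < a" and h: "\<And>v. 0 \<le> v \<Longrightarrow> ennreal a * tail v \<le> (\<integral>\<^sup>+x. tail x * indicator {v..} x \<partial>lborel)"
    and u: "0 \<le> u"
  shows "ennreal (a ^ j) * ruin_value l c \<nu> (\<lambda>y. ennreal (y ^ 0)) u \<le> ruin_value l c \<nu> (\<lambda>y. ennreal (y ^ j)) u"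
proof -
  have "ennreal (a ^ j) * ruin_iter l c \<nu> (\<lambda>y. ennreal (y ^ 0)) n u \<le> ruin_iter l c \<nu> (\<lambda>y. ennreal (y ^ j)) n u" if "0 \<le> u" for n u
    using that
  proof (induction n arbitrary: u)
    case 0 then show ?case by (simp add: ruin_iter_0)
  next
    case (Suc n)
    let ?Q = "\<lambda>j. ruin_iter l c \<nu> (\<lambda>y. ennreal (y ^ j)) n"
    have ac: "ennreal (a ^ j) * after_claim \<nu> (\<lambda>y. ennreal (y ^ 0)) (?Q 0) v \<le> after_claim \<nu> (\<lambda>y. ennreal (y ^ j)) (?Q j) v" if v: "0 \<le> v" for v
    proof -
      have "ennreal (a ^ j) * after_claim \<nu> (\<lambda>y. ennreal (y ^ 0)) (?Q 0) v
        = (\<integral>\<^sup>+z. ennreal (a ^ j) * (?Q 0 (v - z) * indicator {..v} z) \<partial>\<nu>) + ennreal (a ^ j) * tail v"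
        by (subst after_claim_split, measurable, unfold overshoot_rate_0, subst nn_integral_cmult, measurable, simp only: distrib_left)
      also have "\<dots> \<le> (\<integral>\<^sup>+z. ?Q j (v - z) * indicator {..v} z \<partial>\<nu>) + overshoot_rate (\<lambda>y. ennreal (y ^ j)) v"
        using Suc.IH by (intro add_mono nn_integral_mono overshoot_rate_lower a h v) (auto simp: indicator_def)
      also have "\<dots> = after_claim \<nu> (\<lambda>y. ennreal (y ^ j)) (?Q j) v"
        by (subst after_claim_split) auto
      finally show ?thesis .
    qed
    have "ennreal (a ^ j) * first_step l c \<nu> (\<lambda>y. ennreal (y ^ 0)) (?Q 0) u
       = (\<integral>\<^sup>+s. ennreal (a ^ j) * after_claim \<nu> (\<lambda>y. ennreal (y ^ 0)) (?Q 0) (u + c * s) \<partial>density lborel (exponential_density l))"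
      unfolding first_step_def by (rule nn_integral_cmult[symmetric]) measurable
    also have "\<dots> \<le> first_step l c \<nu> (\<lambda>y. ennreal (y ^ j)) (?Q j) u"
      unfolding first_step_def
      using Suc.prems c_pos
      by (intro nn_integral_mono_AE eventually_mono[OF AE_expo_pos] ac add_nonneg_nonneg mult_nonneg_nonneg) auto
    finally show ?case by (simp only: ruin_iter_Suc)
  qed
  then show ?thesis
    unfolding ruin_value_def SUP_mult_left_ennreal using u by (intro SUP_mono) blast
qed

end

section \<open>Ruin as passage of the embedded random walk\<close>

text \<open>
  The penalty along one path with waiting times \<open>s\<close> and claims \<open>z\<close>, counted if ruin occurs at one of
  the first \<open>n\<close> claims. The recursion consumes the first waiting time and the first claim, as the
  first-step operator does; \<open>level\<close> is the reserve right after claim number \<open>m + 1\<close>.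
\<close>
primrec ruin_path :: "real \<Rightarrow> (real \<Rightarrow> ennreal) \<Rightarrow> nat \<Rightarrow> real \<Rightarrow> (nat \<Rightarrow> real) \<Rightarrow> (nat \<Rightarrow> real) \<Rightarrow> ennreal" where
  "ruin_path c w 0 u s z = 0"
| "ruin_path c w (Suc n) u s z = (if u + c * s 0 < z 0 then w (z 0 - (u + c * s 0))
     else ruin_path c w n (u + c * s 0 - z 0) (\<lambda>i. s (Suc i)) (\<lambda>i. z (Suc i)))"

definition level :: "real \<Rightarrow> real \<Rightarrow> (nat \<Rightarrow> real) \<Rightarrow> (nat \<Rightarrow> real) \<Rightarrow> nat \<Rightarrow> real" where
  "level c u s z m = u + c * (\<Sum>i<Suc m. s i) - (\<Sum>i<Suc m. z i)"

lemma level_0: "level c u s z 0 = u + c * s 0 - z 0"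
  by (simp add: level_def)

lemma level_Suc: "level c u s z (Suc m) = level c (u + c * s 0 - z 0) (\<lambda>i. s (Suc i)) (\<lambda>i. z (Suc i)) m"
  unfolding level_def sum.lessThan_Suc_shift[where n="Suc m"] by (simp add: algebra_simps del: sum.lessThan_Suc)

lemma ruin_path_eq:
  "ruin_path c w n u s z = (if \<exists>m<n. level c u s z m < 0 then w (- level c u s z (LEAST m. level c u s z m < 0)) else 0)"
proof (induction n arbitrary: u s z)
  case 0 then show ?case by simp
next
  case (Suc n)
  show ?case
  proof (cases "level c u s z 0 < 0")
    case True
    then have "(LEAST m. level c u s z m < 0) = 0" by (intro Least_eq_0)
    then show ?thesis using True by (auto simp: level_0)
  next
    case False
    let ?L = "level c (u + c * s 0 - z 0) (\<lambda>i. s (Suc i)) (\<lambda>i. z (Suc i))"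
    have ex: "(\<exists>m<Suc n. level c u s z m < 0) \<longleftrightarrow> (\<exists>m<n. ?L m < 0)"
      using False by (simp only: Ex_less_Suc2 level_Suc) blast
    have "(LEAST m. level c u s z m < 0) = Suc (LEAST m. ?L m < 0)" if "\<exists>m<n. ?L m < 0"
    proof -
      from that obtain m where "level c u s z (Suc m) < 0" by (auto simp: level_Suc)
      from Least_Suc[of "\<lambda>m. level c u s z m < 0", OF this False] show ?thesis by (simp add: level_Suc)
    qed
    then show ?thesis using False Suc[of "u + c * s 0 - z 0"] ex by (auto simp: level_0 level_Suc)
  qed
qed

lemma SUP_ruin_path:
  "(SUP n. ruin_path c w n u s z) = (if \<exists>m. level c u s z m < 0 then w (- level c u s z (LEAST m. level c u s z m < 0)) else 0)"
proof (cases "\<exists>m. level c u s z m < 0")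
  case True
  then obtain m where m: "level c u s z m < 0" by blast
  show ?thesis
  proof (rule antisym)
    show "(SUP n. ruin_path c w n u s z) \<le> (if \<exists>m. level c u s z m < 0 then w (- level c u s z (LEAST m. level c u s z m < 0)) else 0)"
      by (rule SUP_least) (auto simp: ruin_path_eq)
    show "(if \<exists>m. level c u s z m < 0 then w (- level c u s z (LEAST m. level c u s z m < 0)) else 0) \<le> (SUP n. ruin_path c w n u s z)"
      using m by (intro SUP_upper2[of "Suc m"]) (auto simp: ruin_path_eq)
  qed
qed (simp add: ruin_path_eq)

lemma ruin_path_mono: "ruin_path c w n u s z \<le> ruin_path c w (Suc n) u s z"
  unfolding ruin_path_eq by (auto intro: less_SucI)

lemma measurable_branch:
  fixes A B :: "'x \<Rightarrow> real" and w :: "real \<Rightarrow> ennreal"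
  assumes [measurable]: "A \<in> borel_measurable M" "B \<in> borel_measurable M" "D \<in> borel_measurable M" "w \<in> borel_measurable borel"
  shows "(\<lambda>p. if A p < B p then w (B p - A p) else D p) \<in> borel_measurable M"
  by measurable

lemma ruin_path_measurable:
  assumes [measurable]: "w \<in> borel_measurable borel"
  shows "(\<lambda>(u, s, z). ruin_path c w n u s z) \<in> borel_measurable (borel \<Otimes>\<^sub>M (PiM UNIV (\<lambda>_. borel) \<Otimes>\<^sub>M PiM UNIV (\<lambda>_. borel)))"
proof (induction n)
  case 0 then show ?case by simp
next
  case (Suc n)
  note [measurable] = Suc
  let ?S = "borel \<Otimes>\<^sub>M (PiM UNIV (\<lambda>_. borel :: real measure) \<Otimes>\<^sub>M PiM UNIV (\<lambda>_. borel :: real measure)) :: (real \<times> (nat \<Rightarrow> real) \<times> (nat \<Rightarrow> real)) measure"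
  have [measurable]: "(\<lambda>p. (fst (snd p) :: nat \<Rightarrow> real) 0) \<in> borel_measurable ?S" "(\<lambda>p. (snd (snd p) :: nat \<Rightarrow> real) 0) \<in> borel_measurable ?S"
    by measurable
  have [measurable]: "(\<lambda>p. (\<lambda>i. (fst (snd p) :: nat \<Rightarrow> real) (Suc i))) \<in> measurable ?S (PiM UNIV (\<lambda>_. borel))"
    "(\<lambda>p. (\<lambda>i. (snd (snd p) :: nat \<Rightarrow> real) (Suc i))) \<in> measurable ?S (PiM UNIV (\<lambda>_. borel))"
    by (auto intro!: measurable_PiM_single')
  have "(\<lambda>p. (\<lambda>(u, s, z). ruin_path c w n u s z) (fst p + c * fst (snd p) 0 - snd (snd p) 0, (\<lambda>i. fst (snd p) (Suc i)), (\<lambda>i. snd (snd p) (Suc i)))) \<in> borel_measurable ?S"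
    by (rule measurable_compose[OF _ Suc]) measurable
  then have "(\<lambda>p. if fst p + c * fst (snd p) 0 < snd (snd p) 0 then w (snd (snd p) 0 - (fst p + c * fst (snd p) 0))
     else (\<lambda>(u, s, z). ruin_path c w n u s z) (fst p + c * fst (snd p) 0 - snd (snd p) 0, (\<lambda>i. fst (snd p) (Suc i)), (\<lambda>i. snd (snd p) (Suc i)))) \<in> borel_measurable ?S"
    by (intro measurable_branch assms) measurable
  then show ?case by (simp only: ruin_path.simps case_prod_unfold fst_conv snd_conv)
qed

text \<open>
  An i.i.d. sequence is its first term followed by an independent copy of the sequence.
\<close>
lemma nn_integral_sequence:
  assumes "prob_space M" and f: "f \<in> borel_measurable (PiM UNIV (\<lambda>_::nat. M))"
  shows "(\<integral>\<^sup>+\<omega>. f \<omega> \<partial>PiM UNIV (\<lambda>_. M)) = (\<integral>\<^sup>+x. (\<integral>\<^sup>+\<omega>. f (case_nat x \<omega>) \<partial>PiM UNIV (\<lambda>_. M)) \<partial>M)"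
proof -
  interpret prob_space M by fact
  interpret S: sequence_space M ..
  have SPs: "prob_space (PiM UNIV (\<lambda>_::nat. M))" by (rule prob_space_PiM) unfold_locales
  have m: "(\<lambda>(s, \<omega>). case_nat s \<omega>) \<in> measurable (M \<Otimes>\<^sub>M PiM UNIV (\<lambda>_. M)) (PiM UNIV (\<lambda>_::nat. M))"
    by measurable
  have "(\<integral>\<^sup>+\<omega>. f \<omega> \<partial>PiM UNIV (\<lambda>_. M)) = (\<integral>\<^sup>+\<omega>. f \<omega> \<partial>distr (M \<Otimes>\<^sub>M PiM UNIV (\<lambda>_. M)) (PiM UNIV (\<lambda>_. M)) (\<lambda>(s, \<omega>). case_nat s \<omega>))"
    using S.PiM_iter by simp
  also have "\<dots> = (\<integral>\<^sup>+p. f (case p of (s, \<omega>) \<Rightarrow> case_nat s \<omega>) \<partial>(M \<Otimes>\<^sub>M PiM UNIV (\<lambda>_. M)))"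
    using m f by (intro nn_integral_distr) simp_all
  also have "\<dots> = (\<integral>\<^sup>+x. (\<integral>\<^sup>+\<omega>. f (case_nat x \<omega>) \<partial>PiM UNIV (\<lambda>_. M)) \<partial>M)"
    using measurable_compose[OF m f] by (subst sigma_finite_measure.nn_integral_fst[OF prob_space_imp_sigma_finite[OF SPs], symmetric]) auto
  finally show ?thesis .
qed

text \<open>
  Split off the first waiting time and the first claim, and exchange the remaining waiting times with
  the first claim.
\<close>
lemma (in claim_law) nn_integral_ruin_path:
  assumes [measurable]: "w \<in> borel_measurable borel"
  shows "(\<integral>\<^sup>+s. (\<integral>\<^sup>+z. ruin_path c w n u s z \<partial>PiM UNIV (\<lambda>_. \<nu>)) \<partial>PiM UNIV (\<lambda>_. density lborel (exponential_density l)))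
    = ruin_iter l c \<nu> w n u"
proof (induction n arbitrary: u)
  case 0 then show ?case by (simp add: ruin_iter_0)
next
  case (Suc n)
  let ?e = "density lborel (exponential_density l)"
  let ?E = "PiM UNIV (\<lambda>_::nat. ?e)" and ?F = "PiM UNIV (\<lambda>_::nat. \<nu>)"
  interpret e: prob_space ?e by (rule prob_space_exponential_density[OF l_pos])
  interpret E: sequence_space ?e ..
  interpret F: sequence_space \<nu> ..
  have EPs: "prob_space ?E" by (rule prob_space_PiM) unfold_locales
  have FPs: "prob_space ?F" by (rule prob_space_PiM) unfold_locales
  interpret P: pair_sigma_finite \<nu> ?E ..
  have sE [measurable_cong]: "sets ?E = sets (PiM UNIV (\<lambda>_. borel))" by (rule sets_PiM_cong) auto
  have sF [measurable_cong]: "sets ?F = sets (PiM UNIV (\<lambda>_. borel))" by (rule sets_PiM_cong) (auto simp: sets_law)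
  have rp: "(\<lambda>p. ruin_path c w n (f p) (g p) (h p)) \<in> borel_measurable M"
    if "f \<in> borel_measurable M" "g \<in> measurable M (PiM UNIV (\<lambda>_. borel))" "h \<in> measurable M (PiM UNIV (\<lambda>_. borel))"
    for f g h n and M :: "'x measure"
  proof -
    have "(\<lambda>p. (f p, g p, h p)) \<in> measurable M (borel \<Otimes>\<^sub>M (PiM UNIV (\<lambda>_. borel) \<Otimes>\<^sub>M PiM UNIV (\<lambda>_. borel)))"
      using that by (intro measurable_Pair)
    from measurable_compose[OF this ruin_path_measurable[OF assms]] show ?thesis by simp
  qed
  have idE: "(\<lambda>s. s) \<in> measurable ?E (PiM UNIV (\<lambda>_. borel))" by (rule measurable_ident_sets[OF sE])
  have idF: "(\<lambda>s. s) \<in> measurable ?F (PiM UNIV (\<lambda>_. borel))" by (rule measurable_ident_sets[OF sF])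
  have inner: "(\<integral>\<^sup>+z. ruin_path c w (Suc n) u s z \<partial>?F)
      = (\<integral>\<^sup>+y. (\<integral>\<^sup>+z. (if u + c * s 0 < y then w (y - (u + c * s 0)) else ruin_path c w n (u + c * s 0 - y) (\<lambda>i. s (Suc i)) z) \<partial>?F) \<partial>\<nu>)" for s
  proof -
    have "(\<lambda>z. ruin_path c w (Suc n) u s z) \<in> borel_measurable ?F"
      by (intro rp idF measurable_const) (simp_all add: space_PiM)
    from nn_integral_sequence[OF prob_space_axioms this] show ?thesis by (simp cong: if_cong)
  qed
  define G where "G a s y = (\<integral>\<^sup>+z. (if u + c * a < y then w (y - (u + c * a)) else ruin_path c w n (u + c * a - y) s z) \<partial>?F)" for a s y
  have Gm: "(\<lambda>((a, s), y). G a s y) \<in> borel_measurable ((borel \<Otimes>\<^sub>M PiM UNIV (\<lambda>_. borel)) \<Otimes>\<^sub>M borel)"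
  proof -
    have rpm: "(\<lambda>p. ruin_path c w n (u + c * fst (fst (fst p)) - snd (fst p)) (snd (fst (fst p))) (snd p)) \<in> borel_measurable (((borel \<Otimes>\<^sub>M PiM UNIV (\<lambda>_. borel)) \<Otimes>\<^sub>M borel) \<Otimes>\<^sub>M ?F)"
      by (rule rp) measurable
    have "(\<lambda>p. u + c * fst (fst (fst p))) \<in> borel_measurable (((borel \<Otimes>\<^sub>M PiM UNIV (\<lambda>_. borel)) \<Otimes>\<^sub>M borel) \<Otimes>\<^sub>M ?F)"
      "(\<lambda>p. snd (fst p)) \<in> borel_measurable (((borel \<Otimes>\<^sub>M PiM UNIV (\<lambda>_. borel)) \<Otimes>\<^sub>M borel) \<Otimes>\<^sub>M ?F)"
      by measurable
    from measurable_branch[OF this rpm assms] have "(\<lambda>p. if u + c * fst (fst (fst p)) < snd (fst p) then w (snd (fst p) - (u + c * fst (fst (fst p)))) else ruin_path c w n (u + c * fst (fst (fst p)) - snd (fst p)) (snd (fst (fst p))) (snd p)) \<in> borel_measurable (((borel \<Otimes>\<^sub>M PiM UNIV (\<lambda>_. borel)) \<Otimes>\<^sub>M borel) \<Otimes>\<^sub>M ?F)"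
      .
    from sigma_finite_measure.borel_measurable_nn_integral_fst[OF prob_space_imp_sigma_finite[OF FPs] this] show ?thesis
      by (simp add: G_def case_prod_unfold cong: if_cong)
  qed
  have "(\<integral>\<^sup>+s. (\<integral>\<^sup>+z. ruin_path c w (Suc n) u s z \<partial>?F) \<partial>?E) = (\<integral>\<^sup>+s. (\<integral>\<^sup>+y. G (s 0) (\<lambda>i. s (Suc i)) y \<partial>\<nu>) \<partial>?E)"
    unfolding inner G_def ..
  also have "\<dots> = (\<integral>\<^sup>+a. (\<integral>\<^sup>+s. (\<integral>\<^sup>+y. G a s y \<partial>\<nu>) \<partial>?E) \<partial>?e)"
  proof (subst nn_integral_sequence[OF e.prob_space_axioms])
    have "(\<lambda>p. (\<lambda>((a, s), y). G a s y) ((fst p 0, (\<lambda>i. fst p (Suc i))), snd p)) \<in> borel_measurable (?E \<Otimes>\<^sub>M \<nu>)"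
      by (rule measurable_compose[OF _ Gm]) (measurable, auto intro!: measurable_PiM_single')
    then show "(\<lambda>s. \<integral>\<^sup>+y. G (s 0) (\<lambda>i. s (Suc i)) y \<partial>\<nu>) \<in> borel_measurable ?E"
      using borel_measurable_nn_integral_fst by fastforce
  qed simp
  also have "\<dots> = (\<integral>\<^sup>+a. (\<integral>\<^sup>+y. (\<integral>\<^sup>+s. G a s y \<partial>?E) \<partial>\<nu>) \<partial>?e)"
  proof (rule nn_integral_cong)
    fix a :: real
    have "(\<lambda>p. (\<lambda>((a, s), y). G a s y) ((a, snd p), fst p)) \<in> borel_measurable (\<nu> \<Otimes>\<^sub>M ?E)"
      by (rule measurable_compose[OF _ Gm]) measurable
    then have "(\<lambda>(y, s). G a s y) \<in> borel_measurable (\<nu> \<Otimes>\<^sub>M ?E)" by (simp add: case_prod_unfold)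
    from P.Fubini'[OF this] show "(\<integral>\<^sup>+s. (\<integral>\<^sup>+y. G a s y \<partial>\<nu>) \<partial>?E) = (\<integral>\<^sup>+y. (\<integral>\<^sup>+s. G a s y \<partial>?E) \<partial>\<nu>)" .
  qed
  also have "\<dots> = (\<integral>\<^sup>+a. after_claim \<nu> w (ruin_iter l c \<nu> w n) (u + c * a) \<partial>?e)"
    unfolding after_claim_def G_def
    by (intro nn_integral_cong) (auto simp: Suc prob_space.emeasure_space_1[OF FPs] prob_space.emeasure_space_1[OF EPs])
  also have "\<dots> = ruin_iter l c \<nu> w (Suc n) u"
    by (simp add: ruin_iter_Suc first_step_def)
  finally show ?case .
qed


locale reserve_process =
  fixes X :: "'a model"
  assumes model: "reserve_model X"
begin

abbreviation "M \<equiv> sample X"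
abbreviation "N \<equiv> arrivals X"
definition law :: "real measure" where "law = distr M borel (claim X 1)"

lemma premium_pos: "0 < premium X" and intensity_pos: "0 < intensity X"
  using model unfolding reserve_model_def by blast+

sublocale poisson M "intensity X" N
proof (intro poisson.intro poisson_axioms.intro)
  show "prob_space M" "poisson_process M (intensity X) N"
    using model unfolding reserve_model_def by blast+
qed (rule intensity_pos)

lemma claim_measurable: "1 \<le> i \<Longrightarrow> claim X i \<in> borel_measurable M"
proof -
  assume "1 \<le> i"
  have "indep_vars (\<lambda>_. borel) (claim X) {1..}" using model unfolding reserve_model_def by blast
  then show ?thesis using \<open>1 \<le> i\<close> by (simp add: indep_vars_def)
qed

lemma claim_Suc_measurable [measurable]: "claim X (Suc i) \<in> borel_measurable M"
  by (rule claim_measurable) simp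

lemma claim_distr: "1 \<le> i \<Longrightarrow> distr M borel (claim X i) = law"
  using model unfolding reserve_model_def law_def by blast

sublocale L: claim_law law "intensity X" "premium X"
proof -
  interpret D: prob_space law unfolding law_def by (rule prob_space_distr) (simp add: claim_measurable)
  show "claim_law law (intensity X) (premium X)"
  proof
    show "sets law = sets borel" by (simp add: law_def)
    have "AE \<omega> in M. claim X 1 \<omega> > 0" using model unfolding reserve_model_def by blast
    then show "AE z in law. 0 < z"
      unfolding law_def by (subst AE_distr_iff) (auto simp: claim_measurable)
  qed (rule intensity_pos premium_pos)+
qed

lemma jump_time_sum: "\<omega> \<in> space M \<Longrightarrow> jump_time N n \<omega> = (\<Sum>i<n. interarrival N i \<omega>)"
  by (induction n) (auto simp: jump_time_0 interarrival_def)

definition waits :: "'a \<Rightarrow> nat \<Rightarrow> real" where "waits \<omega> i = interarrival N i \<omega>"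
definition sizes :: "'a \<Rightarrow> nat \<Rightarrow> real" where "sizes \<omega> i = claim X (Suc i) \<omega>"

text \<open>
  Between claims the reserve increases, so it is at least as large as right after the preceding claim:
  it is negative at some time if and only if it is negative at some jump time, and the first such jump
  time is the time of ruin.
\<close>
lemma embedded_ruin:
  assumes w: "\<omega> \<in> space M" and unb: "\<forall>n. \<exists>t\<ge>0. n \<le> N t \<omega>" and cnt: "\<forall>n. N (jump_time N n \<omega>) \<omega> = n"
    and u: "0 \<le> u"
  shows "w (deficit X u \<omega>) * indicator (ruin_event X u) \<omega> = (SUP n. ruin_path (premium X) w n u (waits \<omega>) (sizes \<omega>))"
proof -
  let ?c = "premium X"
  note c = premium_pos
  let ?L = "level ?c u (waits \<omega>) (sizes \<omega>)"
  let ?T = "\<lambda>n. jump_time N n \<omega>"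
  have iff: "?T n \<le> t \<longleftrightarrow> n \<le> N t \<omega>" if "0 \<le> t" for n t
    using jump_time_le_iff[OF w _ that] unb by blast
  have claims: "(\<Sum>i=1..n. claim X i \<omega>) = (\<Sum>i<n. sizes \<omega> i)" for n
    by (simp add: sizes_def sum.atLeast1_atMost_eq)
  have L: "?L m = u + ?c * ?T (Suc m) - (\<Sum>i=1..Suc m. claim X i \<omega>)" for m
    unfolding level_def claims jump_time_sum[OF w] waits_def ..
  have at: "reserve X u (?T (Suc m)) \<omega> = ?L m" for m
    unfolding L reserve_def using cnt by simp
  have after: "\<exists>m. N t \<omega> = Suc m \<and> ?L m \<le> reserve X u t \<omega>" if "0 \<le> t" "reserve X u t \<omega> < 0" for t
  proof (cases "N t \<omega>")
    case 0
    then have "reserve X u t \<omega> = u + ?c * t" by (simp add: reserve_def)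
    moreover have "0 \<le> u + ?c * t" using that u c by simp
    ultimately show ?thesis using that by linarith
  next
    case (Suc m)
    then have "?T (Suc m) \<le> t" using iff[OF that(1)] by simp
    then have "?c * ?T (Suc m) \<le> ?c * t" using c by simp
    then show ?thesis using Suc by (auto simp: L reserve_def)
  qed
  let ?S = "{t. 0 \<le> t \<and> reserve X u t \<omega> < 0}"
  show ?thesis
  proof (cases "\<exists>m. ?L m < 0")
    case True
    define m where "m = (LEAST m. ?L m < 0)"
    have Lm: "?L m < 0" unfolding m_def using True by (rule LeastI_ex)
    have inS: "?T (Suc m) \<in> ?S" using Lm at jump_time_nonneg by simp
    have min: "?T (Suc m) \<le> t" if t: "t \<in> ?S" for t
    proof -
      obtain m' where m': "N t \<omega> = Suc m'" "?L m' \<le> reserve X u t \<omega>" using after[of t] t by blast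
      then have "?L m' < 0" using t by simp
      then have "m \<le> m'" unfolding m_def by (rule Least_le)
      then show ?thesis using iff[of t "Suc m"] m' t by simp
    qed
    have rt: "ruin_time X u \<omega> = ereal (?T (Suc m))"
      unfolding ruin_time_def
    proof (rule Inf_eqI)
      fix i assume "i \<in> ereal ` ?S"
      then show "ereal (?T (Suc m)) \<le> i" using min by auto
    next
      fix y assume "\<And>i. i \<in> ereal ` ?S \<Longrightarrow> y \<le> i"
      then show "y \<le> ereal (?T (Suc m))" using inS by blast
    qed
    then have "\<omega> \<in> ruin_event X u" using w by (simp add: ruin_event_def)
    moreover have "deficit X u \<omega> = - ?L m" using rt at Lm by (simp add: deficit_def)
    ultimately show ?thesis using True by (simp add: SUP_ruin_path m_def)
  next
    case False
    have "\<not> (0 \<le> t \<and> reserve X u t \<omega> < 0)" for t using after[of t] False by (metis le_less_trans)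
    then have S: "?S = {}" by blast
    have "ruin_time X u \<omega> = \<infinity>" unfolding ruin_time_def S by (simp add: top_ereal_def)
    then have "\<omega> \<notin> ruin_event X u" by (simp add: ruin_event_def)
    then show ?thesis using False by (simp add: SUP_ruin_path)
  qed
qed

lemma reserve_measurable [measurable]:
  assumes "0 \<le> t"
  shows "reserve X u t \<in> borel_measurable M"
proof -
  have [measurable]: "N t \<in> measurable M (count_space UNIV)" using assms by simp
  have "(\<lambda>\<omega>. (\<lambda>n \<omega>. \<Sum>i=1..n. claim X i \<omega>) (N t \<omega>) \<omega>) \<in> borel_measurable M"
    by (rule measurable_compose_countable) (auto intro!: borel_measurable_sum claim_measurable)
  then show ?thesis unfolding reserve_def[abs_def] by measurable
qed

lemma reserve_right_affine:
  assumes "\<omega> \<in> space M" "0 \<le> t"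
  shows "\<exists>d>0. \<forall>s. t \<le> s \<longrightarrow> s < t + d \<longrightarrow> reserve X u s \<omega> = reserve X u t \<omega> + premium X * (s - t)"
proof -
  obtain d where d: "d > 0" "\<And>s. t \<le> s \<Longrightarrow> s < t + d \<Longrightarrow> N s \<omega> = N t \<omega>"
    using N_right_constant[OF assms] by blast
  have "reserve X u s \<omega> = reserve X u t \<omega> + premium X * (s - t)" if "t \<le> s" "s < t + d" for s
    unfolding reserve_def d(2)[OF that] by (simp add: right_diff_distrib)
  with d(1) show ?thesis by blast
qed

text \<open>
  After a time at which the reserve is negative it stays negative for a while, by right continuity;
  hence rational times suffice to detect ruin.
\<close>
lemma ruin_time_less_iff:
  assumes w: "\<omega> \<in> space M"
  shows "ruin_time X u \<omega> < a \<longleftrightarrow> (\<exists>q\<in>\<rat>. 0 \<le> q \<and> ereal q < a \<and> reserve X u q \<omega> < 0)"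
proof
  assume "ruin_time X u \<omega> < a"
  then obtain t where t: "0 \<le> t" "reserve X u t \<omega> < 0" "ereal t < a"
    unfolding ruin_time_def Inf_less_iff by auto
  obtain d where d: "d > 0" "\<And>s. t \<le> s \<Longrightarrow> s < t + d \<Longrightarrow> reserve X u s \<omega> = reserve X u t \<omega> + premium X * (s - t)"
    using reserve_right_affine[OF w t(1)] by blast
  note c = premium_pos
  obtain b where b: "t < b" "ereal b < a"
    using t(3) ereal_dense2[of "ereal t" a] by auto
  \<comment> \<open>up to \<open>b'\<close> no claim arrives, the premium does not lift the reserve to 0, and the time stays below \<open>a\<close>\<close>
  define b' where "b' = min b (min (t + d) (t + (- reserve X u t \<omega>) / premium X))"
  have "t < b'" unfolding b'_def using b(1) d(1) t(2) c by (simp add: divide_neg_pos)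
  then obtain q where q: "q \<in> \<rat>" "t < q" "q < b'" using Rats_dense_in_real by blast
  have "t \<le> q" "q < t + d" using q unfolding b'_def by auto
  then have "reserve X u q \<omega> = reserve X u t \<omega> + premium X * (q - t)" by (rule d(2))
  moreover have "premium X * (q - t) < - reserve X u t \<omega>"
    using q c unfolding b'_def by (simp add: field_simps)
  ultimately show "\<exists>q\<in>\<rat>. 0 \<le> q \<and> ereal q < a \<and> reserve X u q \<omega> < 0"
    using q t b unfolding b'_def by (intro bexI[of _ q]) (auto intro: less_trans[of _ "ereal b"])
next
  assume "\<exists>q\<in>\<rat>. 0 \<le> q \<and> ereal q < a \<and> reserve X u q \<omega> < 0"
  then show "ruin_time X u \<omega> < a" unfolding ruin_time_def Inf_less_iff by auto
qed

lemma ruin_time_measurable [measurable]: "ruin_time X u \<in> borel_measurable M"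
proof (rule borel_measurableI_less)
  fix a :: ereal
  have "{\<omega> \<in> space M. ruin_time X u \<omega> < a} = (\<Union>q\<in>{q \<in> \<rat>. 0 \<le> q \<and> ereal q < a}. {\<omega> \<in> space M. reserve X u q \<omega> < 0})"
    using ruin_time_less_iff by auto
  also have "\<dots> \<in> sets M"
  proof (rule sets.countable_UN'')
    show "countable {q \<in> \<rat>. 0 \<le> q \<and> ereal q < a}" by (rule countable_subset[OF _ countable_rat]) auto
    fix q assume "q \<in> {q \<in> \<rat>. 0 \<le> q \<and> ereal q < a}"
    then have [measurable]: "reserve X u q \<in> borel_measurable M" by simp
    show "{\<omega> \<in> space M. reserve X u q \<omega> < 0} \<in> sets M" by measurable
  qed
  finally show "{\<omega> \<in> space M. ruin_time X u \<omega> < a} \<in> sets M" .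
qed

lemma ruin_event_measurable [measurable]: "ruin_event X u \<in> sets M"
  unfolding ruin_event_def by measurable

text \<open>
  Approximate the random time from above by times in a countable set and use right continuity.
\<close>
lemma reserve_at_random_time_measurable:
  assumes [measurable]: "\<tau> \<in> borel_measurable M" and pos: "\<And>\<omega>. \<omega> \<in> space M \<Longrightarrow> 0 \<le> \<tau> \<omega>"
  shows "(\<lambda>\<omega>. reserve X u (\<tau> \<omega>) \<omega>) \<in> borel_measurable M"
proof (rule borel_measurable_LIMSEQ_real)
  define g where "g m \<omega> = real (nat \<lfloor>real (Suc m) * \<tau> \<omega>\<rfloor> + 1) / real (Suc m)" for m \<omega>
  have gr: "\<tau> \<omega> < g m \<omega>" "g m \<omega> \<le> \<tau> \<omega> + 1 / real (Suc m)" if "\<omega> \<in> space M" for m \<omega>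
  proof -
    have f: "real (nat \<lfloor>real (Suc m) * \<tau> \<omega>\<rfloor>) = of_int \<lfloor>real (Suc m) * \<tau> \<omega>\<rfloor>" using pos[OF that] by simp
    have "real (Suc m) * \<tau> \<omega> < real (nat \<lfloor>real (Suc m) * \<tau> \<omega>\<rfloor> + 1)" "real (nat \<lfloor>real (Suc m) * \<tau> \<omega>\<rfloor> + 1) \<le> real (Suc m) * \<tau> \<omega> + 1"
      unfolding of_nat_add f using floor_correct[of "real (Suc m) * \<tau> \<omega>"] by simp_all
    then show "\<tau> \<omega> < g m \<omega>" "g m \<omega> \<le> \<tau> \<omega> + 1 / real (Suc m)"
      unfolding g_def by (simp_all add: field_simps del: of_nat_Suc of_nat_add)
  qed
  show "(\<lambda>\<omega>. reserve X u (g m \<omega>) \<omega>) \<in> borel_measurable M" for m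
  proof -
    have "(\<lambda>\<omega>. (\<lambda>n \<omega>. reserve X u (real (n + 1) / real (Suc m)) \<omega>) (nat \<lfloor>real (Suc m) * \<tau> \<omega>\<rfloor>) \<omega>) \<in> borel_measurable M"
    proof (rule measurable_compose_countable[where f="\<lambda>n \<omega>. reserve X u (real (n + 1) / real (Suc m)) \<omega>" and g="\<lambda>\<omega>. nat \<lfloor>real (Suc m) * \<tau> \<omega>\<rfloor>"])
      show "reserve X u (real (n + 1) / real (Suc m)) \<in> borel_measurable M" for n
        by (rule reserve_measurable) simp
      show "(\<lambda>\<omega>. nat \<lfloor>real (Suc m) * \<tau> \<omega>\<rfloor>) \<in> measurable M (count_space UNIV)" by measurable
    qed
    then show ?thesis by (simp add: g_def)
  qed
  show "(\<lambda>m. reserve X u (g m \<omega>) \<omega>) \<longlonglongrightarrow> reserve X u (\<tau> \<omega>) \<omega>" if w: "\<omega> \<in> space M" for \<omega>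
  proof -
    have glim: "(\<lambda>m. g m \<omega>) \<longlonglongrightarrow> \<tau> \<omega>"
    proof (rule real_tendsto_sandwich)
      show "\<forall>\<^sub>F m in sequentially. \<tau> \<omega> \<le> g m \<omega>" using gr(1)[OF w] by (intro always_eventually allI less_imp_le)
      show "\<forall>\<^sub>F m in sequentially. g m \<omega> \<le> \<tau> \<omega> + inverse (real (Suc m))" using gr(2)[OF w] by (simp add: inverse_eq_divide)
      show "(\<lambda>m. \<tau> \<omega> + inverse (real (Suc m))) \<longlonglongrightarrow> \<tau> \<omega>"
        using tendsto_add[OF tendsto_const LIMSEQ_inverse_real_of_nat] by simp
    qed simp
    obtain d where d: "d > 0" "\<And>s. \<tau> \<omega> \<le> s \<Longrightarrow> s < \<tau> \<omega> + d \<Longrightarrow> reserve X u s \<omega> = reserve X u (\<tau> \<omega>) \<omega> + premium X * (s - \<tau> \<omega>)"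
      using reserve_right_affine[OF w pos[OF w]] by blast
    have "\<forall>\<^sub>F m in sequentially. g m \<omega> < \<tau> \<omega> + d" using glim d(1) by (intro order_tendstoD(2)) auto
    then have ev: "\<forall>\<^sub>F m in sequentially. reserve X u (\<tau> \<omega>) \<omega> + premium X * (g m \<omega> - \<tau> \<omega>) = reserve X u (g m \<omega>) \<omega>"
      by eventually_elim (use d(2) gr(1)[OF w] in \<open>auto simp: less_imp_le\<close>)
    have "(\<lambda>m. reserve X u (\<tau> \<omega>) \<omega> + premium X * (g m \<omega> - \<tau> \<omega>)) \<longlonglongrightarrow> reserve X u (\<tau> \<omega>) \<omega> + premium X * (\<tau> \<omega> - \<tau> \<omega>)"
      by (intro tendsto_intros glim)
    from Lim_transform_eventually[OF this ev] show ?thesis by simp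
  qed
qed

lemma ruin_time_nonneg: "0 \<le> ruin_time X u \<omega>"
  unfolding ruin_time_def by (rule Inf_greatest) auto

lemma deficit_measurable [measurable]: "deficit X u \<in> borel_measurable M"
proof -
  have "(\<lambda>\<omega>. reserve X u (real_of_ereal (ruin_time X u \<omega>)) \<omega>) \<in> borel_measurable M"
    by (rule reserve_at_random_time_measurable) (auto simp: ruin_time_nonneg real_of_ereal_pos)
  then show ?thesis unfolding deficit_def[abs_def] by measurable
qed

lemma indep_sizes: "indep_vars (\<lambda>_. borel) (\<lambda>i. claim X (Suc i)) UNIV"
  unfolding indep_vars_def2
proof (intro conjI ballI indep_setsI)
  fix A J
  assume J: "J \<noteq> {}" "J \<subseteq> (UNIV::nat set)" "finite J"
    and A: "\<forall>j\<in>J. A j \<in> {claim X (Suc j) -` S \<inter> space M |S. S \<in> sets borel}"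
  have ind: "indep_sets (\<lambda>i. {claim X i -` S \<inter> space M |S. S \<in> sets borel}) {1..}"
    using model unfolding reserve_model_def indep_vars_def2 by blast
  have "prob (\<Inter>i\<in>Suc ` J. A (i - 1)) = (\<Prod>i\<in>Suc ` J. prob (A (i - 1)))"
    by (rule indep_setsD[OF ind]) (use J A in auto)
  then show "prob (\<Inter>j\<in>J. A j) = (\<Prod>j\<in>J. prob (A j))"
    by (simp add: prod.reindex)
qed auto

lemma distr_sizes: "distr M (PiM UNIV (\<lambda>_. borel)) sizes = PiM UNIV (\<lambda>_. law)"
  using indep_vars_iff_distr_eq_PiM[where I=UNIV and M'="\<lambda>_. borel" and X="\<lambda>i. claim X (Suc i)"] indep_sizes
  by (simp add: claim_distr sizes_def[abs_def] restrict_UNIV)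

lemma distr_waits: "distr M (PiM UNIV (\<lambda>_. borel)) waits = PiM UNIV (\<lambda>_. density lborel (exponential_density (intensity X)))"
  using distr_interarrivals by (simp add: waits_def[abs_def])

lemma waits_measurable: "waits \<in> measurable M (PiM UNIV (\<lambda>_. borel))"
  unfolding waits_def[abs_def] by (rule measurable_PiM_single') auto

lemma sizes_measurable: "sizes \<in> measurable M (PiM UNIV (\<lambda>_. borel))"
  unfolding sizes_def[abs_def] by (rule measurable_PiM_single') auto

abbreviation "arrivals_algebra \<equiv> vimage_algebra (space M) (\<lambda>\<omega>. \<lambda>t\<in>{0..}. N t \<omega>) (\<Pi>\<^sub>M t\<in>{0..}. count_space UNIV)"
abbreviation "claims_algebra \<equiv> vimage_algebra (space M) (\<lambda>\<omega>. \<lambda>i\<in>{1..}. claim X i \<omega>) (\<Pi>\<^sub>M i\<in>{1..}. borel)"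

lemma arrivals_algebra_measurable:
  assumes "0 \<le> t"
  shows "N t \<in> measurable arrivals_algebra (count_space UNIV)"
proof -
  have "(\<lambda>\<omega>. \<lambda>t\<in>{0..}. N t \<omega>) \<in> measurable arrivals_algebra (\<Pi>\<^sub>M t\<in>{0..}. count_space UNIV)"
    by (rule measurable_vimage_algebra1) (auto simp: space_PiM)
  from measurable_compose[OF this measurable_component_singleton[of t]] assms
  have "(\<lambda>\<omega>. (\<lambda>t\<in>{0..}. N t \<omega>) t) \<in> measurable arrivals_algebra (count_space UNIV)" by simp
  then show ?thesis using assms by simp
qed

lemma claims_algebra_measurable:
  assumes "1 \<le> i"
  shows "claim X i \<in> measurable claims_algebra borel"
proof -
  have "(\<lambda>\<omega>. \<lambda>i\<in>{1..}. claim X i \<omega>) \<in> measurable claims_algebra (\<Pi>\<^sub>M i\<in>{1..}. borel)"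
    by (rule measurable_vimage_algebra1) (auto simp: space_PiM)
  from measurable_compose[OF this measurable_component_singleton[of i]] assms
  have "(\<lambda>\<omega>. (\<lambda>i\<in>{1..}. claim X i \<omega>) i) \<in> measurable claims_algebra borel" by simp
  then show ?thesis using assms by simp
qed

text \<open>
  The independence of the \<open>\<sigma>\<close>-algebras of arrivals and claims, in terms of random variables.
\<close>
lemma indep_arrivals_claims:
  assumes f: "f \<in> measurable arrivals_algebra A" and g: "g \<in> measurable claims_algebra B"
    and fM: "f \<in> measurable M A" and gM: "g \<in> measurable M B"
  shows "indep_var A f B g"
  unfolding indep_var_eq
proof (intro conjI fM gM)
  have ind: "indep_set (sets arrivals_algebra) (sets claims_algebra)"
    using model unfolding reserve_model_def by blast
  have 1: "sigma_sets (space M) {f -` S \<inter> space M |S. S \<in> sets A} \<subseteq> sets arrivals_algebra"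
  proof -
    have "sigma_sets (space arrivals_algebra) {f -` S \<inter> space M |S. S \<in> sets A} \<subseteq> sets arrivals_algebra"
      by (rule sets.sigma_sets_subset) (use measurable_sets[OF f] in auto)
    then show ?thesis by simp
  qed
  have 2: "sigma_sets (space M) {g -` S \<inter> space M |S. S \<in> sets B} \<subseteq> sets claims_algebra"
  proof -
    have "sigma_sets (space claims_algebra) {g -` S \<inter> space M |S. S \<in> sets B} \<subseteq> sets claims_algebra"
      by (rule sets.sigma_sets_subset) (use measurable_sets[OF g] in auto)
    then show ?thesis by simp
  qed
  show "indep_set (sigma_sets (space M) {f -` S \<inter> space M |S. S \<in> sets A}) (sigma_sets (space M) {g -` S \<inter> space M |S. S \<in> sets B})"
    using ind 1 2 unfolding indep_sets2_eq by blast
qed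

lemma indep_waits_sizes: "indep_var (PiM UNIV (\<lambda>_. borel)) waits (PiM UNIV (\<lambda>_. borel)) sizes"
proof (rule indep_arrivals_claims[OF _ _ waits_measurable sizes_measurable])
  have [measurable]: "jump_time N n \<in> borel_measurable arrivals_algebra" for n
    by (rule jump_time_measurable) (auto intro: arrivals_algebra_measurable)
  show "waits \<in> measurable arrivals_algebra (PiM UNIV (\<lambda>_. borel))"
    unfolding waits_def[abs_def] interarrival_def by (rule measurable_PiM_single') auto
  show "sizes \<in> measurable claims_algebra (PiM UNIV (\<lambda>_. borel))"
    unfolding sizes_def[abs_def]
  proof (rule measurable_PiM_single')
    show "claim X (Suc i) \<in> borel_measurable claims_algebra" for i
      by (rule claims_algebra_measurable) simp
  qed auto
qed

text \<open>
  Almost surely ruin is the passage of the embedded random walk, whose waiting times and claims have the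
  product law of \<open>nn_integral_ruin_path\<close>; monotone convergence passes to infinitely many claims.
\<close>
theorem ruin_value_represents:
  assumes [measurable]: "w \<in> borel_measurable borel" and u: "0 \<le> u"
  shows "(\<integral>\<^sup>+\<omega>. w (deficit X u \<omega>) * indicator (ruin_event X u) \<omega> \<partial>M) = ruin_value (intensity X) (premium X) law w u"
proof -
  let ?E = "PiM UNIV (\<lambda>_::nat. density lborel (exponential_density (intensity X)))" and ?F = "PiM UNIV (\<lambda>_::nat. law)"
  have FPs: "prob_space ?F" by (rule prob_space_PiM) unfold_locales
  let ?P = "PiM UNIV (\<lambda>_::nat. borel :: real measure)"
  have joint: "?E \<Otimes>\<^sub>M ?F = distr M (?P \<Otimes>\<^sub>M ?P) (\<lambda>\<omega>. (waits \<omega>, sizes \<omega>))"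
    using indep_waits_sizes unfolding indep_var_distribution_eq distr_waits distr_sizes by blast
  have pm: "(\<lambda>\<omega>. (waits \<omega>, sizes \<omega>)) \<in> measurable M (?P \<Otimes>\<^sub>M ?P)"
    by (intro measurable_Pair waits_measurable sizes_measurable)
  have rm: "(\<lambda>p. ruin_path (premium X) w n u (fst p) (snd p)) \<in> borel_measurable (?P \<Otimes>\<^sub>M ?P)" for n
  proof -
    have "(\<lambda>p. (u, fst p, snd p)) \<in> measurable (?P \<Otimes>\<^sub>M ?P) (borel \<Otimes>\<^sub>M (?P \<Otimes>\<^sub>M ?P))" by measurable
    from measurable_compose[OF this ruin_path_measurable[OF assms(1)]] show ?thesis by simp
  qed
  have meas: "(\<lambda>\<omega>. ruin_path (premium X) w n u (waits \<omega>) (sizes \<omega>)) \<in> borel_measurable M" for n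
    using measurable_compose[OF pm rm] by simp
  have E: "(\<integral>\<^sup>+\<omega>. ruin_path (premium X) w n u (waits \<omega>) (sizes \<omega>) \<partial>M) = ruin_iter (intensity X) (premium X) law w n u" for n
  proof -
    have "(\<integral>\<^sup>+\<omega>. ruin_path (premium X) w n u (waits \<omega>) (sizes \<omega>) \<partial>M)
      = (\<integral>\<^sup>+p. ruin_path (premium X) w n u (fst p) (snd p) \<partial>(?E \<Otimes>\<^sub>M ?F))"
      unfolding joint using rm by (subst nn_integral_distr[OF pm]) auto
    also have "\<dots> = (\<integral>\<^sup>+s. (\<integral>\<^sup>+z. ruin_path (premium X) w n u s z \<partial>?F) \<partial>?E)"
    proof -
      have "(\<lambda>p. ruin_path (premium X) w n u (fst p) (snd p)) \<in> borel_measurable (?E \<Otimes>\<^sub>M ?F)"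
        unfolding joint using rm by simp
      from sigma_finite_measure.nn_integral_fst[OF prob_space_imp_sigma_finite[OF FPs] this] show ?thesis by simp
    qed
    also have "\<dots> = ruin_iter (intensity X) (premium X) law w n u" by (rule L.nn_integral_ruin_path) measurable
    finally show ?thesis .
  qed
  have "(\<integral>\<^sup>+\<omega>. w (deficit X u \<omega>) * indicator (ruin_event X u) \<omega> \<partial>M)
     = (\<integral>\<^sup>+\<omega>. (SUP n. ruin_path (premium X) w n u (waits \<omega>) (sizes \<omega>)) \<partial>M)"
    by (rule nn_integral_cong_AE, use AE_count_at_jump AE_space in eventually_elim) (rule embedded_ruin, use u in auto)
  also have "\<dots> = (SUP n. \<integral>\<^sup>+\<omega>. ruin_path (premium X) w n u (waits \<omega>) (sizes \<omega>) \<partial>M)"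
    by (rule nn_integral_monotone_convergence_SUP[OF _ meas])
      (intro incseq_SucI le_funI ruin_path_mono)
  also have "\<dots> = ruin_value (intensity X) (premium X) law w u"
    by (simp add: E ruin_value_def)
  finally show ?thesis .
qed

theorem deficit_moment_eq:
  assumes u: "0 \<le> u"
  shows "deficit_moment X j u = enn2real (ruin_value (intensity X) (premium X) law (\<lambda>y. ennreal (y ^ j)) u)
    / enn2real (ruin_value (intensity X) (premium X) law (\<lambda>y. ennreal (y ^ 0)) u)"
proof -
  have d0: "0 \<le> deficit X u \<omega>" for \<omega> by (simp add: deficit_def)
  have "(LINT \<omega>:ruin_event X u|M. deficit X u \<omega> ^ j) = enn2real (\<integral>\<^sup>+\<omega>. ennreal (indicator (ruin_event X u) \<omega> *\<^sub>R deficit X u \<omega> ^ j) \<partial>M)"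
    unfolding set_lebesgue_integral_def by (rule integral_eq_nn_integral) (auto simp: d0)
  also have "(\<integral>\<^sup>+\<omega>. ennreal (indicator (ruin_event X u) \<omega> *\<^sub>R deficit X u \<omega> ^ j) \<partial>M)
     = (\<integral>\<^sup>+\<omega>. ennreal (deficit X u \<omega> ^ j) * indicator (ruin_event X u) \<omega> \<partial>M)"
    by (intro nn_integral_cong) (auto simp: indicator_def)
  also have "\<dots> = ruin_value (intensity X) (premium X) law (\<lambda>y. ennreal (y ^ j)) u"
    by (rule ruin_value_represents) (use u in auto)
  finally have 1: "(LINT \<omega>:ruin_event X u|M. deficit X u \<omega> ^ j) = enn2real (ruin_value (intensity X) (premium X) law (\<lambda>y. ennreal (y ^ j)) u)" .
  have "emeasure M (ruin_event X u) = (\<integral>\<^sup>+\<omega>. ennreal (deficit X u \<omega> ^ 0) * indicator (ruin_event X u) \<omega> \<partial>M)"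
    by simp
  also have "\<dots> = ruin_value (intensity X) (premium X) law (\<lambda>y. ennreal (y ^ 0)) u"
    by (rule ruin_value_represents) (use u in auto)
  finally have "measure M (ruin_event X u) = enn2real (ruin_value (intensity X) (premium X) law (\<lambda>y. ennreal (y ^ 0)) u)"
    by (simp add: measure_def)
  with 1 show ?thesis by (simp add: deficit_moment_def)
qed

end

section \<open>Mean and variance of the reserve\<close>

lemma poisson_weights_sums:
  fixes l :: real
  shows "(\<lambda>n. l ^ n / fact n * exp (- l)) sums 1"
    and "(\<lambda>n. l ^ n / fact n * exp (- l) * real n) sums l"
    and "(\<lambda>n. l ^ n / fact n * exp (- l) * (real n * (real n - 1))) sums l\<^sup>2"
proof -
  let ?p = "\<lambda>n. l ^ n / fact n * exp (- l)"
  have "(\<lambda>n. l ^ n /\<^sub>R fact n) sums exp l" by (rule exp_converges)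
  then have "(\<lambda>n. l ^ n /\<^sub>R fact n * exp (- l)) sums (exp l * exp (- l))" by (rule sums_mult2)
  then show 0: "?p sums 1" by (simp add: divide_inverse ac_simps exp_minus_inverse)
  have "(\<lambda>n. ?p (Suc n) * real (Suc n)) sums l"
  proof -
    have eq: "?p (Suc n) * real (Suc n) = l * ?p n" for n by (simp add: field_simps del: of_nat_Suc)
    show ?thesis unfolding eq using sums_mult[OF 0, of l] by (simp only: mult_1_right)
  qed
  from sums_Suc[OF this] show 1: "(\<lambda>n. ?p n * real n) sums l" by simp
  have "(\<lambda>n. ?p (Suc n) * (real (Suc n) * (real (Suc n) - 1))) sums l\<^sup>2"
  proof -
    have eq: "?p (Suc n) * (real (Suc n) * (real (Suc n) - 1)) = l * (?p n * real n)" for n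
    proof -
      have *: "?p (Suc n) * real (Suc n) = l * ?p n" by (simp add: field_simps del: of_nat_Suc)
      have "?p (Suc n) * (real (Suc n) * (real (Suc n) - 1)) = (?p (Suc n) * real (Suc n)) * real n" by simp
      then show ?thesis unfolding * by simp
    qed
    show ?thesis unfolding eq power2_eq_square by (rule sums_mult[OF 1])
  qed
  from sums_Suc[OF this] show "(\<lambda>n. ?p n * (real n * (real n - 1))) sums l\<^sup>2" by simp
qed

context reserve_process
begin

lemma integrable_claim_cong:
  assumes "1 \<le> i" and [measurable]: "f \<in> borel_measurable borel"
  shows "integrable M (\<lambda>\<omega>. (f (claim X i \<omega>) :: real)) \<longleftrightarrow> integrable law f"
    and "(\<integral>\<omega>. f (claim X i \<omega>) \<partial>M) = integral\<^sup>L law f"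
proof -
  have m: "claim X i \<in> borel_measurable M" by (rule claim_measurable) fact
  show "integrable M (\<lambda>\<omega>. f (claim X i \<omega>)) \<longleftrightarrow> integrable law f"
    using integrable_distr_eq[OF m assms(2)] claim_distr[OF assms(1)] by simp
  show "(\<integral>\<omega>. f (claim X i \<omega>) \<partial>M) = integral\<^sup>L law f"
    using integral_distr[OF m assms(2)] claim_distr[OF assms(1)] by simp
qed

lemma claim_moment_law: "claim_moment X j = (\<integral>z. z ^ j \<partial>law)"
  unfolding claim_moment_def by (rule integrable_claim_cong(2)) auto

text \<open>
  Induction on \<open>n\<close>: the next claim is uncorrelated with the sum of the preceding ones.
\<close>
lemma sum_claims_moments:
  assumes i1: "integrable law (\<lambda>z. z)" and i2: "integrable law (\<lambda>z. z\<^sup>2)"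
  defines "S \<equiv> \<lambda>n \<omega>. \<Sum>i=1..n. claim X i \<omega>"
  shows "integrable M (S n) \<and> integrable M (\<lambda>\<omega>. (S n \<omega>)\<^sup>2) \<and> (\<integral>\<omega>. S n \<omega> \<partial>M) = real n * claim_moment X 1
    \<and> (\<integral>\<omega>. (S n \<omega>)\<^sup>2 \<partial>M) = real n * claim_moment X 2 + real n * (real n - 1) * (claim_moment X 1)\<^sup>2"
proof (induction n)
  case 0 then show ?case by (simp add: S_def)
next
  case (Suc n)
  let ?Z = "claim X (Suc n)"
  have Z: "integrable M ?Z" "integrable M (\<lambda>\<omega>. (?Z \<omega>)\<^sup>2)"
    by (rule integrable_claim_cong(1)[of "Suc n" "\<lambda>z. z", THEN iffD2], simp, simp, rule i1)
      (rule integrable_claim_cong(1)[of "Suc n" "\<lambda>z. z\<^sup>2", THEN iffD2], simp, simp, rule i2)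
  have EZ: "(\<integral>\<omega>. ?Z \<omega> \<partial>M) = claim_moment X 1" "(\<integral>\<omega>. (?Z \<omega>)\<^sup>2 \<partial>M) = claim_moment X 2"
    unfolding claim_moment_law power_one_right
    by (rule integrable_claim_cong(2), simp, simp)+
  have "indep_vars (\<lambda>_. borel) (claim X) {1..}" using model unfolding reserve_model_def by blast
  then have "indep_vars (\<lambda>_. borel) (claim X) (insert (Suc n) {1..n})"
    by (rule indep_vars_subset) auto
  then have ind: "indep_var borel ?Z borel (S n)" unfolding S_def by (intro indep_vars_sum) auto
  have cross: "integrable M (\<lambda>\<omega>. ?Z \<omega> * S n \<omega>)" "(\<integral>\<omega>. ?Z \<omega> * S n \<omega> \<partial>M) = (\<integral>\<omega>. ?Z \<omega> \<partial>M) * (\<integral>\<omega>. S n \<omega> \<partial>M)"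
    using indep_var_integrable[OF ind Z(1)] indep_var_lebesgue_integral[OF ind Z(1)] Suc by auto
  have S: "S (Suc n) = (\<lambda>\<omega>. S n \<omega> + ?Z \<omega>)" by (simp add: S_def fun_eq_iff)
  have S2: "(\<lambda>\<omega>. (S (Suc n) \<omega>)\<^sup>2) = (\<lambda>\<omega>. (S n \<omega>)\<^sup>2 + 2 * (?Z \<omega> * S n \<omega>) + (?Z \<omega>)\<^sup>2)"
    unfolding S by (simp add: fun_eq_iff power2_sum)
  show ?case
  proof (intro conjI)
    show "integrable M (S (Suc n))" unfolding S using Suc Z by auto
    show "integrable M (\<lambda>\<omega>. (S (Suc n) \<omega>)\<^sup>2)" unfolding S2 using Suc Z cross(1) by auto
    show "(\<integral>\<omega>. S (Suc n) \<omega> \<partial>M) = real (Suc n) * claim_moment X 1"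
      unfolding S using Suc Z EZ by (simp add: algebra_simps)
    have "(\<integral>\<omega>. (S (Suc n) \<omega>)\<^sup>2 \<partial>M) = (\<integral>\<omega>. (S n \<omega>)\<^sup>2 \<partial>M) + 2 * (\<integral>\<omega>. ?Z \<omega> * S n \<omega> \<partial>M) + (\<integral>\<omega>. (?Z \<omega>)\<^sup>2 \<partial>M)"
      unfolding S2 using Suc Z cross(1) by simp
    also have "\<dots> = real (Suc n) * claim_moment X 2 + real (Suc n) * (real (Suc n) - 1) * (claim_moment X 1)\<^sup>2"
      unfolding cross(2) EZ using Suc by (simp add: algebra_simps power2_eq_square)
    finally show "(\<integral>\<omega>. (S (Suc n) \<omega>)\<^sup>2 \<partial>M) = real (Suc n) * claim_moment X 2 + real (Suc n) * (real (Suc n) - 1) * (claim_moment X 1)\<^sup>2" .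
  qed
qed

text \<open>
  The aggregate claims up to time 1 are split according to the number \<open>n\<close> of claims, which is
  independent of the claims. Then \<open>E N = l\<close> and \<open>E N (N - 1) = l\<^sup>2\<close> give the mean and the second moment.
\<close>
lemma compound_poisson_moments:
  assumes i1: "integrable law (\<lambda>z. z)" and i2: "integrable law (\<lambda>z. z\<^sup>2)"
  defines "m1 \<equiv> claim_moment X 1" and "m2 \<equiv> claim_moment X 2"
  shows "reserve_moment X 0 1 1 = premium X - intensity X * m1"
    and "reserve_moment X 0 1 2 = (premium X - intensity X * m1)\<^sup>2 + intensity X * m2"
proof -
  let ?l = "intensity X" and ?c = "premium X"
  define p where "p n = ?l ^ n / fact n * exp (- ?l)" for n
  define S where "S n \<omega> = (\<Sum>i=1..n. claim X i \<omega>)" for n \<omega>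
  define A where "A n = {\<omega> \<in> space M. N 1 \<omega> = n}" for n
  have N1 [measurable]: "N 1 \<in> measurable M (count_space UNIV)" by simp
  have A [measurable]: "A n \<in> events" for n
    using measurable_sets[OF N1, of "{n}"] by (simp add: A_def vimage_def Int_def conj_commute)
  have Sm [measurable]: "S n \<in> borel_measurable M" for n
    unfolding S_def[abs_def] by (intro borel_measurable_sum claim_measurable) auto
  have p0: "0 \<le> p n" for n using intensity_pos by (simp add: p_def)
  have pA: "prob (A n) = p n" for n
  proof -
    have "prob (A n) = prob {\<omega> \<in> space M. N 1 \<omega> - N 0 \<omega> = n}"
      by (intro arg_cong[where f=prob]) (auto simp: A_def N_0)
    then show ?thesis using prob_increment_eq[of 0 1 n] by (simp add: p_def)
  qed
  have m0: "0 \<le> m1" "0 \<le> m2"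
  proof -
    have "AE z in law. 0 \<le> z" using L.claim_pos by eventually_elim simp
    then show "0 \<le> m1" unfolding m1_def claim_moment_law by (auto intro!: integral_nonneg_AE)
    show "0 \<le> m2" unfolding m2_def claim_moment_law by (auto intro!: integral_nonneg_AE)
  qed
  have pos: "AE \<omega> in M. \<forall>n. 0 \<le> S n \<omega>"
  proof -
    have "AE \<omega> in M. 0 < claim X (Suc i) \<omega>" for i
      using model unfolding reserve_model_def by simp
    then have "AE \<omega> in M. \<forall>i. 0 < claim X (Suc i) \<omega>" by (simp add: AE_all_countable)
    then show ?thesis
    proof eventually_elim
      case (elim \<omega>)
      have "0 \<le> claim X i \<omega>" if "i \<in> {1..n}" for i n
        using elim[rule_format, of "i - 1"] that by simp
      then show ?case unfolding S_def by (intro allI sum_nonneg)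
    qed
  qed
  have indep: "(\<integral>\<^sup>+\<omega>. ennreal (indicator (A n) \<omega> * S n \<omega> ^ d) \<partial>M) = ennreal (p n * (\<integral>\<omega>. S n \<omega> ^ d \<partial>M))"
    if int: "integrable M (\<lambda>\<omega>. S n \<omega> ^ d)" for n d
  proof -
    have "indep_var borel (\<lambda>\<omega>. indicator {n} (N 1 \<omega>) :: real) borel (\<lambda>\<omega>. S n \<omega> ^ d)"
    proof (rule indep_arrivals_claims)
      show "(\<lambda>\<omega>. indicator {n} (N 1 \<omega>) :: real) \<in> borel_measurable arrivals_algebra"
        by (rule measurable_compose[OF arrivals_algebra_measurable]) auto
      show "(\<lambda>\<omega>. S n \<omega> ^ d) \<in> borel_measurable claims_algebra"
        unfolding S_def by (intro borel_measurable_power borel_measurable_sum claims_algebra_measurable) auto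
      show "(\<lambda>\<omega>. indicator {n} (N 1 \<omega>) :: real) \<in> borel_measurable M"
        by (rule measurable_compose[OF N1]) auto
    qed measurable
    moreover have iA: "integrable M (\<lambda>\<omega>. indicator {n} (N 1 \<omega>) :: real)"
      by (rule integrable_const_bound[where B=1]) (auto intro!: AE_I2 measurable_compose[OF N1])
    ultimately have *: "integrable M (\<lambda>\<omega>. indicator {n} (N 1 \<omega>) * S n \<omega> ^ d)"
      "(\<integral>\<omega>. indicator {n} (N 1 \<omega>) * S n \<omega> ^ d \<partial>M) = (\<integral>\<omega>. indicator {n} (N 1 \<omega>) \<partial>M) * (\<integral>\<omega>. S n \<omega> ^ d \<partial>M)"
      using int by (auto intro: indep_var_integrable indep_var_lebesgue_integral)
    have ind: "(\<integral>\<omega>. (indicator {n} (N 1 \<omega>) :: real) \<partial>M) = p n"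
    proof -
      have "(\<integral>\<omega>. (indicator {n} (N 1 \<omega>) :: real) \<partial>M) = (\<integral>\<omega>. indicator (A n) \<omega> \<partial>M)"
        by (rule Bochner_Integration.integral_cong) (auto simp: A_def indicator_def)
      then show ?thesis by (simp add: pA)
    qed
    have "(\<integral>\<^sup>+\<omega>. ennreal (indicator (A n) \<omega> * S n \<omega> ^ d) \<partial>M) = (\<integral>\<^sup>+\<omega>. ennreal (indicator {n} (N 1 \<omega>) * S n \<omega> ^ d) \<partial>M)"
      by (rule nn_integral_cong) (auto simp: A_def indicator_def)
    also have "\<dots> = ennreal (\<integral>\<omega>. indicator {n} (N 1 \<omega>) * S n \<omega> ^ d \<partial>M)"
      using pos by (intro nn_integral_eq_integral *(1)) (auto elim!: eventually_mono)
    finally show ?thesis using * ind by simp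
  qed
  have total: "(\<integral>\<^sup>+\<omega>. ennreal (S (N 1 \<omega>) \<omega> ^ d) \<partial>M) = ennreal s"
    if int: "\<And>n. integrable M (\<lambda>\<omega>. S n \<omega> ^ d)" and sums: "(\<lambda>n. p n * (\<integral>\<omega>. S n \<omega> ^ d \<partial>M)) sums s"
    for d s
  proof -
    have "(\<integral>\<^sup>+\<omega>. ennreal (S (N 1 \<omega>) \<omega> ^ d) \<partial>M) = (\<integral>\<^sup>+\<omega>. (\<Sum>n. ennreal (indicator (A n) \<omega> * S n \<omega> ^ d)) \<partial>M)"
    proof (rule nn_integral_cong)
      fix \<omega> assume w: "\<omega> \<in> space M"
      have "(\<Sum>n. ennreal (indicator (A n) \<omega> * S n \<omega> ^ d)) = (\<Sum>n\<in>{N 1 \<omega>}. ennreal (indicator (A n) \<omega> * S n \<omega> ^ d))"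
        by (rule suminf_finite) (auto simp: A_def indicator_def)
      then show "ennreal (S (N 1 \<omega>) \<omega> ^ d) = (\<Sum>n. ennreal (indicator (A n) \<omega> * S n \<omega> ^ d))"
        using w by (simp add: A_def)
    qed
    also have "\<dots> = (\<Sum>n. \<integral>\<^sup>+\<omega>. ennreal (indicator (A n) \<omega> * S n \<omega> ^ d) \<partial>M)"
      by (rule nn_integral_suminf) measurable
    also have "\<dots> = (\<Sum>n. ennreal (p n * (\<integral>\<omega>. S n \<omega> ^ d \<partial>M)))" by (simp add: indep[OF int])
    also have "\<dots> = ennreal s"
    proof (rule suminf_ennreal_eq[OF _ sums])
      show "0 \<le> p n * (\<integral>\<omega>. S n \<omega> ^ d \<partial>M)" for n
        using pos p0 by (intro mult_nonneg_nonneg integral_nonneg_AE) (auto elim!: eventually_mono)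
    qed
    finally show ?thesis .
  qed
  have sm: "integrable M (S n)" "integrable M (\<lambda>\<omega>. (S n \<omega>)\<^sup>2)" "(\<integral>\<omega>. S n \<omega> \<partial>M) = real n * m1"
     "(\<integral>\<omega>. (S n \<omega>)\<^sup>2 \<partial>M) = real n * m2 + real n * (real n - 1) * m1\<^sup>2" for n
    using sum_claims_moments[OF i1 i2, of n] unfolding S_def m1_def m2_def by auto
  have T1: "(\<integral>\<^sup>+\<omega>. ennreal (S (N 1 \<omega>) \<omega>) \<partial>M) = ennreal (?l * m1)"
    using total[of 1 "?l * m1"] sm sums_mult2[OF poisson_weights_sums(2), of ?l m1]
    by (simp add: p_def mult.assoc)
  have T2: "(\<integral>\<^sup>+\<omega>. ennreal ((S (N 1 \<omega>) \<omega>)\<^sup>2) \<partial>M) = ennreal (?l * m2 + ?l\<^sup>2 * m1\<^sup>2)"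
  proof (rule total)
    show "integrable M (\<lambda>\<omega>. (S n \<omega>)\<^sup>2)" for n by (rule sm)
    show "(\<lambda>n. p n * (\<integral>\<omega>. (S n \<omega>)\<^sup>2 \<partial>M)) sums (?l * m2 + ?l\<^sup>2 * m1\<^sup>2)"
      using sums_add[OF sums_mult2[OF poisson_weights_sums(2), of ?l m2] sums_mult2[OF poisson_weights_sums(3), of ?l "m1\<^sup>2"]]
      by (simp add: sm p_def distrib_left mult.assoc)
  qed
  define Y where "Y \<omega> = S (N 1 \<omega>) \<omega>" for \<omega>
  have Ym [measurable]: "Y \<in> borel_measurable M"
    unfolding Y_def by (rule measurable_compose_countable) (auto simp: Sm)
  have Y0: "AE \<omega> in M. 0 \<le> Y \<omega>" using pos by eventually_elim (simp add: Y_def)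
  have Y1: "integrable M Y" "(\<integral>\<omega>. Y \<omega> \<partial>M) = ?l * m1"
    using T1 Y0 m0 intensity_pos
    by (auto intro!: integrableI_nonneg simp: integral_eq_nn_integral Y_def[symmetric])
  have Y2: "integrable M (\<lambda>\<omega>. (Y \<omega>)\<^sup>2)" "(\<integral>\<omega>. (Y \<omega>)\<^sup>2 \<partial>M) = ?l * m2 + ?l\<^sup>2 * m1\<^sup>2"
    using T2 m0 intensity_pos
    by (auto intro!: integrableI_nonneg simp: integral_eq_nn_integral Y_def[symmetric] simp del: ennreal_plus)
  have r: "reserve X 0 1 \<omega> = ?c - Y \<omega>" for \<omega> by (simp add: reserve_def Y_def S_def)
  show "reserve_moment X 0 1 1 = ?c - ?l * m1"
    unfolding reserve_moment_def r using Y1 by (simp add: prob_space)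
  have r2: "(?c - Y \<omega>)\<^sup>2 = ?c\<^sup>2 - 2 * ?c * Y \<omega> + (Y \<omega>)\<^sup>2" for \<omega> by (simp add: power2_diff)
  show "reserve_moment X 0 1 2 = (?c - ?l * m1)\<^sup>2 + ?l * m2"
    unfolding reserve_moment_def r r2 using Y1 Y2 by (simp add: prob_space power2_eq_square algebra_simps)
qed

end

section \<open>Moments of the deficit\<close>

lemma enn2real_ratio_le:
  assumes "a \<le> ennreal C * b" "0 < b" "b < \<infinity>" "0 \<le> C"
  shows "enn2real a / enn2real b \<le> C"
proof -
  obtain y where y: "b = ennreal y" "0 < y"
    using assms(2,3) by (cases b) (auto simp: ennreal_zero_less_top)
  have "a \<le> ennreal (C * y)" using assms y by (simp add: ennreal_mult)
  then have "enn2real a \<le> C * y" using assms(4) y by (intro enn2real_leI) auto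
  then show ?thesis using y by (simp add: field_simps)
qed

lemma enn2real_ratio_ge:
  assumes "ennreal C * b \<le> a" "0 < b" "b < \<infinity>" "a < \<infinity>" "0 \<le> C"
  shows "C \<le> enn2real a / enn2real b"
proof -
  obtain y where y: "b = ennreal y" "0 < y"
    using assms(2,3) by (cases b) (auto simp: ennreal_zero_less_top)
  obtain x where x: "a = ennreal x" "0 \<le> x"
    using assms(4) by (cases a) auto
  have "C * y \<le> x" using assms(1,5) x y by (simp add: ennreal_mult[symmetric])
  then show ?thesis using x y by (simp add: field_simps)
qed

text \<open>
  The constant of \<open>ruin_value_ratio\<close> for mean claim \<open>m\<close>, safety loading at most \<open>B\<close> and tilted \<open>k\<close>-th
  moment at most \<open>E\<close>. Neither the initial reserve nor the adjustment coefficient enters.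
\<close>
definition deficit_bound :: "real \<Rightarrow> real \<Rightarrow> real \<Rightarrow> real" where
  "deficit_bound m B E = (let p = 1 / (2 * (1 + B)); u0 = m / 2; K = (1 + E) * (1 / p + 1 / (u0 * p)) in K * (1 / p) powr (K / u0))"

context reserve_process
begin

lemma tail_real: "L.tail x = ennreal (measure law {x<..})"
  unfolding L.tail_def by (rule L.emeasure_eq_measure)

lemma one_minus_claim_cdf: "1 - claim_cdf X x = measure law {x<..}"
proof -
  have "prob_space.prob law (space law - {..x}) = 1 - measure law {..x}"
    by (rule L.prob_compl) (simp add: L.sets_law)
  moreover have "space law - {..x} = {x<..}" by auto
  ultimately show ?thesis by (simp add: claim_cdf_def cdf_def law_def)
qed

lemma measure_tail_pos: "0 < measure law {x<..}"
  using model one_minus_claim_cdf[of x] unfolding reserve_model_def by (metis diff_gt_0_iff_gt)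

lemma measure_tail_measurable [measurable]: "(\<lambda>x. measure law {x<..}) \<in> borel_measurable borel"
proof -
  have "(\<lambda>x. enn2real (L.tail x)) \<in> borel_measurable borel" by measurable
  then show ?thesis by (simp add: tail_real)
qed

lemma claim_mean_pos:
  assumes "claim_moment X 1 \<noteq> 0"
  shows "integrable law (\<lambda>z. z)" "0 < claim_moment X 1"
proof -
  have m: "claim_moment X 1 = (\<integral>z. z \<partial>law)" by (simp add: claim_moment_law)
  show "integrable law (\<lambda>z. z)" using assms not_integrable_integral_eq unfolding m by blast
  have "0 \<le> (\<integral>z. z \<partial>law)" by (rule integral_nonneg_AE) (use L.claim_pos in \<open>auto elim!: eventually_mono\<close>)
  then show "0 < claim_moment X 1" using assms unfolding m by simp
qed

lemma nn_integral_claim: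
  assumes "claim_moment X 1 \<noteq> 0"
  shows "(\<integral>\<^sup>+x. L.tail x * indicator {0..} x \<partial>lborel) = ennreal (claim_moment X 1)"
proof -
  have "(\<integral>\<^sup>+x. L.tail x * indicator {0..} x \<partial>lborel) = (\<integral>\<^sup>+z. ennreal z \<partial>law)"
    unfolding L.mean_excess_tail[symmetric]
    by (intro nn_integral_cong_AE eventually_mono[OF L.claim_pos]) auto
  also have "\<dots> = ennreal (claim_moment X 1)"
    using claim_mean_pos[OF assms]
    by (subst nn_integral_eq_integral) (auto simp: claim_moment_law intro!: eventually_mono[OF L.claim_pos])
  finally show ?thesis .
qed

lemma f_I_tail: "f_I X x = measure law {x<..} / claim_moment X 1"
  by (simp add: f_I_def one_minus_claim_cdf)

lemma one_plus_loading: "1 + loading X = premium X / (intensity X * claim_moment X 1)"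
  by (simp add: loading_def)

lemma ladder_density:
  assumes "claim_moment X 1 \<noteq> 0"
  shows "f_I X x / (1 + loading X) = L.\<kappa> * measure law {x<..}"
  using assms premium_pos intensity_pos by (simp add: f_I_tail one_plus_loading L.\<kappa>_def field_simps)

text \<open>
  Bochner integrals vanish unless they exist, so the value 1 entails that the mean claim is nonzero and
  that the integrand is integrable.
\<close>
lemma adjustment_eq_lundberg:
  assumes "adjustment_eq X r"
  shows "claim_moment X 1 \<noteq> 0" "0 < r"
    "(\<integral>\<^sup>+s. ennreal (exp (r * s)) * L.ladder s * indicator {0..} s \<partial>lborel) = 1"
proof -
  have r: "0 < r" and eq: "(LBINT x:{0..}. exp (r * x) * (f_I X x / (1 + loading X))) = 1"
    using assms by (auto simp: adjustment_eq_def)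
  show m: "claim_moment X 1 \<noteq> 0"
  proof
    assume "claim_moment X 1 = 0"
    then have "f_I X x = 0" for x by (simp add: f_I_tail)
    then show False using eq by (simp add: set_lebesgue_integral_def)
  qed
  show "0 < r" by (rule r)
  let ?f = "\<lambda>x. indicator {0..} x *\<^sub>R (exp (r * x) * (L.\<kappa> * measure law {x<..}))"
  have eq': "(\<integral>x. ?f x \<partial>lborel) = 1"
    using eq unfolding set_lebesgue_integral_def ladder_density[OF m] .
  then have int: "integrable lborel ?f" using not_integrable_integral_eq by fastforce
  have "(\<integral>\<^sup>+s. ennreal (exp (r * s)) * L.ladder s * indicator {0..} s \<partial>lborel) = (\<integral>\<^sup>+s. ennreal (?f s) \<partial>lborel)"
    using L.kappa_pos by (intro nn_integral_cong) (auto simp: indicator_def L.ladder_def tail_real ennreal_mult)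
  also have "\<dots> = 1"
  proof -
    have "AE x in lborel. 0 \<le> ?f x" using L.kappa_pos by (intro AE_I2) (auto simp: indicator_def)
    from nn_integral_eq_integral[OF int this] show ?thesis by (simp only: eq' ennreal_1)
  qed
  finally show "(\<integral>\<^sup>+s. ennreal (exp (r * s)) * L.ladder s * indicator {0..} s \<partial>lborel) = 1" .
qed

lemma adjustment_coeff_eq:
  assumes "A1 X"
  shows "adjustment_eq X (adjustment_coeff X)"
  unfolding adjustment_coeff_def
proof (rule theI')
  obtain r where r: "adjustment_eq X r" using assms by (auto simp: A1_def)
  show "\<exists>!r. adjustment_eq X r"
  proof (rule ex1I[where a=r])
    show "adjustment_eq X r" by (rule r)
    fix r' assume r': "adjustment_eq X r'"
    show "r' = r"
    proof (rule linorder_cases[of r' r])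
      assume "r' < r"
      from L.tilt_strict[OF this adjustment_eq_lundberg(3)[OF r]] show ?thesis
        using adjustment_eq_lundberg(3)[OF r'] by simp
    next
      assume "r < r'"
      from L.tilt_strict[OF this adjustment_eq_lundberg(3)[OF r']] show ?thesis
        using adjustment_eq_lundberg(3)[OF r] by simp
    qed
  qed
qed

lemma lundberg_model:
  assumes "A1 X"
  shows "lundberg law (intensity X) (premium X) (adjustment_coeff X)"
  using adjustment_eq_lundberg(2,3)[OF adjustment_coeff_eq[OF assms]] by unfold_locales

lemma claim_mean_nonzero: "A1 X \<Longrightarrow> claim_moment X 1 \<noteq> 0"
  using adjustment_eq_lundberg(1) adjustment_coeff_eq by blast

lemma tilted_moment_m_exp:
  assumes "A1 X" "A2 X k"
  shows "lundberg.tilted_moment law (intensity X) (premium X) (adjustment_coeff X) k = ennreal (m_exp X k)"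
    and "0 \<le> m_exp X k"
proof -
  interpret G: lundberg law "intensity X" "premium X" "adjustment_coeff X" by (rule lundberg_model) fact
  note m = claim_mean_nonzero[OF assms(1)]
  let ?f = "\<lambda>x. indicator {0..} x *\<^sub>R (x ^ k * exp (adjustment_coeff X * x) * (L.\<kappa> * measure law {x<..}))"
  have int: "integrable lborel ?f"
    using assms(2) unfolding A2_def set_integrable_def ladder_density[OF m] .
  have val: "m_exp X k = (\<integral>x. ?f x \<partial>lborel)"
    unfolding m_exp_def set_lebesgue_integral_def ladder_density[OF m] ..
  have pos: "0 \<le> ?f x" for x using L.kappa_pos by (auto simp: indicator_def)
  show "0 \<le> m_exp X k" unfolding val by (rule integral_nonneg_AE) (use pos in simp)
  have "G.tilted_moment k = (\<integral>\<^sup>+x. ennreal (?f x) \<partial>lborel)"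
    unfolding G.tilted_moment_def G.tilted_def L.ladder_def tail_real
    using L.kappa_pos by (intro nn_integral_cong) (auto simp: indicator_def ennreal_mult ac_simps)
  also have "\<dots> = ennreal (m_exp X k)"
    unfolding val by (rule nn_integral_eq_integral[OF int]) (use pos in simp)
  finally show "G.tilted_moment k = ennreal (m_exp X k)" .
qed

text \<open>
  By the layer cake formula the second moment of the claims is a multiple of the first moment of the
  ladder density, which is at most the first moment of the tilted density.
\<close>
lemma integrable_claim_square:
  assumes "A1 X" "A2 X k" "2 \<le> k"
  shows "integrable law (\<lambda>z. z\<^sup>2)"
proof (rule integrableI_nonneg)
  interpret G: lundberg law "intensity X" "premium X" "adjustment_coeff X" by (rule lundberg_model) fact
  have inner: "(\<integral>\<^sup>+x. ennreal (2 * x) * indicator {0..<z} x \<partial>lborel) = ennreal (z\<^sup>2)" if "0 < z" for z :: real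
  proof -
    have "(\<integral>\<^sup>+x. ennreal (2 * x) * indicator {0..<z} x \<partial>lborel) = (\<integral>\<^sup>+x. ennreal (2 * x) * indicator {0..z} x \<partial>lborel)"
      by (intro nn_integral_cong_AE eventually_mono[OF AE_lborel_singleton[of z]]) (auto simp: indicator_def)
    also have "\<dots> = ennreal (z\<^sup>2 - 0\<^sup>2)"
      by (rule nn_integral_FTC_Icc) (use that in \<open>auto intro!: derivative_eq_intros\<close>)
    finally show ?thesis by simp
  qed
  have "(\<integral>\<^sup>+z. ennreal (z\<^sup>2) \<partial>law) = (\<integral>\<^sup>+z. (\<integral>\<^sup>+x. ennreal (2 * x) * indicator {0..<z} x \<partial>lborel) \<partial>law)"
    by (intro nn_integral_cong_AE eventually_mono[OF L.claim_pos]) (simp add: inner)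
  also have "\<dots> = (\<integral>\<^sup>+x. ennreal (2 * x) * L.tail x * indicator {0..} x \<partial>lborel)"
    by (rule L.nn_integral_tail) measurable
  also have "\<dots> \<le> (\<integral>\<^sup>+x. ennreal (2 / L.\<kappa>) * (ennreal (x ^ 1) * G.tilted x * indicator {0..} x) \<partial>lborel)"
  proof (rule nn_integral_mono)
    fix x :: real
    show "ennreal (2 * x) * L.tail x * indicator {0..} x \<le> ennreal (2 / L.\<kappa>) * (ennreal (x ^ 1) * G.tilted x * indicator {0..} x)"
    proof (cases "0 \<le> x")
      case True
      have "ennreal (2 / L.\<kappa>) * ennreal x * ennreal L.\<kappa> = ennreal (2 * x)"
        using True L.kappa_pos by (simp add: ennreal_mult[symmetric])
      then have "ennreal (2 * x) * L.tail x = ennreal (2 / L.\<kappa>) * (ennreal x * L.ladder x)"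
        unfolding L.ladder_def by (simp only: mult.assoc[symmetric])
      also have "\<dots> \<le> ennreal (2 / L.\<kappa>) * (ennreal x * G.tilted x)"
        unfolding G.tilted_def by (intro mult_left_mono G.ladder_le_tilted True) auto
      finally show ?thesis using True by simp
    qed simp
  qed
  also have "\<dots> = ennreal (2 / L.\<kappa>) * G.tilted_moment 1"
    unfolding G.tilted_moment_def by (rule nn_integral_cmult) measurable
  also have "\<dots> < \<infinity>"
  proof -
    have "G.tilted_moment 1 \<le> 1 + ennreal (m_exp X k)"
      using G.tilted_moment_le[of 1 k] assms tilted_moment_m_exp(1)[OF assms(1,2)] by simp
    then have "G.tilted_moment 1 < top" by (rule le_less_trans) simp
    then show ?thesis by (simp add: ennreal_mult_less_top)
  qed
  finally show "(\<integral>\<^sup>+z. ennreal (z\<^sup>2) \<partial>law) < \<infinity>" .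
qed (auto intro: AE_I2)

lemma second_moment_pos:
  assumes "integrable law (\<lambda>z. z\<^sup>2)"
  shows "0 < claim_moment X 2"
proof -
  have m: "claim_moment X 2 = (\<integral>z. z\<^sup>2 \<partial>law)" by (rule claim_moment_law)
  have "claim_moment X 2 \<noteq> 0"
  proof
    assume "claim_moment X 2 = 0"
    then have "AE z in law. z\<^sup>2 = 0" unfolding m using integral_nonneg_eq_0_iff_AE[OF assms] by simp
    with L.claim_pos have "AE z in law. False" by eventually_elim simp
    then show False using L.AE_False by simp
  qed
  moreover have "0 \<le> claim_moment X 2" unfolding m by simp
  ultimately show ?thesis by simp
qed

text \<open>
  The tail is at most 1, so less than half of its integral, the mean claim, can come from below half the
  mean.
\<close>
lemma tail_far_mass:
  assumes "claim_moment X 1 \<noteq> 0"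
  shows "ennreal (claim_moment X 1 / 2) \<le> (\<integral>\<^sup>+x. L.tail x * indicator {claim_moment X 1 / 2..} x \<partial>lborel)" (is "_ \<le> ?Y")
proof -
  let ?m = "claim_moment X 1"
  have m: "0 < ?m" by (rule claim_mean_pos) fact
  have "ennreal ?m = (\<integral>\<^sup>+x. L.tail x * indicator {0..} x \<partial>lborel)" by (rule nn_integral_claim[symmetric]) fact
  also have "\<dots> \<le> (\<integral>\<^sup>+x. indicator {0..?m / 2} x + L.tail x * indicator {?m / 2..} x \<partial>lborel)"
    using L.tail_le_1 by (intro nn_integral_mono) (auto simp: indicator_def)
  also have "\<dots> = ennreal (?m / 2) + ?Y"
    using m by (subst nn_integral_add) auto
  finally have "ennreal ?m \<le> ennreal (?m / 2) + ?Y" .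
  then show ?thesis
  proof (cases ?Y)
    case (real y)
    with \<open>ennreal ?m \<le> ennreal (?m / 2) + ?Y\<close> m show ?thesis
      by (simp add: ennreal_plus[symmetric] ennreal_le_iff del: ennreal_plus)
  qed simp
qed

text \<open>
  The upper bound is \<open>ruin_value_ratio\<close> with \<open>u0\<close> half the mean claim: the ladder density has mass
  \<open>1 / (1 + \<theta>)\<close>, at least half of it beyond \<open>u0\<close>. For the lower bound, \<open>(1 - F_I v) / f_I v\<close> is the mean
  of \<open>Z - v\<close> given \<open>Z > v\<close>, which (A3) bounds from below by \<open>1 / h_I\<close>.
\<close>
theorem deficit_moment_bounds:
  assumes A: "A1 X" "A2 X k" and k: "2 \<le> k" and j: "j < k" and u: "0 \<le> u"
    and B: "loading X \<le> B" and E: "m_exp X k \<le> E"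
  shows "0 \<le> deficit_moment X j u" and "deficit_moment X j u \<le> deficit_bound (claim_moment X 1) B E"
    and "A3 X \<Longrightarrow> 0 < h_I X \<and> (1 / h_I X) ^ j \<le> deficit_moment X j u"
proof -
  interpret G: lundberg law "intensity X" "premium X" "adjustment_coeff X" by (rule lundberg_model) fact
  let ?m = "claim_moment X 1"
  let ?rest = "\<lambda>v. \<integral>\<^sup>+x. L.tail x * indicator {v..} x \<partial>lborel"
  let ?init = "\<lambda>v. \<integral>\<^sup>+x. L.tail x * indicator {0..v} x \<partial>lborel"
  note nz = claim_mean_nonzero[OF A(1)]
  have m: "0 < ?m" by (rule claim_mean_pos[OF nz])
  let ?psi = "ruin_value (intensity X) (premium X) law (\<lambda>y. ennreal (y ^ 0)) u"
  let ?Q = "ruin_value (intensity X) (premium X) law (\<lambda>y. ennreal (y ^ j)) u"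
  define p where "p = 1 / (2 * (1 + B))"
  define u0 where "u0 = ?m / 2"
  define K where "K = (1 + E) * (1 / p + 1 / (u0 * p))"
  have l1: "0 < 1 + loading X" using premium_pos intensity_pos m by (simp add: one_plus_loading)
  then have p: "0 < p" using B by (simp add: p_def)
  have u0: "0 < u0" using m by (simp add: u0_def)
  have E0: "0 \<le> E" using tilted_moment_m_exp(2)[OF A] E by simp
  have K0: "0 \<le> K" using E0 p u0 by (simp add: K_def)
  have far: "ennreal p \<le> (\<integral>\<^sup>+s. L.ladder s * indicator {u0..} s \<partial>lborel)"
  proof -
    have "1 + loading X = 1 / (L.\<kappa> * ?m)"
      unfolding one_plus_loading L.\<kappa>_def using premium_pos intensity_pos m by (simp add: field_simps)
    then have "1 / (L.\<kappa> * ?m) \<le> 1 + B" using B by simp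
    then have "p \<le> L.\<kappa> * (?m / 2)"
      using l1 B L.kappa_pos m by (simp add: p_def field_simps)
    then have "ennreal p \<le> ennreal L.\<kappa> * ennreal (?m / 2)"
      using L.kappa_pos m by (subst ennreal_mult[symmetric]) (auto intro: ennreal_leI)
    also have "\<dots> \<le> ennreal L.\<kappa> * (\<integral>\<^sup>+x. L.tail x * indicator {u0..} x \<partial>lborel)"
      unfolding u0_def by (intro mult_left_mono tail_far_mass nz) simp
    also have "\<dots> = (\<integral>\<^sup>+s. L.ladder s * indicator {u0..} s \<partial>lborel)"
      unfolding L.ladder_def mult.assoc by (rule nn_integral_cmult[symmetric]) measurable
    finally show ?thesis .
  qed
  have mom: "G.tilted_moment k \<le> ennreal E"
    unfolding tilted_moment_m_exp(1)[OF A] using E by (rule ennreal_leI)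
  note ratio = G.ruin_value_ratio[OF p u0 u far mom E0 j k K_def]
  show "0 \<le> deficit_moment X j u" unfolding deficit_moment_eq[OF u] by simp
  show "deficit_moment X j u \<le> deficit_bound ?m B E"
    unfolding deficit_moment_eq[OF u] deficit_bound_def Let_def p_def[symmetric] u0_def[symmetric] K_def[symmetric]
    using K0 by (intro enn2real_ratio_le ratio) simp
  assume A3: "A3 X"
  have split: "(?init v) + (?rest v) = ennreal ?m" if "0 \<le> v" for v
    unfolding nn_integral_claim[OF nz, symmetric] using that
    by (subst nn_integral_add[symmetric])
      (auto simp: indicator_def intro!: nn_integral_cong_AE eventually_mono[OF AE_lborel_singleton[of v]])
  have FI: "1 - F_I X v = enn2real (?rest v) / ?m" if v: "0 \<le> v" for v
  proof -
    have "F_I X v = enn2real (\<integral>\<^sup>+y. ennreal (indicator {0..v} y *\<^sub>R f_I X y) \<partial>lborel)"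
      unfolding F_I_def set_lebesgue_integral_def f_I_tail using m
      by (intro integral_eq_nn_integral) (auto simp: indicator_def)
    also have "(\<integral>\<^sup>+y. ennreal (indicator {0..v} y *\<^sub>R f_I X y) \<partial>lborel) = (\<integral>\<^sup>+y. ennreal (1 / ?m) * (L.tail y * indicator {0..v} y) \<partial>lborel)"
      using m by (intro nn_integral_cong) (auto simp: indicator_def f_I_tail tail_real ennreal_mult[symmetric])
    also have "\<dots> = ennreal (1 / ?m) * (\<integral>\<^sup>+y. L.tail y * indicator {0..v} y \<partial>lborel)"
      by (rule nn_integral_cmult) measurable
    finally have F: "F_I X v = enn2real (\<integral>\<^sup>+y. L.tail y * indicator {0..v} y \<partial>lborel) / ?m"
      using m by (simp add: enn2real_mult)
    have le: "(?init v) \<le> ennreal ?m" "(?rest v) \<le> ennreal ?m"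
      unfolding split[OF v, symmetric] by simp_all
    obtain x where x: "(?init v) = ennreal x" "0 \<le> x"
      using le(1) by (cases "?init v") (auto simp: top_unique)
    obtain y where y: "(?rest v) = ennreal y" "0 \<le> y"
      using le(2) by (cases "?rest v") (auto simp: top_unique)
    note xy = x y
    have "x + y = ?m" using split[OF v] xy m by (simp add: ennreal_plus[symmetric] del: ennreal_plus)
    then show ?thesis using F xy m by (simp add: field_simps)
  qed
  have rest_pos: "0 < enn2real (?rest v)"
    and rest: "(?rest v) < top" if v: "0 \<le> v" for v
  proof -
    have "(?rest v) \<le> ennreal ?m" unfolding split[OF v, symmetric] by simp
    then show fin: "(?rest v) < top" by (auto intro: le_less_trans)
    have "0 < L.tail (v + 1)" using measure_tail_pos by (simp add: tail_real)
    also have "\<dots> = (\<integral>\<^sup>+x. L.tail (v + 1) * indicator {v..v + 1} x \<partial>lborel)"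
      by (subst nn_integral_cmult_indicator) auto
    also have "\<dots> \<le> (?rest v)"
      by (intro nn_integral_mono) (auto simp: indicator_def intro!: L.tail_antimono)
    finally show "0 < enn2real (?rest v)" using fin by (simp add: enn2real_positive_iff)
  qed
  have up: "f_I X v / (1 - F_I X v) \<le> h_I X" if "0 \<le> v" for v
    unfolding h_I_def by (rule cSUP_upper) (use A3 that in \<open>auto simp: A3_def\<close>)
  have h: "0 < h_I X"
  proof -
    have "0 < f_I X 0 / (1 - F_I X 0)"
      unfolding FI[OF order_refl] f_I_tail using measure_tail_pos[of 0] rest_pos[of 0] m by simp
    then show ?thesis using up[of 0] by simp
  qed
  have lower: "ennreal (1 / h_I X) * L.tail v \<le> (?rest v)" if v: "0 \<le> v" for v
  proof -
    let ?y = "enn2real (?rest v)"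
    have "measure law {v<..} / ?y \<le> h_I X"
      using up[OF v] m unfolding FI[OF v] f_I_tail by simp
    then have "1 / h_I X * measure law {v<..} \<le> ?y" using rest_pos[OF v] h by (simp add: field_simps)
    then have "ennreal (1 / h_I X) * L.tail v \<le> ennreal ?y"
      unfolding tail_real using h by (subst ennreal_mult[symmetric]) (auto intro: ennreal_leI)
    then show ?thesis using rest[OF v] by simp
  qed
  have "?Q < \<infinity>"
    by (rule le_less_trans[OF G.power_ruin_value_le[OF u]]) simp
  then have "(1 / h_I X) ^ j \<le> deficit_moment X j u"
    unfolding deficit_moment_eq[OF u]
    using h by (intro enn2real_ratio_ge L.ruin_value_moment_lower lower u ratio(2,3)) auto
  with h show "0 < h_I X \<and> (1 / h_I X) ^ j \<le> deficit_moment X j u" by blast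
qed

end

section \<open>Matched models\<close>

lemma claim_moment_cong:
  assumes "reserve_model X" "reserve_model Y" "claim_cdf X = claim_cdf Y"
  shows "claim_moment X j = claim_moment Y j"
proof -
  interpret X: reserve_process X by unfold_locales fact
  interpret Y: reserve_process Y by unfold_locales fact
  have "real_distribution X.law" "real_distribution Y.law"
    unfolding real_distribution_def real_distribution_axioms_def
    using X.L.prob_space_axioms Y.L.prob_space_axioms X.L.sets_law Y.L.sets_law by auto
  moreover have "cdf X.law = cdf Y.law" using assms(3) by (simp add: claim_cdf_def X.law_def Y.law_def)
  ultimately have "X.law = Y.law" by (rule cdf_unique)
  then show ?thesis by (simp add: X.claim_moment_law Y.claim_moment_law)
qed

text \<open>
  The means of the reserves give equality of \<open>c - \<lambda> m\<^sub>1 = \<theta> \<lambda> m\<^sub>1\<close> in the two models, the variances give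
  equality of \<open>\<lambda> m\<^sub>2\<close>. Eliminating the intensities expresses one safety loading by the other.
\<close>
lemma matched_loading:
  assumes X: "reserve_model X" "A1 X" "A2 X k" and Y: "reserve_model Y" "A1 Y" "A2 Y k" and k: "2 \<le> k"
    and match: "\<And>i. i \<in> {1..k} \<Longrightarrow> reserve_moment X 0 1 i = reserve_moment Y 0 1 i"
  shows "loading Y = loading X * claim_moment X 1 * claim_moment Y 2 / (claim_moment X 2 * claim_moment Y 1)"
proof -
  interpret X: reserve_process X by unfold_locales fact
  interpret Y: reserve_process Y by unfold_locales fact
  have iX: "integrable X.law (\<lambda>z. z)" "integrable X.law (\<lambda>z. z\<^sup>2)" and mX: "0 < claim_moment X 1" "0 < claim_moment X 2"
    using X.claim_mean_pos[OF X.claim_mean_nonzero] X.integrable_claim_square X.second_moment_pos X k by blast+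
  have iY: "integrable Y.law (\<lambda>z. z)" "integrable Y.law (\<lambda>z. z\<^sup>2)" and mY: "0 < claim_moment Y 1" "0 < claim_moment Y 2"
    using Y.claim_mean_pos[OF Y.claim_mean_nonzero] Y.integrable_claim_square Y.second_moment_pos Y k by blast+
  have mean: "premium X - intensity X * claim_moment X 1 = premium Y - intensity Y * claim_moment Y 1"
    using match[of 1] k X.compound_poisson_moments(1)[OF iX] Y.compound_poisson_moments(1)[OF iY] by simp
  have "intensity X * claim_moment X 2 = intensity Y * claim_moment Y 2"
    using match[of 2] k X.compound_poisson_moments(2)[OF iX] Y.compound_poisson_moments(2)[OF iY] mean by simp
  then have lY: "intensity Y = intensity X * claim_moment X 2 / claim_moment Y 2" using mY by (simp add: field_simps)
  have "loading Y = (premium Y - intensity Y * claim_moment Y 1) / (intensity Y * claim_moment Y 1)"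
    using mY Y.intensity_pos by (simp add: loading_def field_simps)
  also have "\<dots> = (premium X - intensity X * claim_moment X 1) / (intensity Y * claim_moment Y 1)" unfolding mean ..
  also have "premium X - intensity X * claim_moment X 1 = loading X * intensity X * claim_moment X 1"
    using mX X.intensity_pos by (simp add: loading_def field_simps)
  also have "loading X * intensity X * claim_moment X 1 / (intensity Y * claim_moment Y 1)
     = loading X * claim_moment X 1 * claim_moment Y 2 / (claim_moment X 2 * claim_moment Y 1)"
    unfolding lY using mX mY X.intensity_pos by (simp add: field_simps)
  finally show ?thesis .
qed

theorem theorem3:
  fixes X :: "real \<Rightarrow> 'a model" and DV :: "real \<Rightarrow> 'b model"
    and \<Theta> :: "real set" and l :: real and F :: "real \<Rightarrow> real"
    and \<mu> :: "nat \<Rightarrow> real" and k j :: nat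
  assumes "k \<ge> 2" and "j \<in> {1..k - 1}"
    and "is_interval \<Theta>" and "bounded \<Theta>" and "\<Theta> \<subseteq> {0<..}"
    and "\<And>\<theta>. \<theta> \<in> \<Theta> \<Longrightarrow> reserve_model (X \<theta>)"
    and "\<And>\<theta>. \<theta> \<in> \<Theta> \<Longrightarrow> reserve_model (DV \<theta>)"
    and "\<And>\<theta>. \<theta> \<in> \<Theta> \<Longrightarrow> intensity (X \<theta>) = l"
    and "\<And>\<theta>. \<theta> \<in> \<Theta> \<Longrightarrow> claim_cdf (X \<theta>) = F"
    and "\<And>\<theta>. \<theta> \<in> \<Theta> \<Longrightarrow> premium (X \<theta>) = (1 + \<theta>) * l * claim_moment (X \<theta>) 1"
    and "\<And>\<theta> i t u. \<theta> \<in> \<Theta> \<Longrightarrow> i \<in> {1..k} \<Longrightarrow> 0 \<le> t \<Longrightarrow> 0 \<le> u \<Longrightarrow>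
           reserve_moment (X \<theta>) u t i = reserve_moment (DV \<theta>) u t i"
    and "\<And>\<theta> i. \<theta> \<in> \<Theta> \<Longrightarrow> i \<in> {1..k} \<Longrightarrow> claim_moment (DV \<theta>) i = \<mu> i"
    and "\<And>\<theta>. \<theta> \<in> \<Theta> \<Longrightarrow> A1 (X \<theta>) \<and> A2 (X \<theta>) k \<and> A3 (X \<theta>)"
    and "\<And>\<theta>. \<theta> \<in> \<Theta> \<Longrightarrow> A1 (DV \<theta>) \<and> A2 (DV \<theta>) k \<and> A3 (DV \<theta>)"
    and "bounded ((\<lambda>\<theta>. m_exp (X \<theta>) k) ` \<Theta>)"
    and "bounded ((\<lambda>\<theta>. m_exp (DV \<theta>) k) ` \<Theta>)"
    and "bounded ((\<lambda>\<theta>. h_I (DV \<theta>)) ` \<Theta>)"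
  shows "(\<exists>C\<ge>0. \<forall>u\<ge>0. \<forall>\<theta>\<in>\<Theta>.
            \<bar>deficit_moment (X \<theta>) j u - deficit_moment (DV \<theta>) j u\<bar> \<le> C) \<and>
         (\<exists>C\<ge>0. \<forall>u\<ge>0. \<forall>\<theta>\<in>\<Theta>.
            \<bar>(deficit_moment (X \<theta>) j u - deficit_moment (DV \<theta>) j u) / deficit_moment (X \<theta>) j u\<bar> \<le> C)"
proof (cases "\<Theta> = {}")
  case True
  then show ?thesis by auto
next
  case False
  then obtain \<theta>0 where \<theta>0: "\<theta>0 \<in> \<Theta>" by blast
  have k: "2 \<le> k" and j: "j < k" using assms(1,2) by auto
  define m1 where "m1 = claim_moment (X \<theta>0) 1"
  define m2 where "m2 = claim_moment (X \<theta>0) 2"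
  define h where "h = h_I (X \<theta>0)"
  have mom: "claim_moment (X \<theta>) i = claim_moment (X \<theta>0) i" if "\<theta> \<in> \<Theta>" for \<theta> i
    using claim_moment_cong[OF assms(6)[OF that] assms(6)[OF \<theta>0]] assms(9) that \<theta>0 by simp
  have hconst: "h_I (X \<theta>) = h" if "\<theta> \<in> \<Theta>" for \<theta>
    unfolding h_def h_I_def F_I_def f_I_def using mom[OF that] assms(9)[OF that] assms(9)[OF \<theta>0] by simp
  obtain B where B: "\<And>\<theta>. \<theta> \<in> \<Theta> \<Longrightarrow> \<bar>\<theta>\<bar> \<le> B" using assms(4) by (auto simp: bounded_iff)
  obtain E where E: "\<And>\<theta>. \<theta> \<in> \<Theta> \<Longrightarrow> \<bar>m_exp (X \<theta>) k\<bar> \<le> E" using assms(15) by (auto simp: bounded_iff)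
  obtain E' where E': "\<And>\<theta>. \<theta> \<in> \<Theta> \<Longrightarrow> \<bar>m_exp (DV \<theta>) k\<bar> \<le> E'" using assms(16) by (auto simp: bounded_iff)
  \<comment> \<open>by \<open>matched_loading\<close> the loading of the approximating model is \<open>\<theta>\<close> times this fixed ratio of moments\<close>
  define B' where "B' = B * \<bar>m1 * \<mu> 2 / (m2 * \<mu> 1)\<bar>"
  define C1 where "C1 = deficit_bound m1 B E"
  define C2 where "C2 = deficit_bound (\<mu> 1) B' E'"
  have X: "0 \<le> deficit_moment (X \<theta>) j u" "deficit_moment (X \<theta>) j u \<le> C1" "0 < h" "(1 / h) ^ j \<le> deficit_moment (X \<theta>) j u"
    and D: "0 \<le> deficit_moment (DV \<theta>) j u" "deficit_moment (DV \<theta>) j u \<le> C2"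
    if \<theta>: "\<theta> \<in> \<Theta>" and u: "0 \<le> u" for \<theta> u
  proof -
    interpret X: reserve_process "X \<theta>" by unfold_locales (rule assms(6)[OF \<theta>])
    interpret D: reserve_process "DV \<theta>" by unfold_locales (rule assms(7)[OF \<theta>])
    have AX: "A1 (X \<theta>)" "A2 (X \<theta>) k" "A3 (X \<theta>)" and AD: "A1 (DV \<theta>)" "A2 (DV \<theta>) k"
      using assms(13,14)[OF \<theta>] by auto
    have load: "loading (X \<theta>) = \<theta>"
      using assms(8,10)[OF \<theta>] X.intensity_pos X.claim_mean_nonzero[OF AX(1)] by (simp add: loading_def)
    have lB: "loading (X \<theta>) \<le> B" using load B[OF \<theta>] by simp
    have eE: "m_exp (X \<theta>) k \<le> E" using E[OF \<theta>] by simp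
    note bX = X.deficit_moment_bounds[OF AX(1,2) k j u lB eE]
    show "0 \<le> deficit_moment (X \<theta>) j u" by (rule bX)
    show "deficit_moment (X \<theta>) j u \<le> C1" using bX(2) mom[OF \<theta>] by (simp add: C1_def m1_def)
    show "0 < h" "(1 / h) ^ j \<le> deficit_moment (X \<theta>) j u" using bX(3)[OF AX(3)] hconst[OF \<theta>] by auto
    have "loading (DV \<theta>) = loading (X \<theta>) * claim_moment (X \<theta>) 1 * claim_moment (DV \<theta>) 2 / (claim_moment (X \<theta>) 2 * claim_moment (DV \<theta>) 1)"
      by (rule matched_loading[OF assms(6)[OF \<theta>] AX(1,2) assms(7)[OF \<theta>] AD k]) (rule assms(11)[OF \<theta>], auto)
    also have "\<dots> = \<theta> * (m1 * \<mu> 2 / (m2 * \<mu> 1))"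
      using assms(12)[OF \<theta>] k mom[OF \<theta>] by (simp add: load m1_def m2_def)
    also have "\<dots> \<le> \<bar>\<theta>\<bar> * \<bar>m1 * \<mu> 2 / (m2 * \<mu> 1)\<bar>" unfolding abs_mult[symmetric, of \<theta>] by (rule abs_ge_self)
    also have "\<dots> \<le> B'" unfolding B'_def by (intro mult_right_mono B \<theta>) simp
    finally have lB': "loading (DV \<theta>) \<le> B'" .
    have eE': "m_exp (DV \<theta>) k \<le> E'" using E'[OF \<theta>] by simp
    note bD = D.deficit_moment_bounds[OF AD k j u lB' eE']
    show "0 \<le> deficit_moment (DV \<theta>) j u" by (rule bD)
    show "deficit_moment (DV \<theta>) j u \<le> C2" using bD(2) assms(12)[OF \<theta>, of 1] k by (simp add: C2_def)
  qed
  have diff: "\<bar>deficit_moment (X \<theta>) j u - deficit_moment (DV \<theta>) j u\<bar> \<le> C1 + C2" if "\<theta> \<in> \<Theta>" "0 \<le> u" for \<theta> u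
    using X(1,2)[OF that] D[OF that] by linarith
  have C0: "0 \<le> C1 + C2" using diff[OF \<theta>0 order_refl] by linarith
  have hpos: "0 < h" by (rule X(3)[OF \<theta>0 order_refl])
  have rel: "\<bar>(deficit_moment (X \<theta>) j u - deficit_moment (DV \<theta>) j u) / deficit_moment (X \<theta>) j u\<bar> \<le> (C1 + C2) / (1 / h) ^ j"
    if "\<theta> \<in> \<Theta>" "0 \<le> u" for \<theta> u
  proof -
    have "0 < (1 / h) ^ j" using hpos by simp
    then have "0 < deficit_moment (X \<theta>) j u" using X(4)[OF that] by linarith
    then show ?thesis
      unfolding abs_divide using diff[OF that] X(4)[OF that] C0 hpos by (intro frac_le) auto
  qed
  show ?thesis
    using diff rel C0 hpos by (intro conjI exI[of _ "C1 + C2"] exI[of _ "(C1 + C2) / (1 / h) ^ j"]) auto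
qed

end
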